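(* Let $k\ge1$ be an integer and $\varepsilon>0$. There is a constant $c_k>0$ depending only on $k$ with the following property. Consider, as $n\to\infty$, degree sequences $D=D^{(n)}=(d_1,\dots,d_n)$ which are strict graphic sequences of type $\varepsilon$ and satisfy $d_n^2=o(M)$. Let $\frac12<a<1$ and put $a_1:=a-\frac12$, where $a$ is such that $\left(\frac nM\right)^{1/2}n^{3a_1}\ll1$ (i.e. tends to $0$). Define $$L_{\mathbf x}:=\frac1M\sum_{(s,T)\in\mathbb S_n^k\times\mathbb T^k}\frac{1}{\psi(s,T,D)}\left|\mathbf p_{\mathbf x}(s,T)-\widetilde{\mathbf p}(s,T)\right|$$ for $\mathbf x\in\{\mathbf a,\mathbf g,\mathbf q\}$, written $L_{\mathbf a}(a,k,D)$, $L_{\mathbf g}(k,D)$, $L_{\mathbf q}(k,D)$ respectively. Then for all sufficiently large $n$: 1. $L_{\mathbf a}(a,k,D)\le c_k\cdot\left(\frac nM\right)^{1/4}n^{a_1}$; 2. $L_{\mathbf g}(k,D)\le c_k\cdot\left(\left(\frac nM\right)^{1/4}n^{a_1}+\frac{d_n^2}{M}\right)$; 3. $L_{\mathbf q}(k,D)\le c_k\cdot\left(\left(\frac nM\right)^{1/4}n^{a_1}+\frac{d_n^2}{M}\right)$.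
   Context: Degree sequences. $D=(d_1,\dots,d_n)$ is a sequence of positive integers with $1\le d_1\le\dots\le d_n$, $M:=\sum_{i=1}^n d_i$, $[n]=\{1,\dots,n\}$. All graphs are simple graphs on the vertex set $[n]$; $\mathbb G^{D}$ is the set of graphs in which vertex $i$ has degree $d_i$ for all $i$, and $\mathcal G_{\mathbf g}(D)$ is a uniformly random element of $\mathbb G^D$. $D$ is a strict graphic sequence of type $\varepsilon$ if $M$ is even, $n^{1+\varepsilon}\le M$, and the strict Erdős–Gallai conditions hold: $\sum_{i=n-k+1}^{n}d_i<k(k-1)+\sum_{i=1}^{n-k}\min\{k,d_i\}$ for all $1\le k\le n$. Maximum entropy graph. $\mathbb P^D$ is the polytope of symmetric arrays $(x_{ij})_{1\le i\ne j\le n}$ with $0\le x_{ij}\le 1$ and $\sum_{j\ne i}x_{ij}=d_i$ for all $i$. With $H(x)=-x\ln x-(1-x)\ln(1-x)$ and $H_1(x)=\sum_{i<j}H(x_{ij})$, under the strict Erdős–Gallai conditions $H_1$ has a unique maximizer $\widetilde{\mathbf p}=(\widetilde p_{ij})$ on $\mathbb P^D$. $\widetilde{\mathcal G}(D)$ is the random graph on $[n]$ in which the edges $\langle i,j\rangle$ are independent and present with probability $\widetilde p_{ij}$. The graph $\mathcal G_{\mathbf q}(D)$ is the random graph on $[n]$ with independent edges, $\langle i,j\rangle$ being present with probability $q_{ij}:=\frac{d_id_j}{M+d_id_j}$ ($i\ne j$). Almost given degree sequence. For $\frac12<a<1$, $\mathbb G_a^D:=\bigcup\mathbb G^{\bar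 D}$, the union over all degree sequences $\bar D=(\bar d_1,\dots,\bar d_n)$ with $|d_i-\bar d_i|<d_i^a$ for all $i$. $\mathcal G_{\mathbf a}(a,D)$ is a uniformly random element of $\mathbb G_a^D$. Ordered trees. $\mathbb T^k$ is the set of (labeled) trees on vertex set $[k]$ and $\mathbb S_n^k$ is the set of injective maps $s:[k]\to[n]$. For $(s,T)\in\mathbb S_n^k\times\mathbb T^k$, with $b_u$ the degree of $u$ in $T$, put $\psi(s,T,D)=\prod_{u\in[k]}d_{s(u)}^{\,b_u-1}$. For a graph $G$ on $[n]$, $\mathbf 1_s(T,G)=1$ if $\langle s(u_1),s(u_2)\rangle$ is an edge of $G$ for every edge $\langle u_1,u_2\rangle$ of $T$, and $0$ otherwise. Finally $\mathbf p_{\mathbf g}(s,T)=E[\mathbf 1_s(T,\mathcal G_{\mathbf g}(D))]$, $\mathbf p_{\mathbf a}(s,T)=E[\mathbf 1_s(T,\mathcal G_{\mathbf a}(a,D))]$, $\mathbf p_{\mathbf q}(s,T)=E[\mathbf 1_s(T,\mathcal G_{\mathbf q}(D))]$ and $\widetilde{\mathbf p}(s,T)=E[\mathbf 1_s(T,\widetilde{\mathcal G}(D))]$. *)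

theory Defs
  imports
    "HOL-Probability.Probability"
    "HOL-Library.Landau_Symbols"
    "HOL-Library.Ramsey"
begin

text \<open>Graphs on a vertex set \<open>V\<close> are represented by their edge sets, i.e. by subsets of
  \<open>[V]\<^bsup>2\<^esup>\<close>, the set of all two-element subsets of \<open>V\<close>. A sequence
  \<open>(d\<^sub>1, \<dots>, d\<^sub>n)\<close> is a function on \<open>nat\<close> of which only the values on \<open>{1..n}\<close> matter.\<close>

subsection \<open>Degree sequences\<close>

definition degree_sequence :: "nat \<Rightarrow> (nat \<Rightarrow> nat) \<Rightarrow> bool" where
  "degree_sequence n d \<longleftrightarrow> (\<forall>i\<in>{1..n}. 1 \<le> d i) \<and> mono_on {1..n} d"

definition deg_sum :: "nat \<Rightarrow> (nat \<Rightarrow> nat) \<Rightarrow> nat" where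
  "deg_sum n d = (\<Sum>i=1..n. d i)"

definition strict_Erdos_Gallai :: "nat \<Rightarrow> (nat \<Rightarrow> nat) \<Rightarrow> bool" where
  "strict_Erdos_Gallai n d \<longleftrightarrow>
     (\<forall>k\<in>{1..n}. (\<Sum>i=n-k+1..n. d i) < k * (k - 1) + (\<Sum>i=1..n-k. min k (d i)))"

definition strict_graphic :: "real \<Rightarrow> nat \<Rightarrow> (nat \<Rightarrow> nat) \<Rightarrow> bool" where
  "strict_graphic \<epsilon> n d \<longleftrightarrow>
     degree_sequence n d \<and> even (deg_sum n d) \<and>
     real n powr (1 + \<epsilon>) \<le> real (deg_sum n d) \<and> strict_Erdos_Gallai n d"

subsection \<open>Graphs and trees\<close>

definition degree :: "'a set set \<Rightarrow> 'a \<Rightarrow> nat" where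
  "degree G v = card {e \<in> G. v \<in> e}"

definition graph_connected :: "'a set \<Rightarrow> 'a set set \<Rightarrow> bool" where
  "graph_connected V G \<longleftrightarrow> (\<forall>u\<in>V. \<forall>v\<in>V. (u, v) \<in> {(x, y). {x, y} \<in> G}\<^sup>*)"

definition graph_cycle :: "'a set set \<Rightarrow> 'a list \<Rightarrow> bool" where
  "graph_cycle G c \<longleftrightarrow> length c \<ge> 3 \<and> distinct c \<and>
     (\<forall>i<length c. {c ! i, c ! ((i + 1) mod length c)} \<in> G)"

definition trees :: "nat \<Rightarrow> nat set set set" where
  "trees k = {T. T \<subseteq> [{1..k}]\<^bsup>2\<^esup> \<and> graph_connected {1..k} T \<and> (\<nexists>c. graph_cycle T c)}"

definition graphs_with_degrees :: "nat \<Rightarrow> (nat \<Rightarrow> nat) \<Rightarrow> nat set set set" where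
  "graphs_with_degrees n d = {G. G \<subseteq> [{1..n}]\<^bsup>2\<^esup> \<and> (\<forall>i\<in>{1..n}. degree G i = d i)}"

text \<open>The union ranges over arbitrary sequences \<open>d'\<close>: positivity is automatic because
  \<open>d\<^sub>i\<^sup>a \<le> d\<^sub>i\<close> for \<open>d\<^sub>i \<ge> 1\<close> and \<open>a < 1\<close>, and \<open>d'\<close> need not be monotone, since ordering \<open>d\<close> only
  fixes the labelling of the vertices.\<close>

definition graphs_almost_degrees :: "real \<Rightarrow> nat \<Rightarrow> (nat \<Rightarrow> nat) \<Rightarrow> nat set set set" where
  "graphs_almost_degrees a n d =
     (\<Union>d' \<in> {d'. \<forall>i\<in>{1..n}. \<bar>real (d i) - real (d' i)\<bar> < real (d i) powr a}.
        graphs_with_degrees n d')"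

subsection \<open>The maximum entropy array\<close>

text \<open>Arrays are set to zero outside their index set \<open>1 \<le> i \<noteq> j \<le> n\<close>, so that an array has only
  one representation as a function.\<close>

definition degree_polytope :: "nat \<Rightarrow> (nat \<Rightarrow> nat) \<Rightarrow> (nat \<Rightarrow> nat \<Rightarrow> real) set" where
  "degree_polytope n d =
     {x. (\<forall>i j. \<not> (i \<in> {1..n} \<and> j \<in> {1..n} \<and> i \<noteq> j) \<longrightarrow> x i j = 0) \<and>
         (\<forall>i\<in>{1..n}. \<forall>j\<in>{1..n}. i \<noteq> j \<longrightarrow> x i j = x j i \<and> 0 \<le> x i j \<and> x i j \<le> 1) \<and>
         (\<forall>i\<in>{1..n}. (\<Sum>j\<in>{1..n} - {i}. x i j) = real (d i))}"

text \<open>As \<open>ln 0 = 0\<close>, the entropy function takes its continuous extension \<open>0\<close> at \<open>0\<close> and \<open>1\<close>.\<close>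

definition entropy_fn :: "real \<Rightarrow> real" where
  "entropy_fn x = - x * ln x - (1 - x) * ln (1 - x)"

definition ordered_pairs :: "nat \<Rightarrow> (nat \<times> nat) set" where
  "ordered_pairs n = {(i, j). 1 \<le> i \<and> i < j \<and> j \<le> n}"

definition array_entropy :: "nat \<Rightarrow> (nat \<Rightarrow> nat \<Rightarrow> real) \<Rightarrow> real" where
  "array_entropy n x = (\<Sum>(i, j)\<in>ordered_pairs n. entropy_fn (x i j))"

text \<open>Under the strict Erdos--Gallai conditions the maximizer exists and is unique, so the choice
  made by \<open>arg_max_on\<close> is immaterial.\<close>

definition max_entropy_array :: "nat \<Rightarrow> (nat \<Rightarrow> nat) \<Rightarrow> nat \<Rightarrow> nat \<Rightarrow> real" where
  "max_entropy_array n d = arg_max_on (array_entropy n) (degree_polytope n d)"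

subsection \<open>Random graphs\<close>

definition independent_edges_graph :: "nat \<Rightarrow> (nat \<Rightarrow> nat \<Rightarrow> real) \<Rightarrow> nat set set pmf" where
  "independent_edges_graph n p =
     map_pmf (\<lambda>f. {{i, j} |i j. (i, j) \<in> ordered_pairs n \<and> f (i, j)})
       (Pi_pmf (ordered_pairs n) False (\<lambda>(i, j). bernoulli_pmf (p i j)))"

definition G_maxent :: "nat \<Rightarrow> (nat \<Rightarrow> nat) \<Rightarrow> nat set set pmf" where
  "G_maxent n d = independent_edges_graph n (max_entropy_array n d)"

definition G_g :: "nat \<Rightarrow> (nat \<Rightarrow> nat) \<Rightarrow> nat set set pmf" where
  "G_g n d = pmf_of_set (graphs_with_degrees n d)"

definition G_a :: "real \<Rightarrow> nat \<Rightarrow> (nat \<Rightarrow> nat) \<Rightarrow> nat set set pmf" where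
  "G_a a n d = pmf_of_set (graphs_almost_degrees a n d)"

definition G_q :: "nat \<Rightarrow> (nat \<Rightarrow> nat) \<Rightarrow> nat set set pmf" where
  "G_q n d = independent_edges_graph n
     (\<lambda>i j. real (d i) * real (d j) / (real (deg_sum n d) + real (d i) * real (d j)))"

subsection \<open>Tree counts\<close>

definition inj_maps :: "nat \<Rightarrow> nat \<Rightarrow> (nat \<Rightarrow> nat) set" where
  "inj_maps k n = {s \<in> {1..k} \<rightarrow>\<^sub>E {1..n}. inj_on s {1..k}}"

text \<open>The exponent is an integer: it equals \<open>-1\<close> for the single vertex of the tree with \<open>k = 1\<close>.\<close>

definition tree_weight :: "nat \<Rightarrow> (nat \<Rightarrow> nat) \<Rightarrow> nat set set \<Rightarrow> (nat \<Rightarrow> nat) \<Rightarrow> real" where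
  "tree_weight k s T d = (\<Prod>u\<in>{1..k}. real (d (s u)) powi (int (degree T u) - 1))"

definition tree_indicator :: "(nat \<Rightarrow> nat) \<Rightarrow> nat set set \<Rightarrow> nat set set \<Rightarrow> real" where
  "tree_indicator s T G = (if \<forall>u v. {u, v} \<in> T \<longrightarrow> {s u, s v} \<in> G then 1 else 0)"

definition tree_prob :: "nat set set pmf \<Rightarrow> (nat \<Rightarrow> nat) \<Rightarrow> nat set set \<Rightarrow> real" where
  "tree_prob \<G> s T = measure_pmf.expectation \<G> (tree_indicator s T)"

definition tree_distance :: "nat set set pmf \<Rightarrow> nat \<Rightarrow> nat \<Rightarrow> (nat \<Rightarrow> nat) \<Rightarrow> real" where
  "tree_distance \<G> k n d =
     1 / real (deg_sum n d) *
     (\<Sum>(s, T) \<in> inj_maps k n \<times> trees k.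
        1 / tree_weight k s T d * \<bar>tree_prob \<G> s T - tree_prob (G_maxent n d) s T\<bar>)"

definition L_a :: "real \<Rightarrow> nat \<Rightarrow> nat \<Rightarrow> (nat \<Rightarrow> nat) \<Rightarrow> real" where
  "L_a a k n d = tree_distance (G_a a n d) k n d"

definition L_g :: "nat \<Rightarrow> nat \<Rightarrow> (nat \<Rightarrow> nat) \<Rightarrow> real" where
  "L_g k n d = tree_distance (G_g n d) k n d"

definition L_q :: "nat \<Rightarrow> nat \<Rightarrow> (nat \<Rightarrow> nat) \<Rightarrow> real" where
  "L_q k n d = tree_distance (G_q n d) k n d"

end

theory Submission
  imports Defs "HOL-Real_Asymp.Real_Asymp"
begin

text \<open>Let \<open>p\<close> be the maximum entropy array and \<open>\<eta> = (n/M)\<^bsup>1/4\<^esup> n\<^bsup>a-1/2\<^esup>\<close>. Perturbing \<open>p\<close> along 4-cycles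
  gives the relations that a switching argument would give for edge probabilities, hence
  \<open>p\<^sub>i\<^sub>j = d\<^sub>i d\<^sub>j / M (1 + O(d\<^sub>n\<^sup>2 / M))\<close>; this yields the bound for \<open>L_q\<close>.

  For \<open>L_a\<close> and \<open>L_g\<close>: all graphs with degree sequence \<open>d\<close> have the same probability under the
  maximum entropy graph, and a sample of the latter can be turned into such a graph by changing
  \<open>O(\<surd>(nM))\<close> edges. So the uniform distribution on any family of graphs with degrees close to \<open>d\<close> that
  contains these graphs has density at most \<open>exp (M \<eta>\<^sup>2)\<close> with respect to the maximum entropy graph.
  Weighted tree counts, truncated to be Lipschitz in each edge, have subgaussian exponential moments
  of order \<open>exp (O(l\<^sup>2 M))\<close>, so under the uniform distribution they exceed their mean by at most
  \<open>O(M \<eta>)\<close>. With the indicator of the positive part as test function this bounds the positive part of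
  the difference of the tree probabilities. The negative part follows because the total weighted
  number of trees is nearly \<open>M\<close> for every graph with degrees close to \<open>d\<close>.\<close>

section \<open>Independent random subsets\<close>

text \<open>The size of \<eta> comes from a budget. A uniform family with total degree deviation
  about sqrt(nM) n^(a-1/2) has log-density about that deviation times log n, because every edge
  altered in a repair costs a factor polynomial in n. One more factor n^(a-1/2) swallows the
  logarithm, and the product is M \<eta>^2. An exponential moment with parameter l turns a
  log-density K into an error K/l + O(l M), and l of order \<eta> balances both terms at M \<eta>.
  Such an l is admissible in the moment bound once \<eta> is bounded, which is what the limit
  hypothesis on a supplies. Two features make this affordable. The moment bound scales with the
  expected number of edges and not with the number of pairs, since the factor p e is kept at every
  edge. And no precise count of graphs is needed: when d_n^2 is small against M, a graph can be
  repaired locally, so the number of realizations is at least exp(entropy) up to a factor whose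
  logarithm is O(sqrt(nM) log n).\<close>

definition subset_weight :: "('a \<Rightarrow> real) \<Rightarrow> 'a set \<Rightarrow> 'a set \<Rightarrow> real" where
  "subset_weight p E G = (\<Prod>e\<in>E. if e \<in> G then p e else 1 - p e)"

text \<open>A finite sum instead of an integral: induction on \<open>E\<close> by conditioning on
  one element then needs no integrability. \<open>expectation_Pi_pmf_bernoulli\<close> links it to
  the random graphs.\<close>

definition subset_expectation :: "('a \<Rightarrow> real) \<Rightarrow> 'a set \<Rightarrow> ('a set \<Rightarrow> real) \<Rightarrow> real" where
  "subset_expectation p E X = (\<Sum>G\<in>Pow E. subset_weight p E G * X G)"

lemma subset_weight_nonneg:
  assumes "\<And>e. e \<in> E \<Longrightarrow> 0 \<le> p e \<and> p e \<le> 1"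
  shows "0 \<le> subset_weight p E G"
  unfolding subset_weight_def using assms by (intro prod_nonneg) auto

lemma subset_expectation_empty [simp]: "subset_expectation p {} X = X {}"
  by (simp add: subset_expectation_def subset_weight_def)

lemma subset_expectation_insert:
  assumes "finite E" "x \<notin> E"
  shows "subset_expectation p (insert x E) X =
    p x * subset_expectation p E (\<lambda>G. X (insert x G)) + (1 - p x) * subset_expectation p E X"
proof -
  have w1: "subset_weight p (insert x E) (insert x G) = p x * subset_weight p E G" for G
    unfolding subset_weight_def using assms by (auto intro!: prod.cong)
  have w2: "subset_weight p (insert x E) G = (1 - p x) * subset_weight p E G" if "G \<subseteq> E" for G
    unfolding subset_weight_def using assms that by (auto intro!: prod.cong)
  have inj: "inj_on (insert x) (Pow E)"
    using assms(2) by (auto simp: inj_on_def)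
  have "subset_expectation p (insert x E) X =
      (\<Sum>G\<in>Pow E. subset_weight p (insert x E) G * X G)
      + (\<Sum>G\<in>insert x ` Pow E. subset_weight p (insert x E) G * X G)"
    unfolding subset_expectation_def Pow_insert using assms
    by (intro sum.union_disjoint) auto
  also have "(\<Sum>G\<in>insert x ` Pow E. subset_weight p (insert x E) G * X G) =
      p x * subset_expectation p E (\<lambda>G. X (insert x G))"
    by (simp add: sum.reindex[OF inj] w1 subset_expectation_def sum_distrib_left mult.assoc)
  also have "(\<Sum>G\<in>Pow E. subset_weight p (insert x E) G * X G) = (1 - p x) * subset_expectation p E X"
    unfolding subset_expectation_def sum_distrib_left by (intro sum.cong) (auto simp: w2)
  finally show ?thesis by simp
qed

lemma subset_expectation_mono:
  assumes "\<And>e. e \<in> E \<Longrightarrow> 0 \<le> p e \<and> p e \<le> 1"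
    and "\<And>G. G \<subseteq> E \<Longrightarrow> X G \<le> Y G"
  shows "subset_expectation p E X \<le> subset_expectation p E Y"
  unfolding subset_expectation_def
  using assms by (intro sum_mono mult_left_mono subset_weight_nonneg) auto

lemma subset_expectation_const:
  "finite E \<Longrightarrow> subset_expectation p E (\<lambda>_. c) = c"
  by (induction E rule: finite_induct) (auto simp: subset_expectation_insert algebra_simps)

lemma subset_expectation_mult:
  "subset_expectation p E (\<lambda>G. c * X G) = c * subset_expectation p E X"
  by (simp add: subset_expectation_def sum_distrib_left mult_ac)

lemma subset_expectation_add:
  "subset_expectation p E (\<lambda>G. X G + Y G) = subset_expectation p E X + subset_expectation p E Y"
  by (simp add: subset_expectation_def algebra_simps sum.distrib)

lemma subset_expectation_sum:
  "subset_expectation p E (\<lambda>G. \<Sum>i\<in>I. X i G) = (\<Sum>i\<in>I. subset_expectation p E (X i))"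
  unfolding subset_expectation_def sum_distrib_left by (rule sum.swap)

lemma subset_expectation_subset:
  assumes "finite E" "T \<subseteq> E"
  shows "subset_expectation p E (\<lambda>G. of_bool (T \<subseteq> G)) = (\<Prod>e\<in>T. p e)"
  using assms
proof (induction E arbitrary: T rule: finite_induct)
  case (insert x E)
  show ?case
  proof (cases "x \<in> T")
    case True
    have "subset_expectation p E (\<lambda>G. of_bool (T \<subseteq> insert x G))
        = subset_expectation p E (\<lambda>G. of_bool (T - {x} \<subseteq> G))"
      using True by (simp add: subset_insert_iff cong: if_cong)
    also have "\<dots> = prod p (T - {x})"
      using insert.prems by (intro insert.IH) auto
    finally have 1: "subset_expectation p E (\<lambda>G. of_bool (T \<subseteq> insert x G)) = prod p (T - {x})" .
    have "subset_expectation p E (\<lambda>G. of_bool (T \<subseteq> G)) = subset_expectation p E (\<lambda>_. 0)"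
      unfolding subset_expectation_def using True insert.hyps by (intro sum.cong) auto
    then show ?thesis
      using True insert.hyps insert.prems 1
      by (simp add: subset_expectation_insert subset_expectation_const prod.remove finite_subset)
  next
    case False
    then have "T \<subseteq> E" using insert.prems by auto
    with False insert show ?thesis
      by (simp add: subset_expectation_insert subset_insert algebra_simps)
  qed
qed simp

text \<open>The variance formula for independent centred terms. The offset \<open>t\<close> is there
  for the induction: conditioning on \<open>x\<close> shifts it by \<open>c x * (1 - p x)\<close> or
  by \<open>- c x * p x\<close>, with mean zero.\<close>

lemma subset_expectation_square:
  assumes "finite E"
  shows "subset_expectation p E (\<lambda>G. ((\<Sum>e\<in>E. c e * (of_bool (e \<in> G) - p e)) + t)\<^sup>2)
    = t\<^sup>2 + (\<Sum>e\<in>E. (c e)\<^sup>2 * (p e * (1 - p e)))"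
  using assms
proof (induction E arbitrary: t rule: finite_induct)
  case (insert x E)
  have 1: "subset_expectation p E (\<lambda>G. ((\<Sum>e\<in>insert x E. c e * (of_bool (e \<in> insert x G) - p e)) + t)\<^sup>2)
     = subset_expectation p E (\<lambda>G. ((\<Sum>e\<in>E. c e * (of_bool (e \<in> G) - p e)) + (t + c x * (1 - p x)))\<^sup>2)"
  proof -
    have "(\<Sum>e\<in>insert x E. c e * (of_bool (e \<in> insert x G) - p e)) + t =
       (\<Sum>e\<in>E. c e * (of_bool (e \<in> G) - p e)) + (t + c x * (1 - p x))" for G
    proof -
      have "(\<Sum>e\<in>E. c e * (of_bool (e \<in> insert x G) - p e)) = (\<Sum>e\<in>E. c e * (of_bool (e \<in> G) - p e))"
        using insert.hyps by (intro sum.cong) auto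
      then show ?thesis using insert.hyps by simp
    qed
    then show ?thesis by (rule_tac arg_cong[where f = "subset_expectation p E"]) (simp only:)
  qed
  have 2: "subset_expectation p E (\<lambda>G. ((\<Sum>e\<in>insert x E. c e * (of_bool (e \<in> G) - p e)) + t)\<^sup>2)
     = subset_expectation p E (\<lambda>G. ((\<Sum>e\<in>E. c e * (of_bool (e \<in> G) - p e)) + (t - c x * p x))\<^sup>2)"
    unfolding subset_expectation_def
  proof (rule sum.cong[OF refl])
    fix G assume "G \<in> Pow E"
    then have "x \<notin> G" using insert.hyps by auto
    then have "(\<Sum>e\<in>insert x E. c e * (of_bool (e \<in> G) - p e)) + t
       = (\<Sum>e\<in>E. c e * (of_bool (e \<in> G) - p e)) + (t - c x * p x)"
      using insert.hyps by simp
    then show "subset_weight p E G * ((\<Sum>e\<in>insert x E. c e * (of_bool (e \<in> G) - p e)) + t)\<^sup>2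
      = subset_weight p E G * ((\<Sum>e\<in>E. c e * (of_bool (e \<in> G) - p e)) + (t - c x * p x))\<^sup>2"
      by (simp only:)
  qed
  show ?case
    unfolding subset_expectation_insert[OF insert.hyps] 1 2 insert.IH
    using insert.hyps by (simp add: power2_eq_square algebra_simps)
qed simp

text \<open>From \<open>exp u \<le> 1 + u + u^2\<close> on the unit interval and
  \<open>1 + z \<le> exp z\<close>. The quadratic term keeps the factor \<open>q\<close>, so that
  summing over edges yields \<open>sum p E\<close>, which is at most \<open>M\<close>, and not the
  number of all pairs.\<close>

lemma two_point_exp_bound:
  fixes a b l C q :: real
  assumes "0 \<le> q" "q \<le> 1" "a \<le> b" "b - a \<le> C" "0 \<le> l" "l * C \<le> 1"
  shows "q * exp (l * b) + (1 - q) * exp (l * a) \<le> exp (l * (q * b + (1 - q) * a) + l\<^sup>2 * C\<^sup>2 * q)"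
proof -
  define u where "u = l * (b - a)"
  have uC: "u \<le> l * C" unfolding u_def using assms by (intro mult_left_mono) auto
  have u: "0 \<le> u" "u \<le> 1" using uC assms by (auto simp: u_def)
  have u2: "u\<^sup>2 \<le> l\<^sup>2 * C\<^sup>2" using uC u by (metis power_mono power_mult_distrib)
  have "q * exp (l * b) + (1 - q) * exp (l * a) = exp (l * a) * (1 + q * (exp u - 1))"
    by (simp add: u_def algebra_simps exp_diff)
  also have "\<dots> \<le> exp (l * a) * exp (q * (u + u\<^sup>2))"
  proof (intro mult_left_mono)
    have "1 + q * (exp u - 1) \<le> 1 + q * (u + u\<^sup>2)"
      using exp_bound[OF u] assms(1) by (intro add_left_mono mult_left_mono) auto
    also have "\<dots> \<le> exp (q * (u + u\<^sup>2))" by (rule exp_ge_add_one_self)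
    finally show "1 + q * (exp u - 1) \<le> exp (q * (u + u\<^sup>2))" .
  qed simp
  also have "\<dots> = exp (l * a + q * u + q * u\<^sup>2)"
    by (simp add: exp_add[symmetric] algebra_simps)
  also have "\<dots> \<le> exp (l * a + q * u + q * (l\<^sup>2 * C\<^sup>2))"
    using u2 assms by (simp add: mult_left_mono)
  also have "l * a + q * u + q * (l\<^sup>2 * C\<^sup>2) = l * (q * b + (1 - q) * a) + l\<^sup>2 * C\<^sup>2 * q"
    by (simp add: u_def algebra_simps)
  finally show ?thesis .
qed

text \<open>A martingale argument by induction: averaging over the presence of \<open>x\<close>
  leaves a function \<open>Y\<close> of the remaining set that is again increasing with increments
  at most \<open>C\<close>.\<close>

lemma subset_expectation_exp_le:
  assumes "finite E" "\<And>e. e \<in> E \<Longrightarrow> 0 \<le> p e \<and> p e \<le> 1"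
    and "\<And>e G. e \<in> E \<Longrightarrow> G \<subseteq> E \<Longrightarrow> e \<notin> G \<Longrightarrow> X G \<le> X (insert e G) \<and> X (insert e G) - X G \<le> C"
    and "0 \<le> l" "l * C \<le> 1"
  shows "subset_expectation p E (\<lambda>G. exp (l * X G))
    \<le> exp (l * subset_expectation p E X + l\<^sup>2 * C\<^sup>2 * sum p E)"
  using assms(1-3)
proof (induction E arbitrary: X rule: finite_induct)
  case (insert x E)
  define Y where "Y G = p x * X (insert x G) + (1 - p x) * X G" for G
  have p: "0 \<le> p x" "p x \<le> 1" using insert.prems by auto
  have "subset_expectation p (insert x E) (\<lambda>G. exp (l * X G)) =
      subset_expectation p E (\<lambda>G. p x * exp (l * X (insert x G)) + (1 - p x) * exp (l * X G))"
    by (simp add: subset_expectation_insert insert.hyps subset_expectation_mult subset_expectation_add)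
  also have "\<dots> \<le> subset_expectation p E (\<lambda>G. exp (l\<^sup>2 * C\<^sup>2 * p x) * exp (l * Y G))"
  proof (rule subset_expectation_mono)
    fix G assume G: "G \<subseteq> E"
    have "X G \<le> X (insert x G) \<and> X (insert x G) - X G \<le> C"
      using insert.prems(2)[of x G] G insert.hyps by auto
    then have "p x * exp (l * X (insert x G)) + (1 - p x) * exp (l * X G)
       \<le> exp (l * Y G + l\<^sup>2 * C\<^sup>2 * p x)"
      unfolding Y_def using p assms(4,5) by (intro two_point_exp_bound) auto
    then show "p x * exp (l * X (insert x G)) + (1 - p x) * exp (l * X G)
       \<le> exp (l\<^sup>2 * C\<^sup>2 * p x) * exp (l * Y G)"
      by (simp add: exp_add mult.commute)
  qed (use insert.prems in auto)
  also have "\<dots> = exp (l\<^sup>2 * C\<^sup>2 * p x) * subset_expectation p E (\<lambda>G. exp (l * Y G))"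
    by (rule subset_expectation_mult)
  also have "\<dots> \<le> exp (l\<^sup>2 * C\<^sup>2 * p x) * exp (l * subset_expectation p E Y + l\<^sup>2 * C\<^sup>2 * sum p E)"
  proof (intro mult_left_mono insert.IH)
    fix e G assume e: "e \<in> E" "G \<subseteq> E" "e \<notin> G"
    have a: "X G \<le> X (insert e G)" "X (insert e G) - X G \<le> C"
      using insert.prems(2)[of e G] e by auto
    have "X (insert x G) \<le> X (insert e (insert x G)) \<and> X (insert e (insert x G)) - X (insert x G) \<le> C"
      using e insert.hyps by (intro insert.prems(2)) auto
    then have b: "X (insert x G) \<le> X (insert x (insert e G))"
        "X (insert x (insert e G)) - X (insert x G) \<le> C"
      by (simp_all add: insert_commute)
    have "Y (insert e G) - Y G = p x * (X (insert x (insert e G)) - X (insert x G))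
       + (1 - p x) * (X (insert e G) - X G)"
      by (simp add: Y_def algebra_simps)
    moreover have "\<dots> \<le> p x * C + (1 - p x) * C"
      using a b p by (intro add_mono mult_left_mono) auto
    moreover have "\<dots> = C" by (simp add: algebra_simps)
    moreover have "0 \<le> p x * (X (insert x (insert e G)) - X (insert x G))
       + (1 - p x) * (X (insert e G) - X G)"
      using a b p by (intro add_nonneg_nonneg mult_nonneg_nonneg) auto
    ultimately show "Y G \<le> Y (insert e G) \<and> Y (insert e G) - Y G \<le> C" by linarith
  qed (use insert.prems in auto)
  also have "subset_expectation p E Y = subset_expectation p (insert x E) X"
    unfolding Y_def
    by (simp add: subset_expectation_insert insert.hyps subset_expectation_mult subset_expectation_add)
  also have "exp (l\<^sup>2 * C\<^sup>2 * p x) * exp (l * subset_expectation p (insert x E) X + l\<^sup>2 * C\<^sup>2 * sum p E)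
    = exp (l * subset_expectation p (insert x E) X + l\<^sup>2 * C\<^sup>2 * sum p (insert x E))"
    using insert.hyps by (simp add: exp_add[symmetric] algebra_simps)
  finally show ?case .
qed simp

section \<open>Transfer between finite sums and product distributions\<close>

lemma finite_set_Pi_pmf_bool:
  assumes "finite A"
  shows "finite (set_pmf (Pi_pmf A dflt (p :: 'a \<Rightarrow> bool pmf)))"
proof (rule finite_subset)
  show "set_pmf (Pi_pmf A dflt p) \<subseteq> PiE_dflt A dflt (\<lambda>_. UNIV)"
    using set_Pi_pmf_subset'[OF assms, of dflt p] by (force simp: PiE_dflt_def)
qed (simp add: assms finite_PiE_dflt)

lemma expectation_Pi_pmf_bernoulli:
  assumes "finite A" "inj_on h A" "\<And>i. i \<in> A \<Longrightarrow> 0 \<le> p (h i) \<and> p (h i) \<le> 1"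
  shows "measure_pmf.expectation (Pi_pmf A False (\<lambda>i. bernoulli_pmf (p (h i)))) (\<lambda>f. X {h i |i. i \<in> A \<and> f i})
    = subset_expectation p (h ` A) (X :: 'b set \<Rightarrow> real)"
  using assms
proof (induction A arbitrary: X rule: finite_induct)
  case (insert x A)
  let ?B = "\<lambda>i. bernoulli_pmf (p (h i))"
  have fin: "finite (set_pmf (Pi_pmf A False ?B))"
    by (rule finite_set_Pi_pmf_bool) (rule insert.hyps)
  have upd: "{h i |i. i \<in> insert x A \<and> (f(x := y)) i} = (if y then insert (h x) {h i |i. i \<in> A \<and> f i} else {h i |i. i \<in> A \<and> f i})" for f y
  proof -
    have "{h i |i. i \<in> insert x A \<and> (f(x := y)) i} = {h i |i. i = x \<and> y} \<union> {h i |i. i \<in> A \<and> f i}"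
    proof -
      have "i \<in> insert x A \<and> (f(x := y)) i \<longleftrightarrow> (i = x \<and> y) \<or> (i \<in> A \<and> f i)" for i
        using insert.hyps(2) by auto
      then show ?thesis by blast
    qed
    then show ?thesis by (cases y) auto
  qed
  have "measure_pmf.expectation (Pi_pmf (insert x A) False ?B) (\<lambda>f. X {h i |i. i \<in> insert x A \<and> f i})
     = measure_pmf.expectation (?B x) (\<lambda>y. measure_pmf.expectation (Pi_pmf A False ?B)
         (\<lambda>f. X {h i |i. i \<in> insert x A \<and> (f(x := y)) i}))"
  proof -
    have "Pi_pmf (insert x A) False ?B
        = bind_pmf (?B x) (\<lambda>y. map_pmf (\<lambda>f. f(x := y)) (Pi_pmf A False ?B))"
      by (simp only: Pi_pmf_insert'[OF insert.hyps(1,2)] map_pmf_def)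
    moreover have "finite (set_pmf (map_pmf (\<lambda>f. f(x := y)) (Pi_pmf A False ?B)))" for y
      using fin by simp
    ultimately show ?thesis
      by (simp only: pmf_expectation_bind[where A = UNIV] finite subset_UNIV
          integral_map_pmf integral_measure_pmf_real[where A = UNIV] UNIV_I)
        (simp add: mult.commute)
  qed
  also have "\<dots> = p (h x) * measure_pmf.expectation (Pi_pmf A False ?B) (\<lambda>f. X (insert (h x) {h i |i. i \<in> A \<and> f i}))
      + (1 - p (h x)) * measure_pmf.expectation (Pi_pmf A False ?B) (\<lambda>f. X {h i |i. i \<in> A \<and> f i})"
    using insert.prems unfolding upd by (subst integral_bernoulli_pmf) auto
  also have "\<dots> = p (h x) * subset_expectation p (h ` A) (\<lambda>G. X (insert (h x) G))
      + (1 - p (h x)) * subset_expectation p (h ` A) X"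
    using insert.IH[of "\<lambda>G. X (insert (h x) G)"] insert.IH[of X] insert.prems by simp
  also have "\<dots> = subset_expectation p (h ` insert x A) X"
    using insert.hyps insert.prems by (simp add: subset_expectation_insert)
  finally show ?case .
qed simp

section \<open>Graphs close to a degree sequence\<close>

lemma degree_insert:
  "finite G \<Longrightarrow> e \<notin> G \<Longrightarrow> degree (insert e G) v = degree G v + of_bool (v \<in> e)"
proof -
  assume a: "finite G" "e \<notin> G"
  have "{e' \<in> insert e G. v \<in> e'} = (if v \<in> e then insert e {e' \<in> G. v \<in> e'} else {e' \<in> G. v \<in> e'})"
    by auto
  then show ?thesis using a by (simp add: degree_def)
qed

lemma degree_remove:
  "finite G \<Longrightarrow> e \<in> G \<Longrightarrow> degree G v = degree (G - {e}) v + of_bool (v \<in> e)"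
  using degree_insert[of "G - {e}" e v] by (simp add: insert_absorb)

lemma degree_empty [simp]: "degree {} v = 0"
  by (simp add: degree_def)

lemma degree_mono: "finite G \<Longrightarrow> H \<subseteq> G \<Longrightarrow> degree H v \<le> degree G v"
  unfolding degree_def by (intro card_mono) auto

lemma finite_graph: "finite V \<Longrightarrow> G \<subseteq> [V]\<^bsup>2\<^esup> \<Longrightarrow> finite G"
  using finite_imp_finite_nsets finite_subset by blast

lemma sum_degree:
  assumes "finite V" "G \<subseteq> [V]\<^bsup>2\<^esup>"
  shows "(\<Sum>v\<in>V. degree G v) = 2 * card G"
proof -
  have "finite G" using assms by (rule finite_graph)
  then show ?thesis using assms(2)
  proof (induction G rule: finite_induct)
    case (insert e G)
    have e: "e \<subseteq> V" "card e = 2" using insert.prems by (auto simp: nsets_def)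
    have "(\<Sum>v\<in>V. degree (insert e G) v) = (\<Sum>v\<in>V. degree G v) + (\<Sum>v\<in>V. of_bool (v \<in> e))"
      by (simp add: degree_insert[OF insert.hyps] sum.distrib)
    also have "(\<Sum>v\<in>V. of_bool (v \<in> e)) = card e"
      using e assms(1) by (simp add: Int_absorb1)
    finally show ?case using insert e by simp
  qed simp
qed

lemma degree_eq_card_neighbours:
  assumes "finite V" "G \<subseteq> [V]\<^bsup>2\<^esup>"
  shows "degree G x = card {y \<in> V. {x, y} \<in> G}"
proof -
  have "{e \<in> G. x \<in> e} = (\<lambda>y. {x, y}) ` {y \<in> V. {x, y} \<in> G}"
  proof (intro equalityI subsetI)
    fix e assume "e \<in> {e \<in> G. x \<in> e}"
    then have e: "e \<in> G" "x \<in> e" "e \<in> [V]\<^bsup>2\<^esup>" using assms by auto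
    then obtain a b where ab: "e = {a, b}" "a \<in> V" "b \<in> V" "a \<noteq> b" by (rule_tac nsets2_E) auto
    then have "\<exists>y\<in>V. e = {x, y}" using e(2) by auto
    then show "e \<in> (\<lambda>y. {x, y}) ` {y \<in> V. {x, y} \<in> G}" using e(1) by auto
  qed auto
  moreover have "inj_on (\<lambda>y. {x, y}) {y \<in> V. {x, y} \<in> G}"
    by (auto simp: inj_on_def doubleton_eq_iff)
  ultimately show ?thesis by (simp add: degree_def card_image)
qed

section \<open>Repairing a graph to a prescribed degree sequence\<close>

lemma card_edges_meeting:
  assumes "finite B" "finite G" "\<And>v. v \<in> B \<Longrightarrow> degree G v \<le> D"
  shows "card {e \<in> G. e \<inter> B \<noteq> {}} \<le> card B * D"
proof -
  have "{e \<in> G. e \<inter> B \<noteq> {}} = (\<Union>v\<in>B. {e \<in> G. v \<in> e})" by auto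
  then have "card {e \<in> G. e \<inter> B \<noteq> {}} \<le> (\<Sum>v\<in>B. degree G v)"
    using card_UN_le[OF assms(1)] by (simp add: degree_def)
  also have "\<dots> \<le> card B * D" using sum_bounded_above[of B "degree G" D] assms(3) by simp
  finally show ?thesis .
qed

text \<open>A vertex of degree below \<open>D\<close> has a closed neighbourhood of at most
  \<open>D\<close> vertices, so at most \<open>2 * D * D\<close> edges meet the closed
  neighbourhoods of \<open>x\<close> and \<open>y\<close>; any other edge will do. The case
  \<open>x = y\<close> is included.\<close>

lemma exists_disjoint_edge:
  assumes V: "finite V" "G \<subseteq> [V]\<^bsup>2\<^esup>"
    and deg: "\<And>v. v \<in> V \<Longrightarrow> degree G v \<le> D"
    and xy: "x \<in> V" "y \<in> V" "degree G x < D" "degree G y < D"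
    and large: "2 * D * D < card G"
  obtains z w where "{z, w} \<in> G" "z \<noteq> w" "z \<noteq> x" "z \<noteq> y" "w \<noteq> x" "w \<noteq> y"
    "{x, z} \<notin> G" "{y, w} \<notin> G" "{x, w} \<notin> G" "z \<in> V" "w \<in> V"
proof -
  let ?N = "\<lambda>x. {y \<in> V. {x, y} \<in> G}"
  define B where "B = insert x (?N x) \<union> insert y (?N y)"
  have finG: "finite G" using V by (rule finite_graph)
  have BV: "B \<subseteq> V" "finite B" using xy V(1) by (auto simp: B_def)
  have "card (insert x (?N x)) \<le> D" "card (insert y (?N y)) \<le> D"
    using card_insert_le_m1[of D "?N x" x] card_insert_le_m1[of D "?N y" y] xy
      degree_eq_card_neighbours[OF V] by auto
  then have cB: "card B \<le> 2 * D"
    unfolding B_def using card_Un_le[of "insert x (?N x)" "insert y (?N y)"] by linarith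
  have "card {e \<in> G. e \<inter> B \<noteq> {}} \<le> card B * D"
    using BV deg by (intro card_edges_meeting finG) auto
  also have "\<dots> \<le> 2 * D * D" using cB by simp
  finally have "card {e \<in> G. e \<inter> B \<noteq> {}} < card G" using large by linarith
  then have "{e \<in> G. e \<inter> B \<noteq> {}} \<noteq> G" by (metis less_irrefl)
  then obtain e where e: "e \<in> G" "e \<inter> B = {}" by blast
  then have "e \<in> [V]\<^bsup>2\<^esup>" using V by auto
  then obtain z w where zw: "e = {z, w}" "z \<in> V" "w \<in> V" "z \<noteq> w" by (rule nsets2_E)
  with e have "z \<notin> B" "w \<notin> B" by auto
  with zw e(1) show ?thesis by (intro that[of z w]) (auto simp: B_def)
qed

text \<open>If two deficient vertices are not adjacent, join them. Otherwise the deficient vertices form a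
  clique, so there are few of them and \<open>G\<close> has many edges; then some edge \<open>zw\<close> is far enough from
  deficient vertices \<open>x\<close>, \<open>y\<close> to be replaced by \<open>xz\<close> and \<open>yw\<close>.\<close>

lemma exists_augmentation:
  fixes d :: "'a \<Rightarrow> nat"
  assumes V: "finite V" "G \<subseteq> [V]\<^bsup>2\<^esup>"
    and deg: "\<And>v. v \<in> V \<Longrightarrow> degree G v \<le> d v" and dD: "\<And>v. v \<in> V \<Longrightarrow> d v \<le> D"
    and ev: "even (sum d V)" and large: "5 * D\<^sup>2 < sum d V" and less: "2 * card G < sum d V"
  shows "\<exists>G'. G' \<subseteq> [V]\<^bsup>2\<^esup> \<and> (\<forall>v\<in>V. degree G' v \<le> d v) \<and> card G' = card G + 1
    \<and> card ((G - G') \<union> (G' - G)) \<le> 3"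
proof -
  define Z where "Z = {v \<in> V. degree G v < d v}"
  have finG: "finite G" using V by (rule finite_graph)
  have finZ: "finite Z" using V by (simp add: Z_def)
  have sd: "sum d V = 2 * card G + (\<Sum>v\<in>V. d v - degree G v)"
  proof -
    have "sum d V = (\<Sum>v\<in>V. degree G v + (d v - degree G v))" using deg by (intro sum.cong) auto
    then show ?thesis using sum_degree[OF V] by (simp only: sum.distrib)
  qed
  have sZ: "(\<Sum>v\<in>V. d v - degree G v) = (\<Sum>v\<in>Z. d v - degree G v)"
    unfolding Z_def using V deg by (intro sum.mono_neutral_right) (auto simp: not_less)
  have "Z \<noteq> {}" using sd sZ less by auto
  show ?thesis
  proof (cases "\<exists>x\<in>Z. \<exists>y\<in>Z. x \<noteq> y \<and> {x, y} \<notin> G")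
    case True
    then obtain x y where xy: "x \<in> Z" "y \<in> Z" "x \<noteq> y" "{x, y} \<notin> G" by auto
    let ?G = "insert {x, y} G"
    have "?G \<subseteq> [V]\<^bsup>2\<^esup>" using xy V by (auto simp: Z_def)
    moreover have "degree ?G v \<le> d v" if "v \<in> V" for v
      using xy deg[OF that] by (auto simp: degree_insert[OF finG xy(4)] Z_def)
    moreover have "card ?G = card G + 1" using xy finG by simp
    moreover have "(G - ?G) \<union> (?G - G) = {{x, y}}" using xy by auto
    ultimately show ?thesis by (intro exI[of _ ?G]) auto
  next
    case False
    have "card Z \<le> D"
    proof -
      obtain x where x: "x \<in> Z" using \<open>Z \<noteq> {}\<close> by auto
      have "Z - {x} \<subseteq> {y \<in> V. {x, y} \<in> G}" using False x by (auto simp: Z_def)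
      then have "card (Z - {x}) \<le> degree G x"
        unfolding degree_eq_card_neighbours[OF V] by (intro card_mono) (auto simp: V)
      moreover have "degree G x < D" using x dD[of x] by (auto simp: Z_def)
      ultimately show ?thesis using x finZ by simp
    qed
    have "(\<Sum>v\<in>Z. d v - degree G v) \<le> card Z * D"
      using sum_bounded_above[of Z "\<lambda>v. d v - degree G v" D] dD
      by (auto simp: Z_def le_diff_conv trans_le_add1)
    also have "\<dots> \<le> D\<^sup>2" using \<open>card Z \<le> D\<close> by (simp add: power2_eq_square)
    \<comment> \<open>This is where the 5 comes from: the total deficit is at most
      \<open>D\<^sup>2\<close>, so \<open>2 * card G\<close> still exceeds
      \<open>4 * D\<^sup>2\<close>.\<close>
    finally have cG: "2 * D * D < card G" using sd sZ large by (simp add: power2_eq_square)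
    \<comment> \<open>\<open>x = y\<close> is allowed if this vertex lacks at least 2. That happens
      when \<open>Z\<close> is a single vertex: its deficit is even because \<open>sum d V\<close>
      and the degree sum are.\<close>
    have "\<exists>x y. x \<in> Z \<and> y \<in> Z \<and> (x = y \<longrightarrow> degree G x + 2 \<le> d x)"
    proof (cases "\<exists>x\<in>Z. \<exists>y\<in>Z. x \<noteq> y")
      case False
      then obtain x where x: "Z = {x}" using \<open>Z \<noteq> {}\<close> by blast
      have "even (d x - degree G x)" using ev sd sZ x by simp
      moreover have "degree G x < d x" using x by (auto simp: Z_def)
      ultimately have "degree G x + 2 \<le> d x"
        by presburger
      then show ?thesis using x by auto
    qed blast
    then obtain x y where xy: "x \<in> Z" "y \<in> Z" "x = y \<longrightarrow> degree G x + 2 \<le> d x" by blast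
    have dx: "x \<in> V" "y \<in> V" "degree G x < d x" "degree G y < d y" using xy by (auto simp: Z_def)
    obtain z w where zw: "{z, w} \<in> G" "z \<noteq> w" "z \<noteq> x" "z \<noteq> y" "w \<noteq> x" "w \<noteq> y"
      "{x, z} \<notin> G" "{y, w} \<notin> G" "{x, w} \<notin> G" "z \<in> V" "w \<in> V"
    proof (rule exists_disjoint_edge[OF V _ dx(1,2) _ _ cG])
      show "degree G v \<le> D" if "v \<in> V" for v using deg dD that le_trans by blast
      show "degree G x < D" "degree G y < D" using dx dD less_le_trans by blast+
    qed
    let ?H = "G - {{z, w}}"
    let ?G = "insert {x, z} (insert {y, w} ?H)"
    have ne: "{x, z} \<noteq> {y, w}" using zw by (auto simp: doubleton_eq_iff)
    have G: "?G \<subseteq> [V]\<^bsup>2\<^esup>" using V dx zw by auto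
    have degG: "degree ?G v = degree G v + of_bool (v = x) + of_bool (v = y)" for v
      using zw ne finG degree_remove[OF finG zw(1), of v] by (auto simp: degree_insert)
    have "degree ?G v \<le> d v" if "v \<in> V" for v
      unfolding degG using dx xy(3) deg[OF that] by auto
    moreover have "card ?G = card G + 1"
    proof -
      have "card G > 0" using zw(1) finG by (auto simp: card_gt_0_iff)
      then show ?thesis using zw ne finG by simp
    qed
    moreover have "card ((G - ?G) \<union> (?G - G)) \<le> 3"
    proof -
      have "(G - ?G) \<union> (?G - G) \<subseteq> {{z, w}, {x, z}, {y, w}}" by auto
      then have "card ((G - ?G) \<union> (?G - G)) \<le> card {{z, w}, {x, z}, {y, w}}" by (intro card_mono) auto
      also have "\<dots> \<le> 3" by (simp add: card_insert_if)
      finally show ?thesis .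
    qed
    ultimately show ?thesis using G by (intro exI[of _ ?G]) auto
  qed
qed

lemma card_sym_diff_trans:
  assumes "finite A" "finite B" "finite C"
  shows "card ((A - C) \<union> (C - A)) \<le> card ((A - B) \<union> (B - A)) + card ((B - C) \<union> (C - B))"
proof -
  have "card ((A - C) \<union> (C - A)) \<le> card (((A - B) \<union> (B - A)) \<union> ((B - C) \<union> (C - B)))"
    using assms by (intro card_mono) auto
  also have "\<dots> \<le> card ((A - B) \<union> (B - A)) + card ((B - C) \<union> (C - B))" by (rule card_Un_le)
  finally show ?thesis .
qed

text \<open>Iterates \<open>exists_augmentation\<close>: each round lowers the deficit
  \<open>sum d V - 2 * card G\<close> by 2 and alters at most 3 edges, hence the ratio 3 to
  2.\<close>

lemma exists_completion:
  fixes d :: "'a \<Rightarrow> nat"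
  assumes V: "finite V" "G \<subseteq> [V]\<^bsup>2\<^esup>"
    and deg: "\<And>v. v \<in> V \<Longrightarrow> degree G v \<le> d v" and dD: "\<And>v. v \<in> V \<Longrightarrow> d v \<le> D"
    and ev: "even (sum d V)" and large: "5 * D\<^sup>2 < sum d V"
  shows "\<exists>G'. G' \<subseteq> [V]\<^bsup>2\<^esup> \<and> (\<forall>v\<in>V. degree G' v = d v) 
    \<and> 2 * card ((G - G') \<union> (G' - G)) \<le> 3 * (sum d V - 2 * card G)"
  using V(2) deg
proof (induction "sum d V - 2 * card G" arbitrary: G rule: less_induct)
  case less
  have le: "2 * card G \<le> sum d V"
    using sum_degree[OF V(1) less.prems(1)] sum_mono[of V "degree G" d] less.prems(2) by simp
  show ?case
  proof (cases "2 * card G = sum d V")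
    case True
    then have "degree G v = d v" if "v \<in> V" for v
      using sum_mono_inv[of "degree G" V d v] sum_degree[OF V(1) less.prems(1)] less.prems(2) that V(1)
      by auto
    then show ?thesis using less.prems by (intro exI[of _ G]) auto
  next
    case False
    then obtain G1 where G1: "G1 \<subseteq> [V]\<^bsup>2\<^esup>" "\<forall>v\<in>V. degree G1 v \<le> d v" "card G1 = card G + 1"
      "card ((G - G1) \<union> (G1 - G)) \<le> 3"
      using exists_augmentation[OF V(1) less.prems(1,2) dD ev large] le by auto
    have le1: "2 * card G1 \<le> sum d V"
      using sum_degree[OF V(1) G1(1)] sum_mono[of V "degree G1" d] G1(2) by simp
    obtain G' where G': "G' \<subseteq> [V]\<^bsup>2\<^esup>" "\<forall>v\<in>V. degree G' v = d v"
      "2 * card ((G1 - G') \<union> (G' - G1)) \<le> 3 * (sum d V - 2 * card G1)"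
    proof -
      have "sum d V - 2 * card G1 < sum d V - 2 * card G" using G1(3) le1 by linarith
      then show ?thesis using less.hyps[OF _ G1(1)] G1(2) that by blast
    qed
    have "card ((G - G') \<union> (G' - G)) \<le> card ((G - G1) \<union> (G1 - G)) + card ((G1 - G') \<union> (G' - G1))"
      using finite_graph[OF V(1)] less.prems(1) G1(1) G'(1) by (intro card_sym_diff_trans) auto
    then have "2 * card ((G - G') \<union> (G' - G)) \<le> 3 * (sum d V - 2 * card G)"
      using G'(3) G1(3,4) le1 by linarith
    then show ?thesis using G' by blast
  qed
qed

text \<open>Delete an edge at a vertex whose degree is too large; every deletion lowers the total
  excess by at least 1. The other end may become deficient, which is left to
  \<open>exists_completion\<close>.\<close>

lemma exists_trimming:
  fixes d :: "'a \<Rightarrow> nat"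
  assumes V: "finite V" "G \<subseteq> [V]\<^bsup>2\<^esup>"
  shows "\<exists>H\<subseteq>G. (\<forall>v\<in>V. degree H v \<le> d v) \<and> card (G - H) \<le> (\<Sum>v\<in>V. degree G v - d v)"
  using V(2)
proof (induction "card G" arbitrary: G rule: less_induct)
  case less
  have finG: "finite G" using V(1) less.prems by (rule finite_graph)
  show ?case
  proof (cases "\<forall>v\<in>V. degree G v \<le> d v")
    case False
    then obtain x where x: "x \<in> V" "d x < degree G x" by (auto simp: not_le)
    then have "{e \<in> G. x \<in> e} \<noteq> {}" unfolding degree_def by (metis card.empty not_less_zero)
    then obtain e where e: "e \<in> G" "x \<in> e" by auto
    let ?G = "G - {e}"
    have "card ?G < card G" using e finG by (meson card_Diff1_less)
    moreover have "?G \<subseteq> [V]\<^bsup>2\<^esup>" using less.prems by auto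
    ultimately obtain H where H: "H \<subseteq> ?G" "\<forall>v\<in>V. degree H v \<le> d v"
      "card (?G - H) \<le> (\<Sum>v\<in>V. degree ?G v - d v)"
      using less.hyps[of ?G] by auto
    have "(\<Sum>v\<in>V. degree ?G v - d v) < (\<Sum>v\<in>V. degree G v - d v)"
    proof (rule sum_strict_mono_ex1)
      show "\<forall>v\<in>V. degree ?G v - d v \<le> degree G v - d v"
        using degree_mono[OF finG, of ?G] by (auto intro: diff_le_mono)
      show "\<exists>v\<in>V. degree ?G v - d v < degree G v - d v"
        using x e degree_remove[OF finG e(1), of x] by (intro bexI[of _ x]) auto
    qed (rule V)
    moreover have "card (G - H) \<le> card (?G - H) + 1"
    proof -
      have "G - H \<subseteq> insert e (?G - H)" by auto
      then have "card (G - H) \<le> card (insert e (?G - H))" using finG by (intro card_mono) auto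
      also have "\<dots> \<le> card (?G - H) + 1" using finG by (simp add: card_insert_if)
      finally show ?thesis .
    qed
    ultimately show ?thesis using H by (intro exI[of _ H]) auto
  qed (auto intro: exI[of _ G])
qed

text \<open>Trimming, then completing. With \<open>ex\<close> and \<open>de\<close> the total excess
  and deficit, trimming costs at most \<open>ex\<close> edges, so the trimmed graph has deficit at
  most \<open>de + ex\<close> and the whole repair costs at most \<open>ex + 3/2 (de + ex)\<close>.
  Applied to the empty graph, it also shows that a realization exists.\<close>

lemma exists_near_realization:
  fixes d :: "'a \<Rightarrow> nat"
  assumes V: "finite V" "G \<subseteq> [V]\<^bsup>2\<^esup>" and dD: "\<And>v. v \<in> V \<Longrightarrow> d v \<le> D"
    and ev: "even (sum d V)" and large: "5 * D\<^sup>2 < sum d V"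
  shows "\<exists>G'. G' \<subseteq> [V]\<^bsup>2\<^esup> \<and> (\<forall>v\<in>V. degree G' v = d v)
    \<and> real (card ((G - G') \<union> (G' - G))) \<le> 3 * (\<Sum>v\<in>V. \<bar>real (degree G v) - real (d v)\<bar>)"
proof -
  obtain H where H: "H \<subseteq> G" "\<forall>v\<in>V. degree H v \<le> d v" "card (G - H) \<le> (\<Sum>v\<in>V. degree G v - d v)"
    using exists_trimming[OF V] by metis
  have HV: "H \<subseteq> [V]\<^bsup>2\<^esup>" using H V by auto
  obtain G' where G': "G' \<subseteq> [V]\<^bsup>2\<^esup>" "\<forall>v\<in>V. degree G' v = d v"
    "2 * card ((H - G') \<union> (G' - H)) \<le> 3 * (sum d V - 2 * card H)"
    using exists_completion[OF V(1) HV _ dD ev large] H(2) by auto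
  have fin: "finite G" "finite H" "finite G'" using finite_graph[OF V(1)] V HV G' by auto
  define ex where "ex = (\<Sum>v\<in>V. degree G v - d v)"
  define de where "de = (\<Sum>v\<in>V. d v - degree G v)"
  have "(\<Sum>v\<in>V. degree G v) + de = sum d V + ex"
    unfolding ex_def de_def sum.distrib[symmetric] by (intro sum.cong) auto
  then have 1: "2 * card G + de = sum d V + ex" using sum_degree[OF V] by simp
  have 2: "card G = card H + card (G - H)"
    using H(1) fin by (metis card_Diff_subset card_mono le_add_diff_inverse)
  have "card ((G - G') \<union> (G' - G)) \<le> card ((G - H) \<union> (H - G)) + card ((H - G') \<union> (G' - H))"
    using fin by (intro card_sym_diff_trans)
  also have "(G - H) \<union> (H - G) = G - H" using H(1) by auto
  finally have 3: "card ((G - G') \<union> (G' - G)) \<le> card (G - H) + card ((H - G') \<union> (G' - H))" .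
  have 4: "card (G - H) \<le> ex" using H(3) by (simp only: ex_def)
  have "sum d V - 2 * card H \<le> de + ex" using 1 2 4 by linarith
  then have "2 * card ((H - G') \<union> (G' - H)) \<le> 3 * (de + ex)"
    using G'(3) by (meson le_trans mult_le_mono2)
  then have "2 * card ((G - G') \<union> (G' - G)) \<le> 2 * ex + 3 * (de + ex)"
    using 3 4 by linarith
  moreover have "c \<le> 3 * (de + ex)" if "2 * c \<le> 2 * ex + 3 * (de + ex)" for c :: nat
    using that by simp
  ultimately have "card ((G - G') \<union> (G' - G)) \<le> 3 * (de + ex)" by blast
  moreover have "real (de + ex) = (\<Sum>v\<in>V. \<bar>real (degree G v) - real (d v)\<bar>)"
    unfolding de_def ex_def sum.distrib[symmetric] of_nat_sum by (intro sum.cong) auto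
  ultimately have "real (card ((G - G') \<union> (G' - G))) \<le> 3 * (\<Sum>v\<in>V. \<bar>real (degree G v) - real (d v)\<bar>)"
    by (metis of_nat_le_iff of_nat_mult of_nat_numeral)
  then show ?thesis using G' by blast
qed

section \<open>The maximum entropy array\<close>

lemma continuous_on_mult_ln: "continuous_on {0..1} (\<lambda>x::real. x * ln x)"
  unfolding continuous_on_eq_continuous_within
proof
  fix x :: real assume x: "x \<in> {0..1}"
  show "continuous (at x within {0..1}) (\<lambda>x. x * ln x)"
  proof (cases "x = 0")
    case True
    have "((\<lambda>x::real. x * ln x) \<longlongrightarrow> 0) (at_right 0)" by real_asymp
    then show ?thesis by (simp add: True continuous_within at_within_Icc_at_right)
  next
    case False
    with x show ?thesis by (intro continuous_intros) auto
  qed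
qed

lemma continuous_on_entropy_fn: "continuous_on {0..1} entropy_fn"
proof -
  have "continuous_on {0..1} ((\<lambda>x::real. x * ln x) \<circ> (\<lambda>x. 1 - x))"
    by (rule continuous_on_compose)
      (auto intro!: continuous_intros continuous_on_subset[OF continuous_on_mult_ln])
  then have "continuous_on {0..1} (\<lambda>x::real. - (x * ln x) - (1 - x) * ln (1 - x))"
    using continuous_on_mult_ln unfolding o_def
    by (intro continuous_on_diff continuous_on_minus)
  then show ?thesis by (simp add: entropy_fn_def[abs_def])
qed

lemma has_real_derivative_entropy_fn:
  assumes "0 < x" "x < 1"
  shows "(entropy_fn has_real_derivative (ln (1 - x) - ln x)) (at x)"
proof -
  have "((\<lambda>x::real. - x * ln x - (1 - x) * ln (1 - x)) has_real_derivative (ln (1 - x) - ln x)) (at x)"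
    using assms by (auto intro!: derivative_eq_intros)
  then show ?thesis by (simp add: entropy_fn_def[abs_def])
qed

text \<open>Although \<open>entropy_fn\<close> has infinite slope at the end points, boundary values need no separate
  treatment: the derivative is used only at positive \<open>t\<close>, where all arguments lie inside \<open>{0<..<1}\<close>.\<close>

lemma entropy_exchange:
  fixes a b c e :: real
  assumes "0 \<le> a" "a \<le> 1" "0 \<le> b" "b \<le> 1" "0 \<le> c" "c \<le> 1" "0 \<le> e" "e \<le> 1"
    and gt: "c * e * (1 - a) * (1 - b) < a * b * (1 - c) * (1 - e)"
  obtains t where "0 < t" "t \<le> a" "t \<le> b" "t \<le> 1 - c" "t \<le> 1 - e"
    "entropy_fn a + entropy_fn b + entropy_fn c + entropy_fn e
     < entropy_fn (a - t) + entropy_fn (b - t) + entropy_fn (c + t) + entropy_fn (e + t)"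
proof -
  have "0 \<le> c * e * (1 - a) * (1 - b)" using assms by simp
  then have "0 < a * b * (1 - c) * (1 - e)" using gt by linarith
  then have pos: "0 < a" "0 < b" "0 < 1 - c" "0 < 1 - e"
    using assms by (auto simp: zero_less_mult_iff)
  \<comment> \<open>The derivative of the four-term entropy sum at \<open>t\<close> is the logarithm
    of the quotient of these two products. Their difference has the same sign for small positive
    \<open>t\<close> and, unlike the logarithms, is continuous at 0.\<close>
  define \<phi> where "\<phi> t = (a - t) * (b - t) * (1 - c - t) * (1 - e - t)
    - (c + t) * (e + t) * (1 - a + t) * (1 - b + t)" for t
  have "continuous (at 0) \<phi>" unfolding \<phi>_def[abs_def] by (intro continuous_intros)
  moreover have "0 < \<phi> 0" using gt by (simp add: \<phi>_def)
  ultimately have "\<forall>\<^sub>F t in at 0. 0 < \<phi> t"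
    unfolding continuous_at by (rule order_tendstoD)
  then obtain r where r: "r > 0" "\<And>t. t \<noteq> 0 \<Longrightarrow> dist t 0 < r \<Longrightarrow> 0 < \<phi> t"
    unfolding eventually_at by auto
  define m where "m = Min {r, a, b, 1 - c, 1 - e}"
  define s where "s = m / 2"
  have "0 < m" using r pos by (simp add: m_def)
  moreover have "m \<le> x" if "x \<in> {r, a, b, 1 - c, 1 - e}" for x
    unfolding m_def using that by (intro Min_le) auto
  then have "m \<le> r" "m \<le> a" "m \<le> b" "m \<le> 1 - c" "m \<le> 1 - e" by blast+
  ultimately have s: "0 < s" "s < r" "s < a" "s < b" "s < 1 - c" "s < 1 - e"
    unfolding s_def by linarith+
  define f where "f t = entropy_fn (a - t) + entropy_fn (b - t) + entropy_fn (c + t) + entropy_fn (e + t)" for t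
  have "f 0 < f s"
  proof (rule DERIV_pos_imp_increasing_open[OF s(1)])
    fix t assume t: "0 < t" "t < s"
    have i: "0 < a - t" "a - t < 1" "0 < b - t" "b - t < 1" "0 < c + t" "c + t < 1" "0 < e + t" "e + t < 1"
      using t s assms by auto
    let ?f' = "(ln (1 - (a - t)) - ln (a - t)) * (0 - 1) + (ln (1 - (b - t)) - ln (b - t)) * (0 - 1)
      + (ln (1 - (c + t)) - ln (c + t)) * (0 + 1) + (ln (1 - (e + t)) - ln (e + t)) * (0 + 1)"
    have "(f has_real_derivative ?f') (at t)"
      unfolding f_def[abs_def]
      by (intro DERIV_add DERIV_chain2[OF has_real_derivative_entropy_fn] DERIV_diff DERIV_const DERIV_ident i)
    moreover have "0 < ?f'"
    proof -
      have "0 < \<phi> t" using r(2)[of t] t s by (auto simp: dist_real_def)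
      then have "(c + t) * (e + t) * (1 - (a - t)) * (1 - (b - t)) <
          (a - t) * (b - t) * (1 - (c + t)) * (1 - (e + t))"
        by (simp add: \<phi>_def algebra_simps)
      then have "ln ((c + t) * (e + t) * (1 - (a - t)) * (1 - (b - t))) <
          ln ((a - t) * (b - t) * (1 - (c + t)) * (1 - (e + t)))"
        using i by (intro ln_less_cancel_iff[THEN iffD2] mult_pos_pos) auto
      moreover have "ln ((c + t) * (e + t) * (1 - (a - t)) * (1 - (b - t)))
         = ln (c + t) + ln (e + t) + ln (1 - (a - t)) + ln (1 - (b - t))"
        using i by (simp add: ln_mult_pos)
      moreover have "ln ((a - t) * (b - t) * (1 - (c + t)) * (1 - (e + t)))
         = ln (a - t) + ln (b - t) + ln (1 - (c + t)) + ln (1 - (e + t))"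
        using i by (simp add: ln_mult_pos)
      ultimately show ?thesis by simp
    qed
    ultimately show "\<exists>y. (f has_real_derivative y) (at t) \<and> 0 < y" by blast
  next
    have C: "continuous_on {0..s} (\<lambda>t. entropy_fn (g t))"
      if "continuous_on {0..s} g" "g ` {0..s} \<subseteq> {0..1}"
      for g
      using that by (rule continuous_on_compose2[OF continuous_on_entropy_fn])
    show "continuous_on {0..s} f"
      unfolding f_def[abs_def] using s assms by (intro continuous_on_add C continuous_intros) auto
  qed
  then show ?thesis using s by (intro that[of s]) (auto simp: f_def)
qed

text \<open>Functions on two-element sets have the symmetry built in. This converts them to the
  arrays of \<open>degree_polytope\<close>, with the zero entries required off the index set;
  \<open>maxent_prob\<close> goes back.\<close>

definition pair_array :: "nat \<Rightarrow> (nat set \<Rightarrow> real) \<Rightarrow> nat \<Rightarrow> nat \<Rightarrow> real" where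
  "pair_array n y i j = (if i \<in> {1..n} \<and> j \<in> {1..n} \<and> i \<noteq> j then y {i, j} else 0)"

definition maxent_prob :: "nat \<Rightarrow> (nat \<Rightarrow> nat) \<Rightarrow> nat set \<Rightarrow> real" where
  "maxent_prob n d e = max_entropy_array n d (Min e) (Max e)"

lemma sum_ordered_pairs:
  "(\<Sum>(i, j)\<in>ordered_pairs n. f i j) = (\<Sum>e\<in>[{1..n}]\<^bsup>2\<^esup>. f (Min e) (Max e))"
proof (rule sum.reindex_bij_witness[where j = "\<lambda>(i, j). {i, j}" and i = "\<lambda>e. (Min e, Max e)"])
  fix e assume e: "e \<in> [{1..n}]\<^bsup>2\<^esup>"
  then obtain a b where ab: "e = {a, b}" "a \<in> {1..n}" "b \<in> {1..n}" "a \<noteq> b" by (rule nsets2_E)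
  then show "(Min e, Max e) \<in> ordered_pairs n" "(case (Min e, Max e) of (i, j) \<Rightarrow> {i, j}) = e"
    by (auto simp: ordered_pairs_def min_def max_def)
qed (auto simp: ordered_pairs_def)

lemma array_entropy_eq:
  "array_entropy n x = (\<Sum>e\<in>[{1..n}]\<^bsup>2\<^esup>. entropy_fn (x (Min e) (Max e)))"
  unfolding array_entropy_def by (rule sum_ordered_pairs)

lemma pair_array_Min_Max:
  assumes "e \<in> [{1..n}]\<^bsup>2\<^esup>"
  shows "pair_array n y (Min e) (Max e) = y e"
proof -
  obtain a b where ab: "e = {a, b}" "a \<in> {1..n}" "b \<in> {1..n}" "a \<noteq> b" using assms by (rule nsets2_E)
  then show ?thesis by (auto simp: pair_array_def min_def max_def insert_commute)
qed

lemma pair_array_in_polytope_iff: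
  "pair_array n y \<in> degree_polytope n d \<longleftrightarrow>
    (\<forall>e\<in>[{1..n}]\<^bsup>2\<^esup>. 0 \<le> y e \<and> y e \<le> 1) \<and> (\<forall>i\<in>{1..n}. (\<Sum>j\<in>{1..n} - {i}. y {i, j}) = real (d i))"
proof -
  have 1: "(\<Sum>j\<in>{1..n} - {i}. pair_array n y i j) = (\<Sum>j\<in>{1..n} - {i}. y {i, j})" if "i \<in> {1..n}" for i
    using that by (intro sum.cong) (auto simp: pair_array_def)
  have 2: "(\<forall>e\<in>[{1..n}]\<^bsup>2\<^esup>. 0 \<le> y e \<and> y e \<le> 1) \<longleftrightarrow>
    (\<forall>i\<in>{1..n}. \<forall>j\<in>{1..n}. i \<noteq> j \<longrightarrow> 0 \<le> y {i, j} \<and> y {i, j} \<le> 1)"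
    by (auto simp: nsets_2_eq)
  show ?thesis
    unfolding 2 degree_polytope_def mem_Collect_eq
    using 1 by (auto simp: pair_array_def insert_commute)
qed

text \<open>The arrays live in an infinite product of lines. The polytope is a closed subset of the
  cube with all coordinates in the unit interval, which is compact by Tychonoff; the prescribed
  zeros put the remaining coordinates there as well.\<close>

lemma compact_degree_polytope: "compact (degree_polytope n d)"
proof -
  let ?K = "PiE UNIV (\<lambda>_. PiE UNIV (\<lambda>_. {0..1})) :: (nat \<Rightarrow> nat \<Rightarrow> real) set"
  have c1: "compact (PiE UNIV (\<lambda>_. {0..1}) :: (nat \<Rightarrow> real) set)"
    unfolding compactin_euclidean_iff[symmetric] euclidean_product_topology[symmetric]
    by (subst compactin_PiE) auto
  have "compactin (product_topology (\<lambda>_. euclidean) UNIV) ?K"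
    by (subst compactin_PiE) (simp add: c1)
  then have cK: "compact ?K"
    by (simp only: euclidean_product_topology compactin_euclidean_iff)
  have cont: "continuous_on UNIV (\<lambda>x :: nat \<Rightarrow> nat \<Rightarrow> real. x i j)" for i j
    by (rule continuous_on_product_then_coordinatewise[OF continuous_on_product_then_coordinatewise[OF continuous_on_id]])
  have ci: "closed {x :: nat \<Rightarrow> nat \<Rightarrow> real. Q \<longrightarrow> P x}" if "closed {x. P x}" for P Q
    using that by (cases Q) auto
  have "closed (degree_polytope n d)"
    unfolding degree_polytope_def Ball_def
    by (intro closed_Collect_conj closed_Collect_all ci closed_Collect_eq closed_Collect_le
        continuous_on_const continuous_on_sum cont)
  moreover have "degree_polytope n d \<subseteq> ?K"
  proof
    fix x assume x: "x \<in> degree_polytope n d"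
    have "0 \<le> x i j \<and> x i j \<le> 1" for i j
    proof (cases "i \<in> {1..n} \<and> j \<in> {1..n} \<and> i \<noteq> j")
      case True
      with x show ?thesis unfolding degree_polytope_def mem_Collect_eq by blast
    next
      case False
      with x have "x i j = 0" unfolding degree_polytope_def mem_Collect_eq by blast
      then show ?thesis by simp
    qed
    then show "x \<in> ?K" by auto
  qed
  ultimately show ?thesis using cK by (metis compact_Int_closed inf.absorb2)
qed

lemma continuous_on_array_entropy: "continuous_on (degree_polytope n d) (array_entropy n)"
proof -
  have "continuous_on (degree_polytope n d) (\<lambda>x. entropy_fn (x (Min e) (Max e)))"
    if e: "e \<in> [{1..n}]\<^bsup>2\<^esup>" for e
  proof -
    obtain a b where ab: "e = {a, b}" "a \<in> {1..n}" "b \<in> {1..n}" "a \<noteq> b" using e by (rule nsets2_E)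
    have "0 \<le> x (Min e) (Max e) \<and> x (Min e) (Max e) \<le> 1" if "x \<in> degree_polytope n d" for x
      using that ab unfolding degree_polytope_def by (cases "a \<le> b") (auto simp: min_def max_def)
    then show ?thesis
      by (intro continuous_on_compose2[OF continuous_on_entropy_fn
            continuous_on_product_then_coordinatewise[OF continuous_on_product_then_coordinatewise[OF continuous_on_id]]]) auto
  qed
  then have "continuous_on (degree_polytope n d) (\<lambda>x. \<Sum>e\<in>[{1..n}]\<^bsup>2\<^esup>. entropy_fn (x (Min e) (Max e)))"
    by (intro continuous_on_sum)
  then show ?thesis by (simp add: array_entropy_eq[abs_def])
qed

text \<open>\<open>arg_max_on\<close> is a choice operator; compactness and continuity provide a
  maximizer for it to choose.\<close>

lemma max_entropy_array_maximal:
  assumes "degree_polytope n d \<noteq> {}"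
  shows "max_entropy_array n d \<in> degree_polytope n d"
    and "x \<in> degree_polytope n d \<Longrightarrow> array_entropy n x \<le> array_entropy n (max_entropy_array n d)"
proof -
  obtain x0 where x0: "x0 \<in> degree_polytope n d" 
    "\<forall>y\<in>degree_polytope n d. array_entropy n y \<le> array_entropy n x0"
    using continuous_attains_sup[OF compact_degree_polytope assms continuous_on_array_entropy] by blast
  then have "is_arg_max (array_entropy n) (\<lambda>x. x \<in> degree_polytope n d) x0"
    by (auto simp: is_arg_max_def not_less)
  then have "is_arg_max (array_entropy n) (\<lambda>x. x \<in> degree_polytope n d) (max_entropy_array n d)"
    unfolding max_entropy_array_def arg_max_on_def arg_max_def
    by (rule someI[where P = "is_arg_max (array_entropy n) (\<lambda>x. x \<in> degree_polytope n d)"])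
  then show "max_entropy_array n d \<in> degree_polytope n d"
    "x \<in> degree_polytope n d \<Longrightarrow> array_entropy n x \<le> array_entropy n (max_entropy_array n d)"
    by (auto simp: is_arg_max_def not_less)
qed

lemma pair_array_maxent_prob:
  assumes "degree_polytope n d \<noteq> {}"
  shows "pair_array n (maxent_prob n d) = max_entropy_array n d"
proof (intro ext)
  fix i j
  show "pair_array n (maxent_prob n d) i j = max_entropy_array n d i j"
    using max_entropy_array_maximal(1)[OF assms]
    by (cases "i \<le> j") (auto simp: degree_polytope_def pair_array_def maxent_prob_def min_def max_def)
qed

lemma sum_doubleton_indicator:
  fixes a b m n :: nat
  assumes "a \<in> {1..n}" "b \<in> {1..n}" "a \<noteq> b" "m \<in> {1..n}"
  shows "(\<Sum>j\<in>{1..n} - {m}. of_bool ({m, j} = {a, b})) = (of_bool (m = a) + of_bool (m = b) :: real)"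
proof -
  have "(\<Sum>j\<in>{1..n} - {m}. of_bool ({m, j} = {a, b})) = (\<Sum>j\<in>{1..n} - {m}. if m = a then of_bool (j = b) else if m = b then of_bool (j = a) else (0::real))"
    using assms(3) by (intro sum.cong) (auto simp: doubleton_eq_iff)
  also have "\<dots> = of_bool (m = a) + of_bool (m = b)"
    using assms by (auto simp: of_bool_def sum.delta)
  finally show ?thesis .
qed

section \<open>Sparse degree sequences\<close>

declare One_nat_def [simp del]

lemma sum_edges_at_vertex:
  fixes f :: "nat set \<Rightarrow> real"
  assumes "i \<in> {1..n}"
  shows "(\<Sum>e\<in>[{1..n}]\<^bsup>2\<^esup>. of_bool (i \<in> e) * f e) = (\<Sum>j\<in>{1..n} - {i}. f {i, j})"
proof -
  have fin: "finite ([{1..n}]\<^bsup>2\<^esup>)" by (rule finite_imp_finite_nsets) simp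
  have "(\<Sum>e\<in>[{1..n}]\<^bsup>2\<^esup>. of_bool (i \<in> e) * f e) = (\<Sum>e\<in>{e\<in>[{1..n}]\<^bsup>2\<^esup>. i \<in> e}. f e)"
    using fin by (simp add: sum.If_cases Int_def flip: sum.inter_filter)
  also have "{e\<in>[{1..n}]\<^bsup>2\<^esup>. i \<in> e} = (\<lambda>j. {i, j}) ` ({1..n} - {i})"
    using assms by (auto simp: nsets_2_eq)
  also have "(\<Sum>e\<in>(\<lambda>j. {i, j}) ` ({1..n} - {i}). f e) = (\<Sum>j\<in>{1..n} - {i}. f {i, j})"
    by (subst sum.reindex) (auto simp: inj_on_def doubleton_eq_iff)
  finally show ?thesis .
qed

lemma degree_eq_sum:
  fixes n :: nat
  assumes "G \<subseteq> [{1..n}]\<^bsup>2\<^esup>"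
  shows "real (degree G i) = (\<Sum>e\<in>[{1..n}]\<^bsup>2\<^esup>. of_bool (i \<in> e) * of_bool (e \<in> G))"
proof -
  have "finite ([{1..n}]\<^bsup>2\<^esup>)" by (rule finite_imp_finite_nsets) simp
  moreover have "{e \<in> G. i \<in> e} = [{1..n}]\<^bsup>2\<^esup> \<inter> {e. i \<in> e \<and> e \<in> G}" using assms by auto
  ultimately show ?thesis by (simp add: degree_def flip: of_bool_conj)
qed

lemma degree_eq_row_sum:
  fixes n :: nat
  assumes "G \<subseteq> [{1..n}]\<^bsup>2\<^esup>" "i \<in> {1..n}"
  shows "real (degree G i) = (\<Sum>j\<in>{1..n} - {i}. of_bool ({i, j} \<in> G))"
  unfolding degree_eq_sum[OF assms(1)] by (rule sum_edges_at_vertex[OF assms(2), where f = "\<lambda>e. of_bool (e \<in> G)"])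

section \<open>Weights of graphs that differ in few edges\<close>

lemma subset_weight_le:
  assumes E: "finite E" "G \<subseteq> E" "G' \<subseteq> E"
    and p: "\<And>e. e \<in> E \<Longrightarrow> 0 \<le> p e \<and> p e \<le> 1 \<and> p e \<le> B * (1 - p e) \<and> 1 - p e \<le> B * p e"
  shows "subset_weight p E G \<le> B ^ card ((G - G') \<union> (G' - G)) * subset_weight p E G'"
proof -
  let ?X = "(G - G') \<union> (G' - G)"
  have "subset_weight p E G \<le> (\<Prod>e\<in>E. (if e \<in> ?X then B else 1) * (if e \<in> G' then p e else 1 - p e))"
    unfolding subset_weight_def using p by (intro prod_mono) auto
  also have "\<dots> = (\<Prod>e\<in>E. if e \<in> ?X then B else 1) * subset_weight p E G'"
    by (simp add: prod.distrib subset_weight_def)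
  also have "(\<Prod>e\<in>E. if e \<in> ?X then B else 1) = B ^ card ?X"
  proof -
    have "E \<inter> ?X = ?X" using E by auto
    then show ?thesis using E(1) by (simp only: prod.If_cases Collect_mem_eq) simp
  qed
  finally show ?thesis .
qed

lemma sum_power_card:
  fixes y :: real
  assumes "finite E"
  shows "(\<Sum>X\<in>Pow E. y ^ card X) = (1 + y) ^ card E"
  using assms
proof (induction E rule: finite_induct)
  case (insert x E)
  have "(\<Sum>X\<in>Pow (insert x E). y ^ card X) = (\<Sum>X\<in>Pow E. y ^ card X) + (\<Sum>X\<in>insert x ` Pow E. y ^ card X)"
    unfolding Pow_insert using insert.hyps by (intro sum.union_disjoint) auto
  also have "(\<Sum>X\<in>insert x ` Pow E. y ^ card X) = (\<Sum>X\<in>Pow E. y ^ card (insert x X))"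
    using insert.hyps(2) by (subst sum.reindex) (auto simp: inj_on_def)
  also have "\<dots> = (\<Sum>X\<in>Pow E. y * y ^ card X)"
  proof (intro sum.cong refl)
    fix X assume "X \<in> Pow E"
    then have "finite X" "x \<notin> X" using insert.hyps finite_subset by auto
    then show "y ^ card (insert x X) = y * y ^ card X" by simp
  qed
  finally show ?case using insert by (simp add: sum_distrib_left[symmetric] algebra_simps)
qed simp

text \<open>Comparison with a binomial sum: as \<open>card X \<le> R\<close>, the term
  \<open>B ^ card X\<close> is at most \<open>(B * N) powr R\<close> times
  \<open>(1 / N) ^ card X\<close>, where \<open>N = card E\<close>. Summed over all subsets, the
  latter gives \<open>(1 + 1 / N) ^ N \<le> 3\<close>.\<close>

lemma sum_power_card_small_le:
  fixes B R :: real
  assumes E: "finite E" "E \<noteq> {}" and B: "1 \<le> B"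
  shows "(\<Sum>X\<in>{X\<in>Pow E. real (card X) \<le> R}. B ^ card X) \<le> 3 * (B * real (card E)) powr R"
proof -
  let ?N = "real (card E)"
  have N: "1 \<le> ?N" using E by (metis One_nat_def Suc_leI card_gt_0_iff of_nat_1 of_nat_mono)
  have BN: "1 \<le> B * ?N" using mult_mono[OF B N] B by simp
  have "(\<Sum>X\<in>{X\<in>Pow E. real (card X) \<le> R}. B ^ card X)
      \<le> (\<Sum>X\<in>{X\<in>Pow E. real (card X) \<le> R}. (B * ?N) powr R * (1 / ?N) ^ card X)"
  proof (rule sum_mono)
    fix X assume X: "X \<in> {X\<in>Pow E. real (card X) \<le> R}"
    have "B ^ card X = (B * ?N) ^ card X * (1 / ?N) ^ card X"
      using N by (simp add: power_mult_distrib[symmetric])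
    also have "(B * ?N) ^ card X = (B * ?N) powr real (card X)"
      using BN by (intro powr_realpow[symmetric]) linarith
    also have "\<dots> \<le> (B * ?N) powr R" using X BN by (intro powr_mono) auto
    finally show "B ^ card X \<le> (B * ?N) powr R * (1 / ?N) ^ card X"
      using N by (simp add: mult_right_mono)
  qed
  also have "\<dots> \<le> (\<Sum>X\<in>Pow E. (B * ?N) powr R * (1 / ?N) ^ card X)"
    using E by (intro sum_mono2) auto
  also have "\<dots> = (B * ?N) powr R * (1 + 1 / ?N) ^ card E"
    using E by (simp only: sum_distrib_left[symmetric] sum_power_card)
  also have "\<dots> \<le> (B * ?N) powr R * 3"
  proof (intro mult_left_mono)
    have "(1 + 1 / ?N) ^ card E \<le> exp (1 / ?N) ^ card E"
      using N by (intro power_mono exp_ge_add_one_self) auto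
    also have "\<dots> = exp 1" using N by (simp add: exp_of_nat_mult[symmetric])
    also have "\<dots> \<le> 3" by (rule exp_le)
    finally show "(1 + 1 / ?N) ^ card E \<le> 3" .
  qed simp
  finally show ?thesis by (simp add: mult.commute)
qed

text \<open>The number 24 covers all later demands at once: \<open>5 * (d n)\<^sup>2 < M\<close> for
  realizations and, through \<open>\<delta> \<le> 1/24\<close>, that
  \<open>(1 - 6 * \<delta>) * (1 + 12 * \<delta>) \<ge> 1\<close>, that
  \<open>1 - 10 * \<delta> \<ge> 1/2\<close>, and that edge probabilities are at most
  \<open>1/2\<close>.\<close>

locale sparse_degree_sequence =
  fixes n :: nat and d :: "nat \<Rightarrow> nat"
  assumes seq: "degree_sequence n d" and even_sum: "even (deg_sum n d)" and n_pos: "1 \<le> n"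
    and sparse: "24 * (d n)\<^sup>2 \<le> deg_sum n d"
begin

abbreviation E :: "nat set set" where "E \<equiv> [{1..n}]\<^bsup>2\<^esup>"
abbreviation M :: real where "M \<equiv> real (deg_sum n d)"
abbreviation p :: "nat set \<Rightarrow> real" where "p \<equiv> maxent_prob n d"

definition \<delta> :: real where "\<delta> = (real (d n))\<^sup>2 / M"

lemma finite_E: "finite E" by (rule finite_imp_finite_nsets) simp

lemma d_pos: "i \<in> {1..n} \<Longrightarrow> 1 \<le> d i"
  using seq by (simp add: degree_sequence_def)

lemma d_le: "i \<in> {1..n} \<Longrightarrow> d i \<le> d n"
  using seq n_pos by (auto simp: degree_sequence_def mono_on_def)

lemma M_ge: "24 * (real (d n))\<^sup>2 \<le> M"
  using sparse by (metis of_nat_le_iff of_nat_mult of_nat_numeral of_nat_power)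

lemma d_n_ge_1: "1 \<le> real (d n)" using d_pos[of n] n_pos by simp

lemma M_ge_24: "24 \<le> M"
proof -
  have "1 \<le> (real (d n))\<^sup>2" using d_n_ge_1 by (simp add: one_le_power)
  then show ?thesis using M_ge by linarith
qed

lemma M_pos: "0 < M" using M_ge_24 by linarith

lemma delta_bounds: "0 < \<delta>" "\<delta> \<le> 1 / 24"
  using M_ge M_pos d_n_ge_1 by (auto simp: \<delta>_def field_simps)

lemma n_le_M: "real n \<le> M"
proof -
  have "(\<Sum>i=1..n. 1) \<le> (\<Sum>i=1..n. d i)" using d_pos by (intro sum_mono) auto
  then have "n \<le> deg_sum n d" by (simp add: deg_sum_def)
  then show ?thesis by (rule of_nat_mono)
qed

lemma M_le_n_mult: "M \<le> real n * real (d n)"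
proof -
  have "deg_sum n d \<le> n * d n"
    unfolding deg_sum_def using sum_bounded_above[of "{1..n}" d "d n"] d_le by simp
  then show ?thesis by (metis of_nat_le_iff of_nat_mult)
qed

lemma d_n_le_n: "24 * real (d n) \<le> real n"
proof -
  have "real (d n) * (24 * real (d n)) \<le> real (d n) * real n"
    using M_ge M_le_n_mult by (simp add: power2_eq_square algebra_simps)
  then show ?thesis using d_n_ge_1 by (simp add: mult_le_cancel_left)
qed

lemma M_le_n2: "M \<le> (real n)\<^sup>2"
proof -
  have "real n * real (d n) \<le> real n * real n" using d_n_le_n by (intro mult_left_mono) auto
  then show ?thesis using M_le_n_mult by (simp add: power2_eq_square)
qed

definition degree_deviation :: "nat set set \<Rightarrow> real" where
  "degree_deviation G = (\<Sum>i\<in>{1..n}. \<bar>real (degree G i) - real (d i)\<bar>)"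

lemma near_realization:
  assumes "G \<subseteq> E"
  obtains G' where "G' \<in> graphs_with_degrees n d"
    "real (card ((G - G') \<union> (G' - G))) \<le> 3 * degree_deviation G"
proof -
  have 1: "even (sum d {1..n})" using even_sum by (simp add: deg_sum_def)
  have 2: "5 * (d n)\<^sup>2 < sum d {1..n}"
  proof -
    have "0 < (d n)\<^sup>2" using d_pos[of n] n_pos by simp
    then show ?thesis using sparse unfolding deg_sum_def by linarith
  qed
  show ?thesis
    using exists_near_realization[OF _ assms d_le 1 2] that
    unfolding degree_deviation_def graphs_with_degrees_def by auto
qed

lemma graphs_with_degrees_nonempty: "graphs_with_degrees n d \<noteq> {}"
  using near_realization[of "{}"] by blast

lemma finite_graphs_with_degrees: "finite (graphs_with_degrees n d)"
  by (rule finite_subset[of _ "Pow E"]) (auto simp: graphs_with_degrees_def finite_E)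

lemma graph_row_sum:
  assumes "G \<in> graphs_with_degrees n d" "i \<in> {1..n}"
  shows "(\<Sum>j\<in>{1..n} - {i}. of_bool ({i, j} \<in> G)) = real (d i)"
  using assms degree_eq_row_sum[of G n i] by (auto simp: graphs_with_degrees_def)

lemma polytope_nonempty: "degree_polytope n d \<noteq> {}"
proof -
  obtain G where "G \<in> graphs_with_degrees n d" using graphs_with_degrees_nonempty by blast
  then have "pair_array n (\<lambda>e. of_bool (e \<in> G)) \<in> degree_polytope n d"
    unfolding pair_array_in_polytope_iff using graph_row_sum by auto
  then show ?thesis by blast
qed

lemma p_bounds: "e \<in> E \<Longrightarrow> 0 \<le> p e" "e \<in> E \<Longrightarrow> p e \<le> 1"
  and p_row_sum: "i \<in> {1..n} \<Longrightarrow> (\<Sum>j\<in>{1..n} - {i}. p {i, j}) = real (d i)"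
  using max_entropy_array_maximal(1)[OF polytope_nonempty]
  unfolding pair_array_maxent_prob[OF polytope_nonempty, symmetric] pair_array_in_polytope_iff by auto

lemma p_maximal:
  assumes "\<And>e. e \<in> E \<Longrightarrow> 0 \<le> y e \<and> y e \<le> 1"
    and "\<And>i. i \<in> {1..n} \<Longrightarrow> (\<Sum>j\<in>{1..n} - {i}. y {i, j}) = real (d i)"
  shows "(\<Sum>e\<in>E. entropy_fn (y e)) \<le> (\<Sum>e\<in>E. entropy_fn (p e))"
proof -
  have "pair_array n y \<in> degree_polytope n d"
    using assms by (auto simp: pair_array_in_polytope_iff)
  then have "array_entropy n (pair_array n y) \<le> array_entropy n (max_entropy_array n d)"
    by (rule max_entropy_array_maximal(2)[OF polytope_nonempty])
  then show ?thesis by (simp add: array_entropy_eq maxent_prob_def pair_array_Min_Max)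
qed

text \<open>The deterministic counterpart of the switching that replaces the edges \<open>ij\<close>, \<open>kl\<close> by \<open>jk\<close>,
  \<open>li\<close>: this direction keeps all row sums.\<close>

lemma p_exchange:
  assumes V: "i \<in> {1..n}" "j \<in> {1..n}" "k \<in> {1..n}" "l \<in> {1..n}"
    and dist: "i \<noteq> j" "i \<noteq> k" "i \<noteq> l" "j \<noteq> k" "j \<noteq> l" "k \<noteq> l"
  shows "p {i, j} * p {k, l} * (1 - p {j, k}) * (1 - p {l, i})
    \<le> p {j, k} * p {l, i} * (1 - p {i, j}) * (1 - p {k, l})"
proof (rule ccontr)
  assume "\<not> ?thesis"
  then have gt: "p {j, k} * p {l, i} * (1 - p {i, j}) * (1 - p {k, l})
     < p {i, j} * p {k, l} * (1 - p {j, k}) * (1 - p {l, i})" by simp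
  have inE: "{i, j} \<in> E" "{k, l} \<in> E" "{j, k} \<in> E" "{l, i} \<in> E" using V dist by auto
  note b = p_bounds[OF inE(1)] p_bounds[OF inE(2)] p_bounds[OF inE(3)] p_bounds[OF inE(4)]
  obtain t where t: "0 < t" "t \<le> p {i, j}" "t \<le> p {k, l}" "t \<le> 1 - p {j, k}" "t \<le> 1 - p {l, i}"
    and ent: "entropy_fn (p {i, j}) + entropy_fn (p {k, l}) + entropy_fn (p {j, k}) + entropy_fn (p {l, i})
     < entropy_fn (p {i, j} - t) + entropy_fn (p {k, l} - t) + entropy_fn (p {j, k} + t) + entropy_fn (p {l, i} + t)"
    using entropy_exchange[OF b gt] by metis
  \<comment> \<open>The signs alternate along the 4-cycle. Written as a combination of four
    indicators, \<open>v\<close> has vanishing row sums by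
    \<open>sum_doubleton_indicator\<close>.\<close>
  define v :: "nat set \<Rightarrow> real" where "v e = of_bool (e = {j, k}) + of_bool (e = {l, i})
     - of_bool (e = {i, j}) - of_bool (e = {k, l})" for e
  define y where "y e = p e + t * v e" for e
  have ne: "{i, j} \<noteq> {k, l}" "{i, j} \<noteq> {j, k}" "{i, j} \<noteq> {l, i}" "{k, l} \<noteq> {j, k}" "{k, l} \<noteq> {l, i}" "{j, k} \<noteq> {l, i}"
    using dist by (auto simp: doubleton_eq_iff)
  have v: "v {i, j} = -1" "v {k, l} = -1" "v {j, k} = 1" "v {l, i} = 1"
    unfolding v_def using ne ne[symmetric] by simp_all
  have v0: "v e = 0" if "e \<notin> {{i, j}, {k, l}, {j, k}, {l, i}}" for e
    using that by (auto simp: v_def)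
  have "(\<Sum>e\<in>E. entropy_fn (y e)) \<le> (\<Sum>e\<in>E. entropy_fn (p e))"
  proof (rule p_maximal)
    fix e assume "e \<in> E"
    then show "0 \<le> y e \<and> y e \<le> 1"
      using p_bounds[of e] t b v v0[of e] by (cases "e \<in> {{i, j}, {k, l}, {j, k}, {l, i}}") (auto simp: y_def)
  next
    fix m assume m: "m \<in> {1..n}"
    have "(\<Sum>x\<in>{1..n} - {m}. v {m, x}) = 0"
      unfolding v_def sum_subtractf sum.distrib
        sum_doubleton_indicator[OF V(2,3) dist(4) m] sum_doubleton_indicator[OF V(4,1) dist(3)[symmetric] m]
        sum_doubleton_indicator[OF V(1,2) dist(1) m] sum_doubleton_indicator[OF V(3,4) dist(6) m]
      by simp
    then show "(\<Sum>x\<in>{1..n} - {m}. y {m, x}) = real (d m)"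
      by (simp add: y_def sum.distrib sum_distrib_left[symmetric] p_row_sum[OF m])
  qed
  then have "(\<Sum>e\<in>E. entropy_fn (y e) - entropy_fn (p e)) \<le> 0" by (simp add: sum_subtractf)
  also have "(\<Sum>e\<in>E. entropy_fn (y e) - entropy_fn (p e))
     = (\<Sum>e\<in>{{i, j}, {k, l}, {j, k}, {l, i}}. entropy_fn (y e) - entropy_fn (p e))"
    by (rule sum.mono_neutral_right[OF finite_E]) (use inE v0 in \<open>auto simp: y_def\<close>)
  also have "\<dots> = (entropy_fn (p {i, j} - t) - entropy_fn (p {i, j})) + (entropy_fn (p {k, l} - t) - entropy_fn (p {k, l}))
     + (entropy_fn (p {j, k} + t) - entropy_fn (p {j, k})) + (entropy_fn (p {l, i} + t) - entropy_fn (p {l, i}))"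
    using ne by (simp add: y_def v)
  finally show False using ent by linarith
qed

section \<open>Edge probabilities up to a relative error of order \<delta>\<close>

abbreviation px :: "nat \<Rightarrow> nat \<Rightarrow> real" where "px \<equiv> pair_array n p"

lemma px_eq: "i \<in> {1..n} \<Longrightarrow> j \<in> {1..n} \<Longrightarrow> i \<noteq> j \<Longrightarrow> px i j = p {i, j}"
  by (simp add: pair_array_def)

lemma px_diag: "px i i = 0" by (simp add: pair_array_def)

lemma px_commute: "px i j = px j i" by (simp add: pair_array_def insert_commute)

lemma px_bounds: "0 \<le> px i j" "px i j \<le> 1"
  using p_bounds by (auto simp: pair_array_def)

lemma px_row_sum: "i \<in> {1..n} \<Longrightarrow> (\<Sum>j\<in>{1..n}. px i j) = real (d i)"
  using p_row_sum[of i] sum.cong[of "{1..n} - {i}" "{1..n} - {i}" "px i" "\<lambda>j. p {i, j}"]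
  by (simp add: sum.remove[of "{1..n}" i] px_diag px_eq)

lemma px_col_sum: "j \<in> {1..n} \<Longrightarrow> (\<Sum>i\<in>{1..n}. px i j) = real (d j)"
  using px_row_sum[of j] by (simp add: px_commute[of _ j])

lemma px_row_sum_le:
  assumes "i \<in> {1..n}" "S \<subseteq> {1..n}"
  shows "(\<Sum>j\<in>S. px i j) \<le> real (d i)" "(\<Sum>j\<in>S. px j i) \<le> real (d i)"
proof -
  have "(\<Sum>j\<in>S. px i j) \<le> (\<Sum>j\<in>{1..n}. px i j)"
    using assms px_bounds by (intro sum_mono2) auto
  then show "(\<Sum>j\<in>S. px i j) \<le> real (d i)" "(\<Sum>j\<in>S. px j i) \<le> real (d i)"
    using px_row_sum[OF assms(1)] by (simp_all add: px_commute[of _ i])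
qed

text \<open>\<open>p_exchange\<close> in both directions, with factors at most 1 dropped on the
  larger side. In the first part \<open>k = l\<close> is harmless, as the left side is then 0; in
  the second it would make the right side 0, so the diagonal has to be excluded.\<close>

lemma px_exchange:
  assumes "i \<in> {1..n}" "j \<in> {1..n}" "i \<noteq> j" "k \<in> {1..n} - {i, j}" "l \<in> {1..n} - {i, j}"
  shows "px i j * (px k l * ((1 - px j k) * (1 - px l i))) \<le> px j k * px l i"
    and "k \<noteq> l \<Longrightarrow> px j k * px l i * ((1 - px k l) * (1 - px i j)) \<le> px i j * px k l"
proof -
  have r: "u * ((1 - px a b) * (1 - px c e)) \<le> u" if "0 \<le> u" for u a b c e
  proof -
    have "(1 - px a b) * (1 - px c e) \<le> 1 * 1" using px_bounds by (intro mult_mono) auto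
    then show ?thesis using mult_left_mono[of _ 1 u] that by simp
  qed
  show "px i j * (px k l * ((1 - px j k) * (1 - px l i))) \<le> px j k * px l i"
  proof (cases "k = l")
    case False
    then have "px i j * (px k l * ((1 - px j k) * (1 - px l i))) \<le> px j k * px l i * ((1 - px i j) * (1 - px k l))"
      using p_exchange[of i j k l] assms by (simp add: px_eq mult_ac)
    also have "\<dots> \<le> px j k * px l i" using px_bounds by (intro r) simp
    finally show ?thesis .
  qed (simp add: px_diag px_bounds)
  assume kl: "k \<noteq> l"
  have "px j k * px l i * ((1 - px k l) * (1 - px i j)) \<le> px i j * px k l * ((1 - px j k) * (1 - px l i))"
    using p_exchange[of j k l i] assms kl by (simp add: px_eq mult_ac)
  also have "\<dots> \<le> px i j * px k l" using px_bounds by (intro r) simp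
  finally show "px j k * px l i * ((1 - px k l) * (1 - px i j)) \<le> px i j * px k l" .
qed

lemma sum_minus_two:
  fixes f :: "nat \<Rightarrow> real"
  assumes "i \<in> {1..n}" "j \<in> {1..n}" "i \<noteq> j"
  shows "(\<Sum>k\<in>{1..n} - {i, j}. f k) = (\<Sum>k\<in>{1..n}. f k) - f i - f j"
proof -
  have "(\<Sum>k\<in>{1..n} - {i, j}. f k) = (\<Sum>k\<in>{1..n}. f k) - sum f {i, j}"
    using assms by (intro sum_diff) auto
  then show ?thesis using assms by simp
qed

lemma M_eq: "M = (\<Sum>k\<in>{1..n}. real (d k))" by (simp add: deg_sum_def)

text \<open>Sum the first exchange inequality over \<open>k\<close> and \<open>l\<close>: the right
  side factors into two row sums, and the coefficient of \<open>px i j\<close> is \<open>M\<close>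
  up to lower order. Of the loss of 6 squares, 4 come from leaving out \<open>i\<close> and
  \<open>j\<close> in both summations and 2 from paths of length two (\<open>wedge\<close>).\<close>

lemma px_upper_aux:
  assumes ij: "i \<in> {1..n}" "j \<in> {1..n}" "i \<noteq> j"
  shows "px i j * (M - 6 * (real (d n))\<^sup>2) \<le> real (d i) * real (d j)"
proof -
  let ?S = "{1..n} - {i, j}" and ?D = "real (d n)"
  have dd: "real (d i) \<le> ?D" "real (d j) \<le> ?D" using d_le ij by auto
  have D2: "?D \<le> ?D\<^sup>2" using d_n_ge_1 by (simp add: power2_eq_square mult_le_cancel_left1)
  have wedge: "(\<Sum>k\<in>?S. \<Sum>l\<in>?S. px k l * px u k) \<le> ?D\<^sup>2" if u: "u \<in> {1..n}" for u
  proof -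
    have "(\<Sum>k\<in>?S. \<Sum>l\<in>?S. px k l * px u k) = (\<Sum>k\<in>?S. (\<Sum>l\<in>?S. px k l) * px u k)"
      by (simp add: sum_distrib_right)
    also have "\<dots> \<le> (\<Sum>k\<in>?S. ?D * px u k)"
    proof (intro sum_mono mult_right_mono px_bounds)
      fix k assume k: "k \<in> ?S"
      then have "(\<Sum>l\<in>?S. px k l) \<le> real (d k)" by (intro px_row_sum_le) auto
      also have "\<dots> \<le> ?D" using d_le k by auto
      finally show "(\<Sum>l\<in>?S. px k l) \<le> ?D" .
    qed
    also have "\<dots> = ?D * (\<Sum>k\<in>?S. px u k)" by (simp add: sum_distrib_left)
    also have "\<dots> \<le> ?D * ?D"
      using px_row_sum_le(1)[OF u, of ?S] d_le[OF u] by (intro mult_left_mono) auto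
    finally show ?thesis by (simp add: power2_eq_square)
  qed
  have "M - 6 * ?D\<^sup>2 \<le> (\<Sum>k\<in>?S. \<Sum>l\<in>?S. px k l) - (\<Sum>k\<in>?S. \<Sum>l\<in>?S. px k l * px j k)
      - (\<Sum>k\<in>?S. \<Sum>l\<in>?S. px k l * px l i)"
  proof -
    have "(\<Sum>k\<in>?S. \<Sum>l\<in>?S. px k l) = (\<Sum>k\<in>?S. real (d k) - px k i - px k j)"
      by (intro sum.cong refl) (simp add: sum_minus_two[OF ij] px_row_sum)
    also have "\<dots> = M - real (d i) - real (d j) - (\<Sum>k\<in>?S. px k i) - (\<Sum>k\<in>?S. px k j)"
      by (simp add: sum_subtractf sum_minus_two[OF ij] M_eq)
    finally have "M - 4 * ?D\<^sup>2 \<le> (\<Sum>k\<in>?S. \<Sum>l\<in>?S. px k l)"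
      using px_row_sum_le(2)[OF ij(1) Diff_subset, of "{i, j}"]
        px_row_sum_le(2)[OF ij(2) Diff_subset, of "{i, j}"] dd D2
      by linarith
    moreover have "(\<Sum>k\<in>?S. \<Sum>l\<in>?S. px k l * px l i) \<le> ?D\<^sup>2"
      using wedge[OF ij(1)] by (subst sum.swap) (simp add: px_commute)
    ultimately show ?thesis using wedge[OF ij(2)] by linarith
  qed
  also have "\<dots> = (\<Sum>k\<in>?S. \<Sum>l\<in>?S. px k l * (1 - px j k - px l i))"
    by (simp add: sum_subtractf[symmetric] algebra_simps)
  also have "\<dots> \<le> (\<Sum>k\<in>?S. \<Sum>l\<in>?S. px k l * ((1 - px j k) * (1 - px l i)))"
  proof (intro sum_mono mult_left_mono px_bounds)
    fix k l
    have "0 \<le> px j k * px l i" using px_bounds by simp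
    then show "1 - px j k - px l i \<le> (1 - px j k) * (1 - px l i)" by (simp add: algebra_simps)
  qed
  finally have "px i j * (M - 6 * ?D\<^sup>2) \<le> px i j * (\<Sum>k\<in>?S. \<Sum>l\<in>?S. px k l * ((1 - px j k) * (1 - px l i)))"
    by (intro mult_left_mono px_bounds)
  also have "\<dots> \<le> (\<Sum>k\<in>?S. \<Sum>l\<in>?S. px j k * px l i)"
    unfolding sum_distrib_left using ij by (intro sum_mono px_exchange(1)) auto
  also have "\<dots> = (\<Sum>k\<in>?S. px j k) * (\<Sum>l\<in>?S. px l i)" by (simp add: sum_product)
  also have "\<dots> \<le> real (d j) * real (d i)"
    using px_row_sum_le(1)[OF ij(2), of ?S] px_row_sum_le(2)[OF ij(1), of ?S]
    by (intro mult_mono sum_nonneg px_bounds) auto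
  finally show ?thesis by (simp add: mult.commute)
qed

lemma px_upper:
  assumes ij: "i \<in> {1..n}" "j \<in> {1..n}"
  shows "px i j \<le> (1 + 12 * \<delta>) * (real (d i) * real (d j) / M)"
proof (cases "i = j")
  case True
  then show ?thesis using delta_bounds M_pos by (simp add: px_diag)
next
  case False
  have "px i j * (M * (1 - 6 * \<delta>)) \<le> real (d i) * real (d j)"
    using px_upper_aux[OF ij False] M_pos by (simp add: \<delta>_def algebra_simps)
  then have "px i j * (1 - 6 * \<delta>) \<le> real (d i) * real (d j) / M"
    using M_pos by (simp add: field_simps)
  then have "px i j * (1 - 6 * \<delta>) * (1 + 12 * \<delta>) \<le> real (d i) * real (d j) / M * (1 + 12 * \<delta>)"
    using delta_bounds by (intro mult_right_mono) auto
  moreover have "px i j * 1 \<le> px i j * ((1 - 6 * \<delta>) * (1 + 12 * \<delta>))"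
  proof (intro mult_left_mono px_bounds)
    have "0 \<le> \<delta> * (6 - 72 * \<delta>)" using delta_bounds by (intro mult_nonneg_nonneg) auto
    then show "1 \<le> (1 - 6 * \<delta>) * (1 + 12 * \<delta>)" by (simp add: algebra_simps)
  qed
  ultimately show ?thesis by (simp add: mult_ac)
qed

lemma px_upper2:
  assumes ij: "i \<in> {1..n}" "j \<in> {1..n}"
  shows "px i j \<le> 2 * (real (d i) * real (d j)) / M"
proof -
  have "(1 + 12 * \<delta>) * (real (d i) * real (d j) / M) \<le> 2 * (real (d i) * real (d j) / M)"
    using delta_bounds M_pos by (intro mult_right_mono) auto
  then show ?thesis using px_upper[OF ij] by simp
qed

lemma px_upper3: "i \<in> {1..n} \<Longrightarrow> j \<in> {1..n} \<Longrightarrow> px i j \<le> 2 * \<delta>"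
proof -
  assume ij: "i \<in> {1..n}" "j \<in> {1..n}"
  have "real (d i) * real (d j) \<le> real (d n) * real (d n)" using d_le ij by (intro mult_mono) auto
  then have "2 * (real (d i) * real (d j)) / M \<le> 2 * (real (d n) * real (d n)) / M"
    using M_pos by (intro divide_right_mono) auto
  then show ?thesis using px_upper2[OF ij] by (simp add: \<delta>_def power2_eq_square)
qed

text \<open>Sum the second exchange inequality over distinct \<open>k\<close> and \<open>l\<close>:
  the right side is at most \<open>px i j * M\<close>. Relative to \<open>P = d i * d j\<close>, the
  left side loses 4 \<delta> by leaving out \<open>i\<close> and \<open>j\<close>, 2 \<delta> on the
  diagonal, and 4 \<delta> through the factors \<open>1 - px\<close>.\<close>

lemma px_lower:
  assumes ij: "i \<in> {1..n}" "j \<in> {1..n}" "i \<noteq> j"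
  shows "(1 - 10 * \<delta>) * (real (d i) * real (d j) / M) \<le> px i j"
proof -
  let ?S = "{1..n} - {i, j}" and ?D = "real (d n)"
  have dd: "real (d i) \<le> ?D" "real (d j) \<le> ?D" using d_le ij by auto
  have D2: "?D \<le> ?D\<^sup>2" using d_n_ge_1 by (simp add: power2_eq_square mult_le_cancel_left1)
  define P where "P = real (d i) * real (d j)"
  have P0: "0 \<le> P" by (simp add: P_def)
  have e1: "2 * (P * ?D) / M \<le> 2 * \<delta> * P"
  proof -
    have "2 * (P * ?D) / M \<le> 2 * (P * ?D\<^sup>2) / M"
      using D2 P0 M_pos by (intro divide_right_mono mult_left_mono) auto
    then show ?thesis by (simp add: \<delta>_def mult_ac)
  qed
  have diag: "(\<Sum>k\<in>?S. px j k * px k i) \<le> 2 * \<delta> * P"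
  proof -
    have "(\<Sum>k\<in>?S. px j k * px k i) \<le> (\<Sum>k\<in>?S. px j k * (2 * (?D * real (d i)) / M))"
    proof (intro sum_mono mult_left_mono px_bounds)
      fix k assume k: "k \<in> ?S"
      have "2 * (real (d k) * real (d i)) / M \<le> 2 * (?D * real (d i)) / M"
        using k d_le M_pos by (intro divide_right_mono mult_left_mono mult_right_mono) auto
      then show "px k i \<le> 2 * (?D * real (d i)) / M"
        using px_upper2[of k i] k ij by auto
    qed
    also have "\<dots> = (\<Sum>k\<in>?S. px j k) * (2 * (?D * real (d i)) / M)"
      by (simp only: sum_distrib_right)
    also have "\<dots> \<le> real (d j) * (2 * (?D * real (d i)) / M)"
      using ij M_pos by (intro mult_right_mono px_row_sum_le) auto
    also have "\<dots> = 2 * (P * ?D) / M" by (simp add: P_def mult_ac)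
    finally show ?thesis using e1 by linarith
  qed
  have prod: "P * (1 - 4 * \<delta>) \<le> (\<Sum>k\<in>?S. px j k) * (\<Sum>l\<in>?S. px l i)"
  proof -
    have 1: "(\<Sum>k\<in>?S. px j k) = real (d j) - px i j" "(\<Sum>l\<in>?S. px l i) = real (d i) - px i j"
      using ij by (simp_all add: sum_minus_two[OF ij] px_row_sum px_col_sum px_diag px_commute[of j i])
    have "(\<Sum>k\<in>?S. px j k) * (\<Sum>l\<in>?S. px l i)
        = P - px i j * (real (d i) + real (d j)) + px i j * px i j"
      unfolding 1 by (simp add: P_def algebra_simps)
    moreover have "px i j * (real (d i) + real (d j)) \<le> (2 * P / M) * (2 * ?D)"
      using px_upper2[OF ij(1,2)] dd px_bounds P0 M_pos by (intro mult_mono) (auto simp: P_def)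
    moreover have "(2 * P / M) * (2 * ?D) = 2 * (2 * (P * ?D) / M)" by simp
    moreover have "0 \<le> px i j * px i j" by simp
    moreover have "P * (1 - 4 * \<delta>) = P - 2 * (2 * \<delta> * P)" by (simp add: algebra_simps)
    ultimately show ?thesis using e1 by linarith
  qed
  have "P * (1 - 10 * \<delta>) \<le> P * ((1 - 6 * \<delta>) * (1 - 4 * \<delta>))"
    using P0 by (intro mult_left_mono) (simp_all add: algebra_simps)
  also have "\<dots> = (P * (1 - 4 * \<delta>) - 2 * \<delta> * P) * (1 - 4 * \<delta>)" by (simp add: algebra_simps)
  also have "\<dots> \<le> ((\<Sum>k\<in>?S. px j k) * (\<Sum>l\<in>?S. px l i) - (\<Sum>k\<in>?S. px j k * px k i)) * (1 - 4 * \<delta>)"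
    using prod diag delta_bounds by (intro mult_right_mono diff_mono) auto
  also have "(\<Sum>k\<in>?S. px j k) * (\<Sum>l\<in>?S. px l i) - (\<Sum>k\<in>?S. px j k * px k i)
     = (\<Sum>k\<in>?S. \<Sum>l\<in>?S - {k}. px j k * px l i)"
    by (simp add: sum_product sum_subtractf[symmetric] sum_diff1)
  also have "\<dots> * (1 - 4 * \<delta>) = (\<Sum>k\<in>?S. \<Sum>l\<in>?S - {k}. px j k * px l i * (1 - 4 * \<delta>))"
    by (simp add: sum_distrib_right)
  also have "\<dots> \<le> (\<Sum>k\<in>?S. \<Sum>l\<in>?S - {k}. px j k * px l i * ((1 - px k l) * (1 - px i j)))"
  proof (intro sum_mono mult_left_mono mult_nonneg_nonneg px_bounds)
    fix k l assume kl: "k \<in> ?S" "l \<in> ?S - {k}"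
    have "0 \<le> px k l * px i j" using px_bounds by simp
    moreover have "px k l \<le> 2 * \<delta>" "px i j \<le> 2 * \<delta>" using kl ij by (auto intro: px_upper3)
    ultimately show "1 - 4 * \<delta> \<le> (1 - px k l) * (1 - px i j)" by (simp add: algebra_simps)
  qed
  also have "\<dots> \<le> (\<Sum>k\<in>?S. \<Sum>l\<in>?S - {k}. px i j * px k l)"
    using ij by (intro sum_mono px_exchange(2)) auto
  also have "\<dots> \<le> (\<Sum>k\<in>?S. \<Sum>l\<in>{1..n}. px i j * px k l)"
    by (intro sum_mono sum_mono2 mult_nonneg_nonneg px_bounds) auto
  also have "\<dots> \<le> (\<Sum>k\<in>{1..n}. \<Sum>l\<in>{1..n}. px i j * px k l)"
    by (intro sum_mono2 sum_nonneg mult_nonneg_nonneg px_bounds) auto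
  also have "\<dots> = px i j * M"
    by (simp add: sum_distrib_left[symmetric] px_row_sum M_eq)
  finally show ?thesis using M_pos by (simp add: P_def field_simps)
qed

end

section \<open>The number of graphs with a given degree sequence\<close>

lemma sum_sqrt_le:
  fixes f :: "'a \<Rightarrow> real"
  assumes "finite A" "\<And>i. i \<in> A \<Longrightarrow> 0 \<le> f i"
  shows "(\<Sum>i\<in>A. sqrt (f i)) \<le> sqrt (real (card A) * (\<Sum>i\<in>A. f i))"
proof (rule real_le_rsqrt)
  have "(\<Sum>i\<in>A. sqrt (f i))\<^sup>2 \<le> (\<Sum>i\<in>A. (sqrt (f i))\<^sup>2) * real (card A)"
    by (rule sum_squared_le_sum_of_squares)
  also have "(\<Sum>i\<in>A. (sqrt (f i))\<^sup>2) = (\<Sum>i\<in>A. f i)"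
    using assms(2) by (intro sum.cong) auto
  finally show "(\<Sum>i\<in>A. sqrt (f i))\<^sup>2 \<le> real (card A) * (\<Sum>i\<in>A. f i)"
    by (simp add: mult.commute)
qed

context sparse_degree_sequence
begin

lemma edge_cases:
  assumes "e \<in> E"
  obtains i j where "e = {i, j}" "i \<in> {1..n}" "j \<in> {1..n}" "i \<noteq> j" "px i j = p e"
proof -
  obtain i j where "e = {i, j}" "i \<in> {1..n}" "j \<in> {1..n}" "i \<noteq> j" using assms by (rule nsets2_E)
  then show ?thesis using that px_eq by blast
qed

lemma p_approx:
  assumes ij: "i \<in> {1..n}" "j \<in> {1..n}" "i \<noteq> j"
  shows "\<bar>p {i, j} - real (d i) * real (d j) / M\<bar> \<le> 12 * \<delta> * (real (d i) * real (d j) / M)"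
proof -
  define P where "P = real (d i) * real (d j) / M"
  have "0 \<le> \<delta> * P" using delta_bounds M_pos by (simp add: P_def)
  moreover have "p {i, j} \<le> P + 12 * (\<delta> * P)"
    using px_upper[OF ij(1,2)] unfolding px_eq[OF ij] P_def[symmetric] by (simp add: algebra_simps)
  moreover have "P - 10 * (\<delta> * P) \<le> p {i, j}"
    using px_lower[OF ij] unfolding px_eq[OF ij] P_def[symmetric] by (simp add: algebra_simps)
  ultimately have "\<bar>p {i, j} - P\<bar> \<le> 12 * (\<delta> * P)" by linarith
  then show ?thesis by (simp only: mult.assoc P_def)
qed

text \<open>The lower bound puts \<open>p\<close> into the interior of the cube. It also bounds the
  cost of altering one edge by a factor \<open>2 * M\<close>; crude as this is, only its logarithm
  will matter.\<close>

lemma p_crude_bounds: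
  assumes "e \<in> E"
  shows "1 / (2 * M) \<le> p e" "p e \<le> 1 / 2"
proof -
  obtain i j where ij: "e = {i, j}" "i \<in> {1..n}" "j \<in> {1..n}" "i \<noteq> j" "px i j = p e"
    using assms by (rule edge_cases)
  show "p e \<le> 1 / 2" using px_upper3[OF ij(2,3)] ij(5) delta_bounds by simp
  have "1 * 1 \<le> real (d i) * real (d j)" using d_pos ij by (intro mult_mono) auto
  then have "1 / M \<le> real (d i) * real (d j) / M" using M_pos by (simp add: divide_right_mono)
  then have "1 / 2 * (1 / M) \<le> (1 - 10 * \<delta>) * (real (d i) * real (d j) / M)"
    using delta_bounds M_pos by (intro mult_mono) auto
  then show "1 / (2 * M) \<le> p e" using px_lower[OF ij(2-4)] ij(5) by simp
qed

section \<open>Likelihood and number of the realizations\<close>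

definition entropy :: real where "entropy = (\<Sum>e\<in>E. entropy_fn (p e))"

text \<open>As \<open>p\<close> is interior, the derivative of the entropy at \<open>p\<close> in the direction of (the indicator of)
  any graph with degree sequence \<open>d\<close> vanishes; this is a statement about its log-likelihood.\<close>

lemma weight_graph_with_degrees:
  assumes G: "G \<in> graphs_with_degrees n d"
  shows "subset_weight p E G = exp (- entropy)"
proof -
  define g :: "nat set \<Rightarrow> real" where "g e = of_bool (e \<in> G)" for e
  define y where "y t e = p e + t * (g e - p e)" for t e
  define f where "f t = (\<Sum>e\<in>E. entropy_fn (y t e))" for t
  define D where "D = (\<Sum>e\<in>E. (ln (1 - p e) - ln (p e)) * (g e - p e))"
  have p01: "0 < p e" "p e < 1" if "e \<in> E" for e
  proof -
    have "0 < 1 / (2 * M)" using M_pos by simp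
    then show "0 < p e" "p e < 1" using p_crude_bounds[OF that] by linarith+
  qed
  have "D = 0"
  proof (rule DERIV_local_max)
    have "((\<lambda>t. \<Sum>e\<in>E. entropy_fn (y t e)) has_real_derivative D) (at 0)"
      unfolding D_def
    proof (rule DERIV_sum)
      fix e assume e: "e \<in> E"
      have "(entropy_fn has_real_derivative (ln (1 - p e) - ln (p e))) (at (y 0 e))"
        using has_real_derivative_entropy_fn[OF p01[OF e]] by (simp add: y_def)
      moreover have "((\<lambda>t. y t e) has_real_derivative (g e - p e)) (at 0)"
        unfolding y_def by (auto intro!: derivative_eq_intros)
      ultimately show "((\<lambda>t. entropy_fn (y t e)) has_real_derivative (ln (1 - p e) - ln (p e)) * (g e - p e)) (at 0)"
        by (rule DERIV_chain2)
    qed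
    then show "(f has_real_derivative D) (at 0)" by (simp add: f_def[abs_def])
    \<comment> \<open>By \<open>p_crude_bounds\<close>, a move of this length in the direction
      \<open>g - p\<close> stays inside the unit cube.\<close>
    show "0 < 1 / (2 * M)" using M_pos by simp
    show "\<forall>t. \<bar>0 - t\<bar> < 1 / (2 * M) \<longrightarrow> f t \<le> f 0"
    proof (intro allI impI)
      fix t :: real assume t: "\<bar>0 - t\<bar> < 1 / (2 * M)"
      have "f 0 = (\<Sum>e\<in>E. entropy_fn (p e))" by (simp add: f_def y_def)
      moreover have "f t \<le> (\<Sum>e\<in>E. entropy_fn (p e))"
        unfolding f_def
      proof (rule p_maximal)
        fix e assume e: "e \<in> E"
        have "\<bar>t * (g e - p e)\<bar> \<le> \<bar>t\<bar> * 1"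
          unfolding abs_mult using p01[OF e] by (intro mult_left_mono) (auto simp: g_def)
        moreover have "1 / (2 * M) \<le> 1 / 2" using M_ge_24 by (simp add: field_simps)
        ultimately show "0 \<le> y t e \<and> y t e \<le> 1"
          using p_crude_bounds[OF e] t unfolding y_def by linarith
      next
        fix i assume i: "i \<in> {1..n}"
        have "(\<Sum>j\<in>{1..n} - {i}. y t {i, j}) = (\<Sum>j\<in>{1..n} - {i}. p {i, j})
           + t * ((\<Sum>j\<in>{1..n} - {i}. g {i, j}) - (\<Sum>j\<in>{1..n} - {i}. p {i, j}))"
          by (simp add: y_def sum.distrib sum_distrib_left sum_subtractf algebra_simps)
        then show "(\<Sum>j\<in>{1..n} - {i}. y t {i, j}) = real (d i)"
          using p_row_sum[OF i] graph_row_sum[OF G i] by (simp add: g_def)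
      qed
      ultimately show "f t \<le> f 0" by simp
    qed
  qed
  have "subset_weight p E G = (\<Prod>e\<in>E. exp (g e * ln (p e) + (1 - g e) * ln (1 - p e)))"
    unfolding subset_weight_def using p01 by (intro prod.cong refl) (auto simp: g_def)
  also have "\<dots> = exp (\<Sum>e\<in>E. g e * ln (p e) + (1 - g e) * ln (1 - p e))"
    by (simp add: exp_sum finite_E)
  \<comment> \<open>The log-likelihood is affine in \<open>g\<close>: at \<open>g = p\<close> it is
    minus the entropy, and the remaining linear part is \<open>- D\<close>.\<close>
  also have "(\<Sum>e\<in>E. g e * ln (p e) + (1 - g e) * ln (1 - p e)) = - D - entropy"
    unfolding D_def entropy_def entropy_fn_def sum_negf[symmetric] sum_subtractf[symmetric]
    by (intro sum.cong refl) (simp add: algebra_simps)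
  finally show ?thesis using \<open>D = 0\<close> by simp
qed

lemma weight_le:
  assumes "G \<subseteq> E" "G' \<subseteq> E"
  shows "subset_weight p E G \<le> (2 * M) ^ card ((G - G') \<union> (G' - G)) * subset_weight p E G'"
proof (rule subset_weight_le[OF finite_E assms])
  fix e assume e: "e \<in> E"
  have "p e \<le> 1 - p e" using p_crude_bounds(2)[OF e] by linarith
  also have "1 * (1 - p e) \<le> 2 * M * (1 - p e)"
    using p_crude_bounds[OF e] M_ge_24 by (intro mult_right_mono) auto
  finally have "p e \<le> 2 * M * (1 - p e)" by simp
  moreover have "2 * M * (1 / (2 * M)) \<le> 2 * M * p e"
    using p_crude_bounds[OF e] M_pos by (intro mult_left_mono) auto
  ultimately show "0 \<le> p e \<and> p e \<le> 1 \<and> p e \<le> 2 * M * (1 - p e) \<and> 1 - p e \<le> 2 * M * p e"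
    using p_bounds[OF e] p_crude_bounds[OF e] M_pos by simp
qed

text \<open>The variance of the degree is at most \<open>d i\<close>. The inequality
  \<open>\<bar>z\<bar> \<le> z^2 / (2 * s) + s / 2\<close> with \<open>s = sqrt (d i)\<close> turns
  this into a bound on the first moment, with both terms contributing \<open>s / 2\<close>.\<close>

lemma expected_deviation:
  assumes i: "i \<in> {1..n}"
  shows "subset_expectation p E (\<lambda>G. \<bar>real (degree G i) - real (d i)\<bar>) \<le> sqrt (real (d i))"
proof -
  let ?s = "sqrt (real (d i))"
  have s: "0 < ?s" using d_pos[OF i] by simp
  have dev: "real (degree G i) - real (d i) = (\<Sum>e\<in>E. of_bool (i \<in> e) * (of_bool (e \<in> G) - p e)) + 0"
    if "G \<subseteq> E" for G
    using degree_eq_sum[OF that, of i] sum_edges_at_vertex[OF i, of p] p_row_sum[OF i]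
    by (simp add: right_diff_distrib sum_subtractf)
  have "subset_expectation p E (\<lambda>G. \<bar>real (degree G i) - real (d i)\<bar>)
     \<le> subset_expectation p E (\<lambda>G. 1 / (2 * ?s) * ((\<Sum>e\<in>E. of_bool (i \<in> e) * (of_bool (e \<in> G) - p e)) + 0)\<^sup>2 + ?s / 2)"
  proof (rule subset_expectation_mono)
    fix G assume G: "G \<subseteq> E"
    define z where "z = real (degree G i) - real (d i)"
    have "0 \<le> (\<bar>z\<bar> - ?s)\<^sup>2" by simp
    then have "2 * ?s * \<bar>z\<bar> \<le> z\<^sup>2 + ?s * ?s" by (simp add: power2_eq_square algebra_simps)
    then have "\<bar>z\<bar> \<le> 1 / (2 * ?s) * z\<^sup>2 + ?s / 2" using s by (simp add: field_simps)
    then show "\<bar>real (degree G i) - real (d i)\<bar>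
       \<le> 1 / (2 * ?s) * ((\<Sum>e\<in>E. of_bool (i \<in> e) * (of_bool (e \<in> G) - p e)) + 0)\<^sup>2 + ?s / 2"
      unfolding z_def dev[OF G] .
  qed (use p_bounds in auto)
  also have "\<dots> = 1 / (2 * ?s) * (\<Sum>e\<in>E. (of_bool (i \<in> e))\<^sup>2 * (p e * (1 - p e))) + ?s / 2"
    unfolding subset_expectation_add subset_expectation_mult subset_expectation_const[OF finite_E]
      subset_expectation_square[OF finite_E] by simp
  also have "\<dots> \<le> 1 / (2 * ?s) * real (d i) + ?s / 2"
  proof (intro add_right_mono mult_left_mono)
    have "(\<Sum>e\<in>E. (of_bool (i \<in> e))\<^sup>2 * (p e * (1 - p e))) \<le> (\<Sum>e\<in>E. of_bool (i \<in> e) * p e)"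
    proof (rule sum_mono)
      fix e assume e: "e \<in> E"
      have "p e * (1 - p e) \<le> p e * 1" using p_bounds[OF e] by (intro mult_left_mono) auto
      then show "(of_bool (i \<in> e))\<^sup>2 * (p e * (1 - p e)) \<le> of_bool (i \<in> e) * p e" by auto
    qed
    also have "\<dots> = real (d i)" using sum_edges_at_vertex[OF i, of p] p_row_sum[OF i] by simp
    finally show "(\<Sum>e\<in>E. (of_bool (i \<in> e))\<^sup>2 * (p e * (1 - p e))) \<le> real (d i)" .
  qed (use s in auto)
  also have "1 / (2 * ?s) * real (d i) = ?s / 2"
    using s real_sqrt_mult_self[of "real (d i)"] by (simp add: field_simps)
  finally show ?thesis by simp
qed

lemma sum_sqrt_d_le: "(\<Sum>i\<in>{1..n}. sqrt (real (d i))) \<le> sqrt (real n * M)"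
  using sum_sqrt_le[of "{1..n}" "\<lambda>i. real (d i)"] by (simp add: M_eq)

lemma expected_degree_deviation: "subset_expectation p E degree_deviation \<le> sqrt (real n * M)"
proof -
  have "subset_expectation p E degree_deviation
    = (\<Sum>i\<in>{1..n}. subset_expectation p E (\<lambda>G. \<bar>real (degree G i) - real (d i)\<bar>))"
    unfolding degree_deviation_def[abs_def] by (rule subset_expectation_sum)
  also have "\<dots> \<le> (\<Sum>i\<in>{1..n}. sqrt (real (d i)))" by (intro sum_mono expected_deviation)
  finally show ?thesis using sum_sqrt_d_le by linarith
qed

lemma card_E_le: "real (card E) \<le> (real n)\<^sup>2" and E_nonempty: "E \<noteq> {}"
proof -
  have "2 \<le> n" using d_n_le_n d_n_ge_1 by simp
  then have "n choose 2 \<le> n ^ 2" by (rule binomial_le_pow)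
  then have "card E \<le> n ^ 2" by (simp add: card_nsets)
  then show "real (card E) \<le> (real n)\<^sup>2" by (metis of_nat_le_iff of_nat_power)
  have "{1, 2} \<in> E" using \<open>2 \<le> n\<close> by auto
  then show "E \<noteq> {}" by blast
qed

text \<open>A sample of the maximum entropy graph typically differs in few edges from a graph with degree
  sequence \<open>d\<close>. As the latter all have weight \<open>exp (- entropy)\<close>, there must be many of them.\<close>

lemma many_graphs_with_degrees:
  defines "s \<equiv> sqrt (real n * M)"
  shows "1 \<le> 6 * (2 * M * real (card E)) powr (6 * s) * (real (card (graphs_with_degrees n d)) * exp (- entropy))"
proof -
  let ?D = "graphs_with_degrees n d" and ?w = "subset_weight p E"
  define Good where "Good = {G \<in> Pow E. degree_deviation G \<le> 2 * s}"
  have s: "0 < s" using n_pos M_pos by (simp add: s_def)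
  have w0: "0 \<le> ?w G" for G using p_bounds by (intro subset_weight_nonneg) auto
  have dev0: "0 \<le> degree_deviation G" for G by (simp add: degree_deviation_def sum_nonneg)
  have DE: "?D \<subseteq> Pow E" by (auto simp: graphs_with_degrees_def)
  have fin: "finite (Pow E)" using finite_E by simp
  have "1 = (\<Sum>G\<in>Pow E. ?w G)"
    using subset_expectation_const[OF finite_E, of p 1] by (simp add: subset_expectation_def)
  \<comment> \<open>Markov's inequality, term by term: outside \<open>Good\<close> the deviation
    exceeds \<open>2 * s\<close>, twice the bound on its mean. So \<open>Good\<close> has mass at
    least 1/2.\<close>
  also have "\<dots> \<le> (\<Sum>G\<in>Pow E. of_bool (G \<in> Good) * ?w G + 1 / (2 * s) * (?w G * degree_deviation G))"
  proof (rule sum_mono)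
    fix G assume G: "G \<in> Pow E"
    show "?w G \<le> of_bool (G \<in> Good) * ?w G + 1 / (2 * s) * (?w G * degree_deviation G)"
    proof (cases "G \<in> Good")
      case False
      then have "1 \<le> 1 / (2 * s) * degree_deviation G" using G s by (simp add: Good_def field_simps)
      then have "?w G * 1 \<le> ?w G * (1 / (2 * s) * degree_deviation G)" using w0 by (intro mult_left_mono)
      then show ?thesis using False by (simp add: mult_ac)
    qed (use w0 dev0 s in auto)
  qed
  also have "\<dots> = (\<Sum>G\<in>Pow E. of_bool (G \<in> Good) * ?w G) + 1 / (2 * s) * subset_expectation p E degree_deviation"
    by (simp add: sum.distrib sum_distrib_left subset_expectation_def)
  also have "(\<Sum>G\<in>Pow E. of_bool (G \<in> Good) * ?w G) = sum ?w Good"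
  proof -
    have "Pow E \<inter> Good = Good" by (auto simp: Good_def)
    then show ?thesis using fin by (simp add: of_bool_def if_distrib[of "\<lambda>a. a * _"] sum.If_cases cong: if_cong)
  qed
  also have "1 / (2 * s) * subset_expectation p E degree_deviation \<le> 1 / (2 * s) * s"
    using expected_degree_deviation s by (intro mult_left_mono) (auto simp: s_def)
  also have "1 / (2 * s) * s = 1 / 2" using s by simp
  finally have half: "1 / 2 \<le> sum ?w Good" by simp
  define c where "c G G' = card ((G - G') \<union> (G' - G))" for G G' :: "nat set set"
  \<comment> \<open>Every good \<open>G\<close> is charged to a realization within
    \<open>3 * 2 * s\<close> altered edges; the pairs are then counted from the side of the
    realization.\<close>
  have "sum ?w Good \<le> (\<Sum>G\<in>Good. \<Sum>G'\<in>?D. of_bool (real (c G G') \<le> 6 * s) * ?w G)"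
  proof (rule sum_mono)
    fix G assume G: "G \<in> Good"
    then obtain G' where G': "G' \<in> ?D" "real (c G G') \<le> 3 * degree_deviation G"
      unfolding c_def by (auto simp: Good_def elim: near_realization)
    moreover have "real (c G G') \<le> 6 * s" using G G'(2) by (simp add: Good_def)
    ultimately have "?w G = of_bool (real (c G G') \<le> 6 * s) * ?w G" by simp
    also have "\<dots> \<le> (\<Sum>G'\<in>?D. of_bool (real (c G G') \<le> 6 * s) * ?w G)"
      using G' w0 by (intro member_le_sum finite_graphs_with_degrees) auto
    finally show "?w G \<le> (\<Sum>G'\<in>?D. of_bool (real (c G G') \<le> 6 * s) * ?w G)" .
  qed
  also have "\<dots> \<le> (\<Sum>G\<in>Pow E. \<Sum>G'\<in>?D. of_bool (real (c G G') \<le> 6 * s) * ?w G)"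
    using fin w0 by (intro sum_mono2 sum_nonneg mult_nonneg_nonneg) (auto simp: Good_def)
  also have "\<dots> \<le> (\<Sum>G\<in>Pow E. \<Sum>G'\<in>?D. of_bool (real (c G G') \<le> 6 * s) * ((2 * M) ^ c G G' * exp (- entropy)))"
  proof (intro sum_mono mult_left_mono)
    fix G G' assume "G \<in> Pow E" "G' \<in> ?D"
    then show "?w G \<le> (2 * M) ^ c G G' * exp (- entropy)"
      using weight_le[of G G'] weight_graph_with_degrees[of G'] DE by (auto simp: c_def)
  qed simp
  also have "\<dots> = (\<Sum>G'\<in>?D. \<Sum>G\<in>Pow E. of_bool (real (c G G') \<le> 6 * s) * ((2 * M) ^ c G G' * exp (- entropy)))"
    by (rule sum.swap)
  \<comment> \<open>Symmetric difference with \<open>G'\<close> is an involution of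
    \<open>Pow E\<close>, so the inner sum does not depend on \<open>G'\<close>.\<close>
  also have "\<dots> = (\<Sum>G'\<in>?D. \<Sum>X\<in>Pow E. of_bool (real (card X) \<le> 6 * s) * ((2 * M) ^ card X * exp (- entropy)))"
  proof (rule sum.cong[OF refl])
    fix G' assume "G' \<in> ?D"
    then have G': "G' \<subseteq> E" using DE by auto
    show "(\<Sum>G\<in>Pow E. of_bool (real (c G G') \<le> 6 * s) * ((2 * M) ^ c G G' * exp (- entropy)))
      = (\<Sum>X\<in>Pow E. of_bool (real (card X) \<le> 6 * s) * ((2 * M) ^ card X * exp (- entropy)))"
      by (rule sum.reindex_bij_witness[where i = "\<lambda>X. (X - G') \<union> (G' - X)" and j = "\<lambda>X. (X - G') \<union> (G' - X)"])
         (use G' in \<open>auto simp: c_def\<close>)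
  qed
  also have "\<dots> = real (card ?D) * exp (- entropy) * (\<Sum>X\<in>{X\<in>Pow E. real (card X) \<le> 6 * s}. (2 * M) ^ card X)"
  proof -
    have "(\<Sum>X\<in>Pow E. of_bool (real (card X) \<le> 6 * s) * ((2 * M) ^ card X * exp (- entropy)))
      = (\<Sum>X\<in>Pow E. if real (card X) \<le> 6 * s then (2 * M) ^ card X * exp (- entropy) else 0)"
      by (intro sum.cong) auto
    also have "\<dots> = (\<Sum>X\<in>{X\<in>Pow E. real (card X) \<le> 6 * s}. (2 * M) ^ card X) * exp (- entropy)"
      unfolding sum_distrib_right by (rule sum.inter_filter[OF fin, symmetric])
    finally show ?thesis by simp
  qed
  also have "\<dots> \<le> real (card ?D) * exp (- entropy) * (3 * (2 * M * real (card E)) powr (6 * s))"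
    using M_ge_24 by (intro mult_left_mono sum_power_card_small_le finite_E E_nonempty) auto
  finally show ?thesis using half by (simp add: mult_ac)
qed

text \<open>A member of \<open>A\<close> is at most \<open>3 * r\<close> alterations away from a
  realization, whose weight is \<open>exp (- entropy)\<close>, and \<open>A\<close> has at least as
  many members as there are realizations. The first fact gives the factor
  \<open>(2 * M) powr (3 * r)\<close>, and \<open>many_graphs_with_degrees\<close> gives the
  rest.\<close>

lemma uniform_density_bound:
  defines "s \<equiv> sqrt (real n * M)"
  assumes A: "graphs_with_degrees n d \<subseteq> A" "A \<subseteq> Pow E" and dev: "\<And>G. G \<in> A \<Longrightarrow> degree_deviation G \<le> r"
    and G: "G \<in> A"
  shows "1 / real (card A) \<le> 6 * (2 * M * real (card E)) powr (6 * s) * (2 * M) powr (3 * r) * subset_weight p E G"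
proof -
  let ?D = "graphs_with_degrees n d" and ?K = "6 * (2 * M * real (card E)) powr (6 * s)"
  have GE: "G \<subseteq> E" using A G by auto
  have finA: "finite A" using A(2) finite_E finite_subset by auto
  obtain G' where G': "G' \<in> ?D" "real (card ((G - G') \<union> (G' - G))) \<le> 3 * degree_deviation G"
    using GE by (rule near_realization)
  let ?c = "card ((G' - G) \<union> (G - G'))"
  have "exp (- entropy) \<le> (2 * M) ^ ?c * subset_weight p E G"
    using weight_le[of G' G] weight_graph_with_degrees[OF G'(1)] G' A GE by auto
  also have "(2 * M) ^ ?c = (2 * M) powr real ?c" using M_pos by (simp add: powr_realpow)
  also have "\<dots> \<le> (2 * M) powr (3 * r)"
    using G'(2) dev[OF G] M_ge_24 by (intro powr_mono) (auto simp: Un_commute)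
  finally have 1: "exp (- entropy) \<le> (2 * M) powr (3 * r) * subset_weight p E G"
    using p_bounds by (simp add: mult_right_mono subset_weight_nonneg)
  have "1 \<le> ?K * (real (card ?D) * exp (- entropy))"
    using many_graphs_with_degrees by (simp add: s_def)
  also have "\<dots> \<le> ?K * (real (card A) * ((2 * M) powr (3 * r) * subset_weight p E G))"
    using 1 card_mono[OF finA A(1)] by (intro mult_left_mono mult_mono) auto
  finally have "1 \<le> real (card A) * (?K * (2 * M) powr (3 * r) * subset_weight p E G)"
    by (simp add: mult_ac)
  moreover have "0 < card A" using finA G by (auto simp: card_gt_0_iff)
  ultimately show ?thesis by (simp add: field_simps)
qed

end

section \<open>Weighted tree sums\<close>

text \<open>Stated for an arbitrary vertex set, because the parts of a tree that arise while it is
  grown are trees on smaller sets.\<close>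

definition is_tree :: "'a set \<Rightarrow> 'a set set \<Rightarrow> bool" where
  "is_tree V T \<longleftrightarrow> T \<subseteq> [V]\<^bsup>2\<^esup> \<and> graph_connected V T \<and> (\<nexists>c. graph_cycle T c)"

lemma trees_eq: "trees k = {T. is_tree {1..k} T}"
  by (simp add: trees_def is_tree_def)

text \<open>Attaches leaves one at a time to a core \<open>(V0, F0)\<close>, which is a vertex or an
  edge in the applications. This is the induction principle for trees: the root or a pinned edge
  comes first, and every other vertex enters as a leaf.\<close>

inductive grows :: "'a set \<Rightarrow> 'a set set \<Rightarrow> 'a set \<Rightarrow> 'a set set \<Rightarrow> bool" for V0 F0 where
  base: "grows V0 F0 V0 F0"
| step: "grows V0 F0 V F \<Longrightarrow> u \<in> V \<Longrightarrow> w \<notin> V \<Longrightarrow> grows V0 F0 (insert w V) (insert {u, w} F)"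

lemma grows_subset: "grows V0 F0 V F \<Longrightarrow> V0 \<subseteq> V \<and> F0 \<subseteq> F"
  by (induction rule: grows.induct) auto

lemma grows_finite: "grows V0 F0 V F \<Longrightarrow> finite V0 \<Longrightarrow> finite V"
  by (induction rule: grows.induct) auto

lemma grows_edges: "grows V0 F0 V F \<Longrightarrow> F0 \<subseteq> [V0]\<^bsup>2\<^esup> \<Longrightarrow> F \<subseteq> [V]\<^bsup>2\<^esup>"
proof (induction rule: grows.induct)
  case (step V F u w)
  have "[V]\<^bsup>2\<^esup> \<subseteq> [insert w V]\<^bsup>2\<^esup>" by (rule nsets_mono) auto
  with step show ?case by auto
qed auto

lemma adjacency_rtrancl_sym:
  "(u, v) \<in> {(x, y). {x, y} \<in> G}\<^sup>* \<Longrightarrow> (v, u) \<in> {(x, y). {x, y} \<in> G}\<^sup>*"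
  by (rule symD[OF sym_rtrancl]) (auto simp: sym_def insert_commute)

lemma grows_connected:
  "grows V0 F0 V F \<Longrightarrow> graph_connected V0 F0 \<Longrightarrow> graph_connected V F"
proof (induction rule: grows.induct)
  case (step V F u w)
  let ?R = "{(x, y). {x, y} \<in> F}" and ?R' = "{(x, y). {x, y} \<in> insert {u, w} F}"
  have mono: "?R\<^sup>* \<subseteq> ?R'\<^sup>*" by (rule rtrancl_mono) auto
  have uw: "(u, w) \<in> ?R'\<^sup>*" by (rule r_into_rtrancl) auto
  have to_u: "(a, u) \<in> ?R'\<^sup>*" if "a \<in> insert w V" for a
  proof (cases "a = w")
    case True
    then show ?thesis using adjacency_rtrancl_sym[OF uw] by (simp only:)
  next
    case False
    then have "(a, u) \<in> ?R\<^sup>*" using step that unfolding graph_connected_def by blast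
    then show ?thesis using mono by blast
  qed
  show ?case
    unfolding graph_connected_def
    using rtrancl_trans[OF to_u adjacency_rtrancl_sym[OF to_u]] by blast
qed

lemma rtrancl_leaves:
  "(a, b) \<in> r\<^sup>* \<Longrightarrow> a \<in> U \<Longrightarrow> b \<notin> U \<Longrightarrow> \<exists>x y. (x, y) \<in> r \<and> x \<in> U \<and> y \<notin> U"
  by (induction rule: rtrancl_induct) auto

lemma grows_spanning:
  assumes V: "finite V" "graph_connected V T" "T \<subseteq> [V]\<^bsup>2\<^esup>"
    and start: "grows V0 F0 U F" "F \<subseteq> T" "U \<subseteq> V" "U \<noteq> {}"
  shows "\<exists>F'\<subseteq>T. grows V0 F0 V F'"
  using start
proof (induction "card (V - U)" arbitrary: U F rule: less_induct)
  case less
  show ?case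
  proof (cases "U = V")
    case False
    then obtain w a where "w \<in> V" "w \<notin> U" "a \<in> U" "a \<in> V" using less.prems by blast
    then have "(a, w) \<in> {(x, y). {x, y} \<in> T}\<^sup>*" using V(2) unfolding graph_connected_def by blast
    then obtain x y where xy: "{x, y} \<in> T" "x \<in> U" "y \<notin> U"
      using rtrancl_leaves[of a w _ U] \<open>a \<in> U\<close> \<open>w \<notin> U\<close> by blast
    then have "y \<in> V" using V(3) by auto
    have "V - insert y U \<subset> V - U" using xy \<open>y \<in> V\<close> by auto
    then have "card (V - insert y U) < card (V - U)" using V(1) by (intro psubset_card_mono) auto
    then show ?thesis
      using less.hyps[of "insert y U" "insert {x, y} F"] grows.step[OF less.prems(1) xy(2,3)] xy \<open>y \<in> V\<close> less.prems
      by blast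
  qed (use less.prems in blast)
qed

text \<open>If the next vertex \<open>z\<close> already lies on the path, the path is cut off at
  \<open>z\<close>, so it stays free of repetitions.\<close>

lemma rtrancl_distinct_path:
  "(x, y) \<in> r\<^sup>* \<Longrightarrow> \<exists>c. c \<noteq> [] \<and> hd c = x \<and> last c = y \<and> distinct c
     \<and> (\<forall>i. Suc i < length c \<longrightarrow> (c ! i, c ! Suc i) \<in> r)"
proof (induction rule: rtrancl_induct)
  case base
  show ?case by (rule exI[of _ "[x]"]) auto
next
  case (step y z)
  then obtain c where c: "c \<noteq> []" "hd c = x" "last c = y" "distinct c"
    "\<And>i. Suc i < length c \<Longrightarrow> (c ! i, c ! Suc i) \<in> r" by auto
  show ?case
  proof (cases "z \<in> set c")
    case True
    then obtain xs ys where s: "c = xs @ z # ys" by (auto simp: in_set_conv_decomp)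
    let ?c = "xs @ [z]"
    have "?c ! i = c ! i" if "i < length ?c" for i
      using that by (auto simp: s nth_append)
    then have "(?c ! i, ?c ! Suc i) \<in> r" if "Suc i < length ?c" for i
      using c(5)[of i] that by (simp add: s)
    moreover have "hd ?c = x" using c(2) by (cases xs) (auto simp: s)
    ultimately show ?thesis using c(4) by (intro exI[of _ ?c]) (auto simp: s)
  next
    case False
    let ?c = "c @ [z]"
    have "(?c ! i, ?c ! Suc i) \<in> r" if i: "Suc i < length ?c" for i
    proof (cases "Suc i < length c")
      case True
      then show ?thesis using c(5)[of i] by (simp add: nth_append)
    next
      case False
      then have "i = length c - 1" "i < length c" using i c(1) by auto
      then have "?c ! i = y" using c(1,3) by (simp add: nth_append last_conv_nth)
      moreover have "?c ! Suc i = z" using i False by (auto simp: nth_append)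
      ultimately show ?thesis using step by simp
    qed
    then show ?thesis using c False by (intro exI[of _ ?c]) auto
  qed
qed

text \<open>Growing by edges of \<open>T\<close> reaches every vertex, by connectedness. An edge of
  \<open>T\<close> left over would close a path of grown edges to a cycle; that path has at least 3
  vertices, as the leftover edge is not itself grown.\<close>

lemma tree_grows:
  assumes T: "finite V" "is_tree V T"
    and start: "V0 \<subseteq> V" "V0 \<noteq> {}" "F0 \<subseteq> T" "graph_connected V0 F0"
  shows "grows V0 F0 V T"
proof -
  have TV: "T \<subseteq> [V]\<^bsup>2\<^esup>" and con: "graph_connected V T" and acyc: "\<nexists>c. graph_cycle T c"
    using T(2) by (auto simp: is_tree_def)
  obtain F where F: "F \<subseteq> T" "grows V0 F0 V F"
    using grows_spanning[OF T(1) con TV grows.base start(3,1,2)] by blast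
  have "T \<subseteq> F"
  proof (rule ccontr)
    assume "\<not> T \<subseteq> F"
    then obtain e where e: "e \<in> T" "e \<notin> F" by auto
    with TV have "e \<in> [V]\<^bsup>2\<^esup>" by auto
    then obtain x y where xy: "e = {x, y}" "x \<in> V" "y \<in> V" "x \<noteq> y" by (rule nsets2_E)
    have "(x, y) \<in> {(x, y). {x, y} \<in> F}\<^sup>*"
      using grows_connected[OF F(2) start(4)] xy unfolding graph_connected_def by blast
    then obtain c where c: "c \<noteq> []" "hd c = x" "last c = y" "distinct c"
      "\<And>i. Suc i < length c \<Longrightarrow> {c ! i, c ! Suc i} \<in> F"
      using rtrancl_distinct_path[of x y "{(x, y). {x, y} \<in> F}"] by (metis (no_types, lifting) case_prodD mem_Collect_eq)
    have first: "c ! 0 = x" and last: "c ! (length c - 1) = y"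
      using c by (simp_all add: hd_conv_nth last_conv_nth)
    have "length c \<noteq> 1" using first last xy(4) by auto
    moreover have "length c \<noteq> 2"
    proof
      assume l: "length c = 2"
      then have "{c ! 0, c ! 1} \<in> F" using c(5)[of 0] by (simp add: One_nat_def)
      then show False using first last l xy(1) e(2) by (simp add: One_nat_def)
    qed
    ultimately have len: "3 \<le> length c"
      using length_greater_0_conv[of c] c(1) by linarith
    have "graph_cycle T c"
      unfolding graph_cycle_def
    proof (intro conjI allI impI len c(4))
      fix i assume i: "i < length c"
      show "{c ! i, c ! ((i + 1) mod length c)} \<in> T"
      proof (cases "i + 1 < length c")
        case True
        then show ?thesis using c(5)[of i] F(1) by (auto simp: Suc_eq_plus1)
      next
        case False
        then have "i + 1 = length c" "i = length c - 1" using i by auto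
        then show ?thesis using first last e(1) xy(1) by (simp add: insert_commute)
      qed
    qed
    then show False using acyc by blast
  qed
  then show ?thesis using F by auto
qed

lemma graph_connected_singleton [simp]: "graph_connected {u} {}"
  by (simp add: graph_connected_def)

lemma graph_connected_edge [simp]: "graph_connected {u, v} {{u, v}}"
proof -
  have "(u, v) \<in> {(x, y). {x, y} \<in> {{u, v}}}\<^sup>*" by (rule r_into_rtrancl) auto
  then show ?thesis unfolding graph_connected_def using adjacency_rtrancl_sym by blast
qed

section \<open>Sums over embeddings of a tree\<close>

definition injections :: "nat set \<Rightarrow> nat \<Rightarrow> (nat \<Rightarrow> nat) set" where
  "injections V n = {s \<in> V \<rightarrow>\<^sub>E {1..n}. inj_on s V}"

definition inverse_tree_weight :: "(nat \<Rightarrow> nat) \<Rightarrow> nat set \<Rightarrow> nat set set \<Rightarrow> (nat \<Rightarrow> nat) \<Rightarrow> real" where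
  "inverse_tree_weight d V T s = (\<Prod>u\<in>V. real (d (s u)) powi (1 - int (degree T u)))"

text \<open>With \<open>\<xi>\<close> the indicator of a graph this is a weighted count of tree
  copies; with \<open>\<xi> = p\<close> it is the expected count. \<open>h\<close> serves as a test
  function, as a weight at the root, or as a constraint that pins an edge.\<close>

definition tree_sum :: "nat \<Rightarrow> (nat \<Rightarrow> nat) \<Rightarrow> ((nat \<Rightarrow> nat) \<Rightarrow> real) \<Rightarrow> (nat set \<Rightarrow> real) \<Rightarrow> nat set \<Rightarrow> nat set set \<Rightarrow> real" where
  "tree_sum n d h \<xi> V T = (\<Sum>s\<in>injections V n. h s * (inverse_tree_weight d V T s * (\<Prod>e\<in>T. \<xi> (s ` e))))"

lemma finite_injections: "finite V \<Longrightarrow> finite (injections V n)"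
  unfolding injections_def by (rule finite_subset[of _ "V \<rightarrow>\<^sub>E {1..n}"]) (auto intro: finite_PiE)

lemma injections_range: "s \<in> injections V n \<Longrightarrow> u \<in> V \<Longrightarrow> s u \<in> {1..n}"
  unfolding injections_def by blast

lemma inverse_tree_weight_nonneg: "0 \<le> inverse_tree_weight d V T s"
  unfolding inverse_tree_weight_def by (intro prod_nonneg) auto

lemma sum_injections_insert:
  fixes f :: "(nat \<Rightarrow> nat) \<Rightarrow> real"
  assumes "w \<notin> V" and finV: "finite V"
  shows "(\<Sum>s\<in>injections (insert w V) n. f s)
    = (\<Sum>s\<in>injections V n. \<Sum>x\<in>{1..n} - s ` V. f (s(w := x)))"
proof -
  have "(\<Sum>s\<in>injections V n. \<Sum>x\<in>{1..n} - s ` V. f (s(w := x)))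
    = (\<Sum>(s, x)\<in>Sigma (injections V n) (\<lambda>s. {1..n} - s ` V). f (s(w := x)))"
    using finite_injections[OF finV] by (subst sum.Sigma) auto
  also have "\<dots> = (\<Sum>s\<in>injections (insert w V) n. f s)"
  proof (rule sum.reindex_bij_witness[where i = "\<lambda>t. (restrict t V, t w)" and j = "\<lambda>(s, x). s(w := x)"])
    fix a assume a: "a \<in> Sigma (injections V n) (\<lambda>s. {1..n} - s ` V)"
    obtain s x where sx: "a = (s, x)" by (cases a)
    have s: "s \<in> V \<rightarrow>\<^sub>E {1..n}" "inj_on s V" "x \<in> {1..n}" "x \<notin> s ` V" using a by (auto simp: sx injections_def)
    have "restrict (s(w := x)) V = s"
    proof
      fix v show "restrict (s(w := x)) V v = s v"
        using assms s(1) by (cases "v \<in> V") (auto simp: PiE_def extensional_def)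
    qed
    then show "(restrict ((case a of (s, x) \<Rightarrow> s(w := x))) V, (case a of (s, x) \<Rightarrow> s(w := x)) w) = a"
      by (simp add: sx)
    have "inj_on (s(w := x)) (insert w V)"
      using s assms by (auto simp: inj_on_def)
    moreover have "s(w := x) \<in> insert w V \<rightarrow>\<^sub>E {1..n}"
      using s by (intro PiE_fun_upd) auto
    ultimately show "(case a of (s, x) \<Rightarrow> s(w := x)) \<in> injections (insert w V) n"
      by (simp add: sx injections_def)
    show "f (case a of (s, x) \<Rightarrow> s(w := x)) = (case a of (s, x) \<Rightarrow> f (s(w := x)))" by (simp add: sx)
  next
    fix t assume t: "t \<in> injections (insert w V) n"
    then have t': "t \<in> insert w V \<rightarrow>\<^sub>E {1..n}" "inj_on t (insert w V)" by (auto simp: injections_def)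
    show "(case (restrict t V, t w) of (s, x) \<Rightarrow> s(w := x)) = t"
    proof
      fix v show "(case (restrict t V, t w) of (s, x) \<Rightarrow> s(w := x)) v = t v"
        using t'(1) by (auto simp: PiE_def extensional_def)
    qed
    have "restrict t V \<in> V \<rightarrow>\<^sub>E {1..n}" using t'(1) by auto
    moreover have "inj_on (restrict t V) V" using t'(2) by (auto simp: inj_on_def)
    moreover have "t w \<in> {1..n}" using t'(1) by auto
    moreover have "t w \<notin> restrict t V ` V" using t'(2) assms by (auto simp: inj_on_def)
    ultimately show "(restrict t V, t w) \<in> Sigma (injections V n) (\<lambda>s. {1..n} - s ` V)"
      by (auto simp: injections_def)
  qed
  finally show ?thesis by simp
qed

lemma inverse_tree_weight_step:
  assumes "finite V" "T \<subseteq> [V]\<^bsup>2\<^esup>" "u \<in> V" "w \<notin> V" and d: "\<And>v. v \<in> V \<Longrightarrow> d (s v) \<noteq> 0"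
  shows "inverse_tree_weight d (insert w V) (insert {u, w} T) (s(w := x))
    = inverse_tree_weight d V T s / real (d (s u))"
proof -
  have finT: "finite T" using assms(1,2) by (rule finite_graph)
  have wT: "w \<notin> e" if "e \<in> T" for e using that assms(2,4) by (auto simp: nsets_def)
  then have new: "{u, w} \<notin> T" by auto
  have "{e \<in> T. w \<in> e} = {}" using wT by blast
  then have "degree T w = 0" by (simp only: degree_def card.empty)
  then have dw: "degree (insert {u, w} T) w = 1" by (simp add: degree_insert[OF finT new])
  have "(\<Prod>v\<in>V. real (d ((s(w := x)) v)) powi (1 - int (degree (insert {u, w} T) v)))
     = (\<Prod>v\<in>V. real (d (s v)) powi (1 - int (degree T v)) * (if v = u then 1 / real (d (s u)) else 1))"
  proof (rule prod.cong[OF refl])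
    fix v assume v: "v \<in> V"
    then have "v \<noteq> w" using assms(4) by auto
    moreover have "1 - int (degree (insert {u, w} T) v) = (1 - int (degree T v)) - of_bool (v = u)"
      using \<open>v \<noteq> w\<close> by (simp add: degree_insert[OF finT new])
    ultimately show "real (d ((s(w := x)) v)) powi (1 - int (degree (insert {u, w} T) v))
      = real (d (s v)) powi (1 - int (degree T v)) * (if v = u then 1 / real (d (s u)) else 1)"
      using d[OF v] by (cases "v = u") (simp_all add: power_int_diff power_int_minus inverse_eq_divide)
  qed
  also have "\<dots> = inverse_tree_weight d V T s * (1 / real (d (s u)))"
    using assms(1,3) by (simp add: prod.distrib inverse_tree_weight_def prod.delta)
  finally show ?thesis
    using assms(1,4) dw by (simp add: inverse_tree_weight_def)
qed

text \<open>A new leaf \<open>w\<close> at \<open>u\<close> divides the weight by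
  \<open>d (s u)\<close> and runs through a row of \<open>\<xi>\<close>. In the applications row
  sums are comparable to \<open>d (s u)\<close>, so each leaf contributes a bounded factor; the
  normalization by \<open>tree_weight\<close> is made for this cancellation.\<close>

lemma tree_sum_step:
  assumes V: "finite V" "T \<subseteq> [V]\<^bsup>2\<^esup>" "u \<in> V" "w \<notin> V" and d: "\<And>i. i \<in> {1..n} \<Longrightarrow> 1 \<le> d i"
    and h: "\<And>s x. h (s(w := x)) = h s"
  shows "tree_sum n d h \<xi> (insert w V) (insert {u, w} T)
    = (\<Sum>s\<in>injections V n. h s * (inverse_tree_weight d V T s * (\<Prod>e\<in>T. \<xi> (s ` e)))
        * ((\<Sum>x\<in>{1..n} - s ` V. \<xi> {s u, x}) / real (d (s u))))"
  unfolding tree_sum_def sum_injections_insert[OF V(4,1)]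
proof (rule sum.cong[OF refl])
  fix s assume s: "s \<in> injections V n"
  have finT: "finite T" using V(1,2) by (rule finite_graph)
  have wT: "w \<notin> e" if "e \<in> T" for e using that V(2,4) by (auto simp: nsets_def)
  then have new: "{u, w} \<notin> T" by auto
  have "h (s(w := x)) * (inverse_tree_weight d (insert w V) (insert {u, w} T) (s(w := x))
       * (\<Prod>e\<in>insert {u, w} T. \<xi> (s(w := x) ` e)))
    = h s * (inverse_tree_weight d V T s * (\<Prod>e\<in>T. \<xi> (s ` e))) * (\<xi> {s u, x} / real (d (s u)))" for x
  proof -
    have nz: "d (s v) \<noteq> 0" if "v \<in> V" for v using d[OF injections_range[OF s that]] by simp
    have "(\<Prod>e\<in>T. \<xi> (s(w := x) ` e)) = (\<Prod>e\<in>T. \<xi> (s ` e))"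
      using wT by (intro prod.cong refl arg_cong[of _ _ \<xi>] image_cong) auto
    moreover have "s(w := x) ` {u, w} = {s u, x}" using V(3,4) by auto
    ultimately show ?thesis
      using finT new by (simp add: h inverse_tree_weight_step[of V T u w d s x, OF V nz])
  qed
  then show "(\<Sum>x\<in>{1..n} - s ` V. h (s(w := x)) * (inverse_tree_weight d (insert w V) (insert {u, w} T) (s(w := x))
       * (\<Prod>e\<in>insert {u, w} T. \<xi> (s(w := x) ` e))))
    = h s * (inverse_tree_weight d V T s * (\<Prod>e\<in>T. \<xi> (s ` e))) * ((\<Sum>x\<in>{1..n} - s ` V. \<xi> {s u, x}) / real (d (s u)))"
    by (simp add: sum_distrib_left sum_divide_distrib)
qed

lemma tree_sum_singleton:
  "tree_sum n d (\<lambda>s. g (s r)) \<xi> {r} {} = (\<Sum>y\<in>{1..n}. g y * real (d y))"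
proof -
  have "tree_sum n d (\<lambda>s. g (s r)) \<xi> {r} {} = (\<Sum>s\<in>injections {r} n. g (s r) * real (d (s r)))"
    by (simp add: tree_sum_def inverse_tree_weight_def)
  also have "\<dots> = (\<Sum>y\<in>{1..n}. g y * real (d y))"
    by (rule sum.reindex_bij_witness[where j = "\<lambda>s. s r" and i = "\<lambda>y. \<lambda>v\<in>{r}. y"])
       (auto simp: injections_def PiE_def extensional_def)
  finally show ?thesis .
qed

text \<open>The base case for a pinned edge: both ends have degree 1, so the weight is 1, and at
  most one embedding satisfies the constraint.\<close>

lemma tree_sum_edge_le:
  assumes "u \<noteq> v" "0 \<le> \<xi> {x, y}"
  shows "tree_sum n d (\<lambda>s. of_bool (s u = x \<and> s v = y)) \<xi> {u, v} {{u, v}} \<le> \<xi> {x, y}"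
proof -
  let ?P = "\<lambda>s. s u = x \<and> s v = y"
  have "tree_sum n d (\<lambda>s. of_bool (s u = x \<and> s v = y)) \<xi> {u, v} {{u, v}}
     = (\<Sum>s\<in>injections {u, v} n. of_bool (?P s) * \<xi> {x, y})"
  proof -
    have "degree {{u, v}} w = 1" if "w \<in> {u, v}" for w
      using that degree_insert[of "{}" "{u, v}" w] by simp
    then have "inverse_tree_weight d {u, v} {{u, v}} s = 1" for s
      unfolding inverse_tree_weight_def by (intro prod.neutral) simp
    then show ?thesis unfolding tree_sum_def by (intro sum.cong refl) auto
  qed
  also have "\<dots> = real (card (injections {u, v} n \<inter> {s. ?P s})) * \<xi> {x, y}"
    by (simp add: finite_injections sum_distrib_right[symmetric])
  also have "\<dots> \<le> 1 * \<xi> {x, y}"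
  proof (intro mult_right_mono assms(2))
    have "injections {u, v} n \<inter> {s. ?P s} \<subseteq> {(\<lambda>_. undefined)(u := x, v := y)}"
      using assms(1) by (auto simp: injections_def PiE_def extensional_def fun_eq_iff)
    from card_mono[OF _ this] have "card (injections {u, v} n \<inter> {s. ?P s}) \<le> 1"
      by simp
    then show "real (card (injections {u, v} n \<inter> {s. ?P s})) \<le> 1" by simp
  qed
  finally show ?thesis by simp
qed

lemma tree_sum_nonneg:
  assumes "\<And>s. s \<in> injections V n \<Longrightarrow> 0 \<le> h s" "\<And>e. 0 \<le> \<xi> e"
  shows "0 \<le> tree_sum n d h \<xi> V T"
  unfolding tree_sum_def using assms
  by (intro sum_nonneg mult_nonneg_nonneg inverse_tree_weight_nonneg prod_nonneg) auto

text \<open>Every leaf outside the core costs at most a factor \<open>c\<close>. The first condition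
  on \<open>h\<close> says that \<open>h\<close> looks only at the core, so it does not interfere
  with the leaves.\<close>

lemma tree_sum_upper:
  assumes "grows V0 F0 V F" "finite V0" "F0 \<subseteq> [V0]\<^bsup>2\<^esup>"
    and d: "\<And>i. i \<in> {1..n} \<Longrightarrow> 1 \<le> d i" and \<xi>: "\<And>e. 0 \<le> \<xi> e" and c: "0 \<le> c"
    and row: "\<And>y. y \<in> {1..n} \<Longrightarrow> (\<Sum>x\<in>{1..n} - {y}. \<xi> {y, x}) \<le> c * real (d y)"
    and h: "\<And>s w x. w \<notin> V0 \<Longrightarrow> h (s(w := x)) = h s" "\<And>s. 0 \<le> h s"
  shows "tree_sum n d h \<xi> V F \<le> c ^ (card V - card V0) * tree_sum n d h \<xi> V0 F0"
  using assms(1)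
proof (induction rule: grows.induct)
  case (step V F u w)
  have fin: "finite V" using step(1) assms(2) by (rule grows_finite)
  have FV: "F \<subseteq> [V]\<^bsup>2\<^esup>" using step(1) assms(3) by (rule grows_edges)
  have V0V: "V0 \<subseteq> V" using grows_subset[OF step(1)] by simp
  then have w: "w \<notin> V0" using step by auto
  have "tree_sum n d h \<xi> (insert w V) (insert {u, w} F)
    = (\<Sum>s\<in>injections V n. h s * (inverse_tree_weight d V F s * (\<Prod>e\<in>F. \<xi> (s ` e)))
        * ((\<Sum>x\<in>{1..n} - s ` V. \<xi> {s u, x}) / real (d (s u))))"
    using step fin FV h(1)[OF w] d by (intro tree_sum_step) auto
  also have "\<dots> \<le> (\<Sum>s\<in>injections V n. h s * (inverse_tree_weight d V F s * (\<Prod>e\<in>F. \<xi> (s ` e))) * c)"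
  proof (intro sum_mono mult_left_mono)
    fix s assume s: "s \<in> injections V n"
    have su: "s u \<in> {1..n}" using injections_range[OF s] step by auto
    have "(\<Sum>x\<in>{1..n} - s ` V. \<xi> {s u, x}) \<le> (\<Sum>x\<in>{1..n} - {s u}. \<xi> {s u, x})"
      using step \<xi> by (intro sum_mono2) auto
    also have "\<dots> \<le> c * real (d (s u))" by (rule row[OF su])
    finally show "(\<Sum>x\<in>{1..n} - s ` V. \<xi> {s u, x}) / real (d (s u)) \<le> c"
      using d[OF su] by (simp add: divide_le_eq)
  qed (intro mult_nonneg_nonneg inverse_tree_weight_nonneg prod_nonneg h \<xi>)
  also have "\<dots> = c * tree_sum n d h \<xi> V F"
    by (simp add: tree_sum_def sum_distrib_left mult_ac)
  also have "\<dots> \<le> c * (c ^ (card V - card V0) * tree_sum n d h \<xi> V0 F0)"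
    using step c by (intro mult_left_mono)
  also have "\<dots> = c ^ (card (insert w V) - card V0) * tree_sum n d h \<xi> V0 F0"
    using step fin card_mono[OF fin V0V] by (simp add: Suc_diff_le)
  finally show ?case .
qed simp

lemma tree_sum_rooted_upper:
  assumes T: "finite V" "is_tree V T" "u \<in> V"
    and d: "\<And>i. i \<in> {1..n} \<Longrightarrow> 1 \<le> d i" and \<xi>: "\<And>e. 0 \<le> \<xi> e" and c: "0 \<le> c"
    and row: "\<And>y. y \<in> {1..n} \<Longrightarrow> (\<Sum>x\<in>{1..n} - {y}. \<xi> {y, x}) \<le> c * real (d y)"
    and g: "\<And>y. 0 \<le> g y"
  shows "tree_sum n d (\<lambda>s. g (s u)) \<xi> V T \<le> c ^ (card V - 1) * (\<Sum>y\<in>{1..n}. g y * real (d y))"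
proof -
  have "grows {u} {} V T" using T by (intro tree_grows) auto
  then have "tree_sum n d (\<lambda>s. g (s u)) \<xi> V T
      \<le> c ^ (card V - card {u}) * tree_sum n d (\<lambda>s. g (s u)) \<xi> {u} {}"
    using d \<xi> c row g by (intro tree_sum_upper) auto
  then show ?thesis by (simp add: tree_sum_singleton One_nat_def)
qed

text \<open>The loss when a leaf is attached at \<open>u\<close> is a sum over trees with a weight that depends on the
  position of \<open>u\<close> only; growing the tree from the root \<open>u\<close> bounds it by \<open>\<Sum>y. g y\<close>.\<close>

lemma tree_sum_lower:
  assumes "grows {r} {} V F" and T: "F \<subseteq> T" "\<nexists>c. graph_cycle T c" and K: "card V \<le> K"
    and d: "\<And>i. i \<in> {1..n} \<Longrightarrow> 1 \<le> d i" and \<xi>: "\<And>e. 0 \<le> \<xi> e" and c: "1 \<le> c"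
    and row: "\<And>y. y \<in> {1..n} \<Longrightarrow> (\<Sum>x\<in>{1..n} - {y}. \<xi> {y, x}) \<le> c * real (d y)"
    and g: "\<And>y. 0 \<le> g y"
    and loss: "\<And>y U. y \<in> {1..n} \<Longrightarrow> finite U \<Longrightarrow> card U \<le> K \<Longrightarrow> real (d y) - (\<Sum>x\<in>{1..n} - U. \<xi> {y, x}) \<le> g y"
  shows "(\<Sum>y\<in>{1..n}. real (d y)) - real (card V) * c ^ K * (\<Sum>y\<in>{1..n}. g y) \<le> tree_sum n d (\<lambda>_. 1) \<xi> V F"
  using assms(1) T(1) K
proof (induction rule: grows.induct)
  case base
  have "0 \<le> c ^ K * (\<Sum>y\<in>{1..n}. g y)" using c g by (intro mult_nonneg_nonneg sum_nonneg) auto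
  then show ?case using tree_sum_singleton[of n d "\<lambda>_. 1" r \<xi>] by simp
next
  case (step V F u w)
  have fin: "finite V" using step(1) by (rule grows_finite) simp
  have FV: "F \<subseteq> [V]\<^bsup>2\<^esup>" using step(1) by (rule grows_edges) simp
  have cV: "card V \<le> K" using step.prems(2) step.hyps fin by simp
  \<comment> \<open>A partially grown tree is connected and, inside \<open>T\<close>, acyclic; so it
    can be rooted anew at \<open>u\<close>.\<close>
  have tree: "is_tree V F"
  proof -
    have "graph_connected V F" using step(1) by (rule grows_connected) simp
    moreover have "graph_cycle T c" if "graph_cycle F c" for c
      using that step.prems(1) unfolding graph_cycle_def by blast
    ultimately show ?thesis using T(2) FV unfolding is_tree_def by blast
  qed
  let ?G = "\<Sum>y\<in>{1..n}. g y"
  have G0: "0 \<le> ?G" using g by (intro sum_nonneg)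
  have "tree_sum n d (\<lambda>s. g (s u) / real (d (s u))) \<xi> V F \<le> c ^ (card V - 1) * (\<Sum>y\<in>{1..n}. g y / real (d y) * real (d y))"
    using tree_sum_rooted_upper[OF fin tree step.hyps(2) d \<xi> _ row, of "\<lambda>y. g y / real (d y)"] c g by simp
  also have "(\<Sum>y\<in>{1..n}. g y / real (d y) * real (d y)) = ?G"
    using d by (intro sum.cong refl) force
  also have "c ^ (card V - 1) * ?G \<le> c ^ K * ?G"
    using c cV G0 by (intro mult_right_mono power_increasing) auto
  finally have lossV: "tree_sum n d (\<lambda>s. g (s u) / real (d (s u))) \<xi> V F \<le> c ^ K * ?G" .
  have "tree_sum n d (\<lambda>_. 1) \<xi> V F - tree_sum n d (\<lambda>s. g (s u) / real (d (s u))) \<xi> V F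
    = (\<Sum>s\<in>injections V n. 1 * (inverse_tree_weight d V F s * (\<Prod>e\<in>F. \<xi> (s ` e))) * (1 - g (s u) / real (d (s u))))"
    by (simp add: tree_sum_def sum_subtractf[symmetric] algebra_simps)
  also have "\<dots> \<le> (\<Sum>s\<in>injections V n. 1 * (inverse_tree_weight d V F s * (\<Prod>e\<in>F. \<xi> (s ` e)))
        * ((\<Sum>x\<in>{1..n} - s ` V. \<xi> {s u, x}) / real (d (s u))))"
  proof (intro sum_mono mult_left_mono)
    fix s assume s: "s \<in> injections V n"
    have su: "s u \<in> {1..n}" using injections_range[OF s] step by auto
    have "card (s ` V) \<le> K" using card_image_le[OF fin, of s] cV by linarith
    then have "real (d (s u)) - g (s u) \<le> (\<Sum>x\<in>{1..n} - s ` V. \<xi> {s u, x})"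
      using loss[OF su, of "s ` V"] fin by simp
    then have "(real (d (s u)) - g (s u)) / real (d (s u)) \<le> (\<Sum>x\<in>{1..n} - s ` V. \<xi> {s u, x}) / real (d (s u))"
      by (intro divide_right_mono) auto
    then show "1 - g (s u) / real (d (s u)) \<le> (\<Sum>x\<in>{1..n} - s ` V. \<xi> {s u, x}) / real (d (s u))"
      using d[OF su] by (simp add: diff_divide_distrib)
  qed (intro mult_nonneg_nonneg inverse_tree_weight_nonneg prod_nonneg \<xi> zero_le_one)
  also have "\<dots> = tree_sum n d (\<lambda>_. 1) \<xi> (insert w V) (insert {u, w} F)"
    using step fin FV d by (intro tree_sum_step[symmetric]) auto
  finally have "tree_sum n d (\<lambda>_. 1) \<xi> V F - c ^ K * ?G \<le> tree_sum n d (\<lambda>_. 1) \<xi> (insert w V) (insert {u, w} F)"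
    using lossV by linarith
  moreover have "(\<Sum>y\<in>{1..n}. real (d y)) - real (card V) * c ^ K * ?G \<le> tree_sum n d (\<lambda>_. 1) \<xi> V F"
    using step cV by auto
  moreover have "real (card (insert w V)) * c ^ K * ?G = real (card V) * c ^ K * ?G + c ^ K * ?G"
    using fin step by (simp add: algebra_simps)
  ultimately show ?case by linarith
qed

section \<open>Concentration of tree counts\<close>

lemma image_edges:
  assumes "s \<in> injections V n" "T \<subseteq> [V]\<^bsup>2\<^esup>"
  shows "inj_on ((`) s) T" "(`) s ` T \<subseteq> [{1..n}]\<^bsup>2\<^esup>"
proof -
  have s: "inj_on s V" "s ` V \<subseteq> {1..n}" using assms(1) by (auto simp: injections_def)
  have TV: "e \<subseteq> V" if "e \<in> T" for e using that assms(2) by (auto simp: nsets_def)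
  show "inj_on ((`) s) T"
    using TV s(1) by (intro inj_onI) (simp add: inj_on_image_eq_iff)
  show "(`) s ` T \<subseteq> [{1..n}]\<^bsup>2\<^esup>"
  proof
    fix e' assume "e' \<in> (`) s ` T"
    then obtain e where e: "e \<in> T" "e' = s ` e" by auto
    then have "e \<in> [V]\<^bsup>2\<^esup>" using assms(2) by auto
    then obtain a b where "e = {a, b}" "a \<in> V" "b \<in> V" "a \<noteq> b" by (rule nsets2_E)
    then show "e' \<in> [{1..n}]\<^bsup>2\<^esup>" using e s by (auto simp: inj_on_eq_iff)
  qed
qed

lemma prod_of_bool: "finite T \<Longrightarrow> (\<Prod>e\<in>T. of_bool (P e)) = (of_bool (\<forall>e\<in>T. P e) :: real)"
  by (induction T rule: finite_induct) auto

lemma tree_indicator_eq: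
  assumes "finite V" "T \<subseteq> [V]\<^bsup>2\<^esup>"
  shows "tree_indicator s T G = (\<Prod>e\<in>T. of_bool (s ` e \<in> G))"
proof -
  have "(\<forall>u v. {u, v} \<in> T \<longrightarrow> {s u, s v} \<in> G) \<longleftrightarrow> (\<forall>e\<in>T. s ` e \<in> G)"
  proof (intro iffI ballI)
    fix e assume *: "\<forall>u v. {u, v} \<in> T \<longrightarrow> {s u, s v} \<in> G" and e: "e \<in> T"
    then have "e \<in> [V]\<^bsup>2\<^esup>" using assms(2) by auto
    then obtain a b where "e = {a, b}" by (rule nsets2_E)
    with * e show "s ` e \<in> G" by auto
  next
    assume *: "\<forall>e\<in>T. s ` e \<in> G"
    show "\<forall>u v. {u, v} \<in> T \<longrightarrow> {s u, s v} \<in> G"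
    proof (intro allI impI)
      fix u v assume "{u, v} \<in> T"
      with * have "s ` {u, v} \<in> G" by blast
      then show "{s u, s v} \<in> G" by simp
    qed
  qed
  then show ?thesis
    unfolding tree_indicator_def prod_of_bool[OF finite_graph[OF assms]] by (simp only: of_bool_def)
qed

lemma subset_expectation_tree:
  assumes s: "s \<in> injections V n" and T: "finite V" "T \<subseteq> [V]\<^bsup>2\<^esup>"
  shows "subset_expectation q ([{1..n}]\<^bsup>2\<^esup>) (\<lambda>G. \<Prod>e\<in>T. of_bool (s ` e \<in> G)) = (\<Prod>e\<in>T. q (s ` e))"
proof -
  have "(\<Prod>e\<in>T. of_bool (s ` e \<in> G)) = (of_bool ((`) s ` T \<subseteq> G) :: real)" for G
    unfolding prod_of_bool[OF finite_graph[OF T]] by (intro arg_cong[where f = of_bool]) auto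
  then have "subset_expectation q ([{1..n}]\<^bsup>2\<^esup>) (\<lambda>G. \<Prod>e\<in>T. of_bool (s ` e \<in> G)) = (\<Prod>e\<in>(`) s ` T. q e)"
  proof -
    have "finite ([{1..n}]\<^bsup>2\<^esup>)" by (rule finite_imp_finite_nsets) simp
    from subset_expectation_subset[OF this image_edges(2)[OF s T(2)], of q] show ?thesis
      unfolding \<open>\<And>G. (\<Prod>e\<in>T. of_bool (s ` e \<in> G)) = (of_bool ((`) s ` T \<subseteq> G) :: real)\<close> .
  qed
  also have "\<dots> = (\<Prod>e\<in>T. q (s ` e))" by (simp add: prod.reindex[OF image_edges(1)[OF s T(2)]])
  finally show ?thesis .
qed

lemma subset_expectation_tree_sum:
  assumes T: "finite V" "T \<subseteq> [V]\<^bsup>2\<^esup>"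
  shows "subset_expectation q ([{1..n}]\<^bsup>2\<^esup>) (\<lambda>G. tree_sum n d h (\<lambda>e. of_bool (e \<in> G)) V T) = tree_sum n d h q V T"
  unfolding tree_sum_def subset_expectation_sum
  by (intro sum.cong refl) (simp add: subset_expectation_mult subset_expectation_tree[OF _ T])

lemma tree_prob_independent_edges:
  assumes s: "s \<in> injections V n" and T: "finite V" "T \<subseteq> [V]\<^bsup>2\<^esup>"
    and q: "\<And>i j. (i, j) \<in> ordered_pairs n \<Longrightarrow> 0 \<le> q i j \<and> q i j \<le> 1"
  shows "tree_prob (independent_edges_graph n q) s T = (\<Prod>e\<in>T. q (Min (s ` e)) (Max (s ` e)))"
proof -
  let ?h = "\<lambda>(i, j). {i, j} :: nat set" and ?q = "\<lambda>e. q (Min e) (Max e)"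
  have qh: "?q (?h a) = (case a of (i, j) \<Rightarrow> q i j)" if "a \<in> ordered_pairs n" for a
    using that by (auto simp: ordered_pairs_def)
  have fin: "finite (ordered_pairs n)"
    by (rule finite_subset[of _ "{1..n} \<times> {1..n}"]) (auto simp: ordered_pairs_def)
  have inj: "inj_on ?h (ordered_pairs n)"
    by (auto simp: inj_on_def ordered_pairs_def doubleton_eq_iff)
  have img: "?h ` ordered_pairs n = [{1..n}]\<^bsup>2\<^esup>"
  proof -
    have "{i, j} \<in> ?h ` ordered_pairs n" if "i \<in> {1..n}" "j \<in> {1..n}" "i \<noteq> j" for i j
    proof (cases "i < j")
      case True
      then have "(i, j) \<in> ordered_pairs n" using that by (auto simp: ordered_pairs_def)
      then show ?thesis by (rule rev_image_eqI) simp
    next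
      case False
      then have "(j, i) \<in> ordered_pairs n" using that by (auto simp: ordered_pairs_def)
      then show ?thesis by (rule rev_image_eqI) auto
    qed
    then have "[{1..n}]\<^bsup>2\<^esup> \<subseteq> ?h ` ordered_pairs n" by (blast elim: nsets2_E)
    moreover have "?h ` ordered_pairs n \<subseteq> [{1..n}]\<^bsup>2\<^esup>" by (auto simp: ordered_pairs_def)
    ultimately show ?thesis by blast
  qed
  have "Pi_pmf (ordered_pairs n) False (\<lambda>(i, j). bernoulli_pmf (q i j))
     = Pi_pmf (ordered_pairs n) False (\<lambda>a. bernoulli_pmf (?q (?h a)))"
    using qh by (intro Pi_pmf_cong) auto
  moreover have "{{i, j} |i j. (i, j) \<in> ordered_pairs n \<and> f (i, j)} = {?h a |a. a \<in> ordered_pairs n \<and> f a}" for f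
    by force
  ultimately have "tree_prob (independent_edges_graph n q) s T
    = measure_pmf.expectation (Pi_pmf (ordered_pairs n) False (\<lambda>a. bernoulli_pmf (?q (?h a))))
        (\<lambda>f. tree_indicator s T {?h a |a. a \<in> ordered_pairs n \<and> f a})"
    unfolding tree_prob_def independent_edges_graph_def integral_map_pmf by simp
  also have "\<dots> = subset_expectation ?q (?h ` ordered_pairs n) (tree_indicator s T)"
    by (rule expectation_Pi_pmf_bernoulli[OF fin inj]) (use q qh in force)
  also have "\<dots> = (\<Prod>e\<in>T. ?q (s ` e))"
    unfolding img tree_indicator_eq[OF T] by (rule subset_expectation_tree[OF s T])
  finally show ?thesis .
qed

lemma inverse_tree_weight_eq:
  "1 / tree_weight k s T d = inverse_tree_weight d {1..k} T s"
proof -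
  have "1 / (x powi (int m - 1)) = x powi (1 - int m)" for x :: real and m
    using power_int_minus[of x "int m - 1"] by (simp add: inverse_eq_divide)
  then show ?thesis
    unfolding tree_weight_def inverse_tree_weight_def by (simp add: prod_dividef[of "\<lambda>_. 1", simplified, symmetric])
qed

lemma tree_distance_eq:
  "tree_distance \<G> k n d = 1 / real (deg_sum n d) *
     (\<Sum>T\<in>trees k. \<Sum>s\<in>injections {1..k} n. inverse_tree_weight d {1..k} T s
        * \<bar>tree_prob \<G> s T - tree_prob (G_maxent n d) s T\<bar>)"
proof -
  have "inj_maps k n = injections {1..k} n" by (simp add: inj_maps_def injections_def)
  then show ?thesis
    unfolding tree_distance_def inverse_tree_weight_eq sum.cartesian_product[symmetric]
    by (simp only:) (subst sum.swap, rule refl)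
qed

lemma trees_D:
  assumes "T \<in> trees k"
  shows "T \<subseteq> [{1..k}]\<^bsup>2\<^esup>" "is_tree {1..k} T"
  using assms by (auto simp: trees_eq is_tree_def)

context sparse_degree_sequence
begin

lemma max_entropy_array_bounds: "0 \<le> max_entropy_array n d i j" "max_entropy_array n d i j \<le> 1"
  using px_bounds[of i j] unfolding pair_array_maxent_prob[OF polytope_nonempty] .

lemma p_nonneg: "0 \<le> p e"
  unfolding maxent_prob_def by (rule max_entropy_array_bounds)

lemma tree_prob_maxent:
  assumes "s \<in> injections V n" "finite V" "T \<subseteq> [V]\<^bsup>2\<^esup>"
  shows "tree_prob (G_maxent n d) s T = (\<Prod>e\<in>T. p (s ` e))"
  unfolding G_maxent_def maxent_prob_def using assms
  by (intro tree_prob_independent_edges)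
    (auto simp: max_entropy_array_bounds)

lemma sum_p_le: "sum p E \<le> M"
proof -
  have "sum p E \<le> (\<Sum>e\<in>E. \<Sum>i\<in>{1..n}. of_bool (i \<in> e) * p e)"
  proof (rule sum_mono)
    fix e assume "e \<in> E"
    then obtain a b where ab: "e = {a, b}" "a \<in> {1..n}" by (rule nsets2_E) blast
    have "of_bool (a \<in> e) * p e \<le> (\<Sum>i\<in>{1..n}. of_bool (i \<in> e) * p e)"
      using ab p_nonneg by (intro member_le_sum) auto
    then show "p e \<le> (\<Sum>i\<in>{1..n}. of_bool (i \<in> e) * p e)" using ab by simp
  qed
  also have "\<dots> = (\<Sum>i\<in>{1..n}. \<Sum>e\<in>E. of_bool (i \<in> e) * p e)" by (rule sum.swap)
  also have "\<dots> = (\<Sum>i\<in>{1..n}. real (d i))"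
    by (intro sum.cong refl) (simp only: sum_edges_at_vertex p_row_sum)
  finally show ?thesis by (simp add: M_eq)
qed

text \<open>Counts of trees change by a bounded amount with each edge only as long as the degrees are
  controlled. Maximizing over subgraphs with degrees at most \<open>2 d\<close> gives a function that has this
  Lipschitz property everywhere and agrees with the count on graphs with such degrees.\<close>

definition bounded_graph :: "nat set set \<Rightarrow> bool" where
  "bounded_graph H \<longleftrightarrow> H \<subseteq> E \<and> (\<forall>i\<in>{1..n}. degree H i \<le> 2 * d i)"

definition tree_count :: "((nat \<Rightarrow> nat) \<Rightarrow> real) \<Rightarrow> nat set \<Rightarrow> nat set set \<Rightarrow> nat set set \<Rightarrow> real" where
  "tree_count f V T H = tree_sum n d f (\<lambda>e. of_bool (e \<in> H)) V T"

definition truncated_count :: "((nat \<Rightarrow> nat) \<Rightarrow> real) \<Rightarrow> nat set \<Rightarrow> nat set set \<Rightarrow> nat set set \<Rightarrow> real" where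
  "truncated_count f V T G = Max (tree_count f V T ` {H. H \<subseteq> G \<and> bounded_graph H})"

definition lipschitz_const :: "nat set \<Rightarrow> real" where
  "lipschitz_const V = real (card (V \<times> V)) * 2 ^ card V"

lemma bounded_graph_row:
  assumes "bounded_graph H" "y \<in> {1..n}"
  shows "(\<Sum>x\<in>{1..n} - {y}. of_bool ({y, x} \<in> H)) \<le> 2 * real (d y)"
proof -
  have "real (degree H y) \<le> real (2 * d y)" using assms unfolding bounded_graph_def by (intro of_nat_mono) auto
  then show ?thesis using degree_eq_row_sum[of H n y] assms by (simp add: bounded_graph_def)
qed

lemma tree_count_mono:
  assumes "H \<subseteq> H'" "\<And>s. 0 \<le> f s"
  shows "tree_count f V T H \<le> tree_count f V T H'"
  unfolding tree_count_def tree_sum_def using assms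
  by (intro sum_mono mult_left_mono prod_mono inverse_tree_weight_nonneg) auto

text \<open>Only embeddings that use \<open>e0\<close> are lost. The set \<open>P\<close> of
  oriented tree edges that may lie over \<open>e0\<close> has at most
  \<open>card (V \<times> V)\<close> elements, and growing the tree from such a pinned edge costs at
  most a factor 2 per leaf. This is the origin of \<open>lipschitz_const\<close>.\<close>

lemma tree_count_remove_edge:
  assumes T: "finite V" "is_tree V T" and H: "bounded_graph H" "e0 \<in> H"
    and f: "\<And>s. 0 \<le> f s \<and> f s \<le> 1"
  shows "tree_count f V T H - tree_count f V T (H - {e0}) \<le> lipschitz_const V"
proof -
  have TV: "T \<subseteq> [V]\<^bsup>2\<^esup>" using T(2) by (simp add: is_tree_def)
  have finT: "finite T" using T(1) TV by (rule finite_graph)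
  have "e0 \<in> E" using H by (auto simp: bounded_graph_def)
  then obtain x y where xy: "e0 = {x, y}" by (rule nsets2_E)
  let ?I = "\<lambda>H s. \<Prod>e\<in>T. of_bool (s ` e \<in> H) :: real"
  define P where "P = {(u, v). u \<in> V \<and> v \<in> V \<and> {u, v} \<in> T}"
  have PV: "P \<subseteq> V \<times> V" by (auto simp: P_def)
  then have finP: "finite P" using T(1) finite_subset by blast
  have diff: "?I H s - ?I (H - {e0}) s \<le> (\<Sum>(u, v)\<in>P. of_bool (s u = x \<and> s v = y) * ?I H s)" for s
  proof (cases "(\<forall>e\<in>T. s ` e \<in> H) \<and> (\<exists>e\<in>T. s ` e = e0)")
    case True
    then obtain e where e: "e \<in> T" "s ` e = e0" by auto
    then have "e \<in> [V]\<^bsup>2\<^esup>" using TV by auto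
    then obtain a b where ab: "e = {a, b}" "a \<in> V" "b \<in> V" by (rule nsets2_E) blast
    have P: "(a, b) \<in> P" "(b, a) \<in> P" using ab e(1) by (auto simp: P_def insert_commute)
    have "{s a, s b} = {x, y}" using e(2) ab(1) xy by simp
    then have "s a = x \<and> s b = y \<or> s b = x \<and> s a = y" by (auto simp: doubleton_eq_iff)
    then obtain u v where uv: "(u, v) \<in> P" "s u = x" "s v = y" using P by blast
    have "?I H s = (case (u, v) of (u, v) \<Rightarrow> of_bool (s u = x \<and> s v = y) * ?I H s)"
      using uv by simp
    also have "\<dots> \<le> (\<Sum>(u, v)\<in>P. of_bool (s u = x \<and> s v = y) * ?I H s)"
      by (rule member_le_sum[OF uv(1) _ finP]) (auto intro!: mult_nonneg_nonneg prod_nonneg)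
    finally have "?I H s \<le> (\<Sum>(u, v)\<in>P. of_bool (s u = x \<and> s v = y) * ?I H s)" .
    moreover have "0 \<le> ?I (H - {e0}) s" by (intro prod_nonneg) simp
    ultimately show ?thesis by linarith
  next
    case False
    then have "?I H s - ?I (H - {e0}) s = 0" unfolding prod_of_bool[OF finT] by auto
    moreover have "0 \<le> (\<Sum>(u, v)\<in>P. of_bool (s u = x \<and> s v = y) * ?I H s)"
      by (intro sum_nonneg) (auto intro!: mult_nonneg_nonneg prod_nonneg)
    ultimately show ?thesis by simp
  qed
  have "tree_count f V T H - tree_count f V T (H - {e0})
    = (\<Sum>s\<in>injections V n. f s * (inverse_tree_weight d V T s * (?I H s - ?I (H - {e0}) s)))"
    by (simp add: tree_count_def tree_sum_def sum_subtractf right_diff_distrib)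
  also have "\<dots> \<le> (\<Sum>s\<in>injections V n. 1 * (inverse_tree_weight d V T s * (\<Sum>(u, v)\<in>P. of_bool (s u = x \<and> s v = y) * ?I H s)))"
  proof (intro sum_mono mult_mono mult_left_mono diff inverse_tree_weight_nonneg mult_nonneg_nonneg)
    fix s
    show "0 \<le> ?I H s - ?I (H - {e0}) s"
      unfolding diff_ge_0_iff_ge by (intro prod_mono) auto
  qed (use f in \<open>auto intro!: prod_mono\<close>)
  also have "\<dots> = (\<Sum>s\<in>injections V n. \<Sum>(u, v)\<in>P. of_bool (s u = x \<and> s v = y) * (inverse_tree_weight d V T s * ?I H s))"
    by (simp add: sum_distrib_left case_prod_beta mult_ac)
  also have "\<dots> = (\<Sum>(u, v)\<in>P. tree_sum n d (\<lambda>s. of_bool (s u = x \<and> s v = y)) (\<lambda>e. of_bool (e \<in> H)) V T)"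
    unfolding tree_sum_def by (subst sum.swap) (simp add: case_prod_beta)
  also have "\<dots> \<le> (\<Sum>(u, v)\<in>P. 2 ^ card V)"
  proof (rule sum_mono)
    fix a assume a: "a \<in> P"
    obtain u v where uv: "a = (u, v)" by (cases a)
    have uvT: "u \<in> V" "v \<in> V" "{u, v} \<in> T" using a by (auto simp: P_def uv)
    then have "{u, v} \<in> [V]\<^bsup>2\<^esup>" using TV by blast
    then have uvV: "u \<in> V" "v \<in> V" "{u, v} \<in> T" "u \<noteq> v" using uvT by simp_all
    let ?h = "\<lambda>s :: nat \<Rightarrow> nat. of_bool (s u = x \<and> s v = y) :: real" and ?\<xi> = "\<lambda>e. of_bool (e \<in> H) :: real"
    have "grows {u, v} {{u, v}} V T" using T uvV by (intro tree_grows) auto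
    then have "tree_sum n d ?h ?\<xi> V T \<le> 2 ^ (card V - card {u, v}) * tree_sum n d ?h ?\<xi> {u, v} {{u, v}}"
      by (rule tree_sum_upper) (use uvV d_pos bounded_graph_row[OF H(1)] in auto)
    also have "\<dots> \<le> 2 ^ card V * 1"
    proof (intro mult_mono power_increasing)
      show "tree_sum n d ?h ?\<xi> {u, v} {{u, v}} \<le> 1"
        using tree_sum_edge_le[OF uvV(4), of ?\<xi> x y n d] by (auto intro: order.trans)
    qed (auto intro!: tree_sum_nonneg)
    finally show "(case a of (u, v) \<Rightarrow> tree_sum n d (\<lambda>s. of_bool (s u = x \<and> s v = y)) (\<lambda>e. of_bool (e \<in> H)) V T)
      \<le> (case a of (u, v) \<Rightarrow> 2 ^ card V)" by (simp add: uv)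
  qed
  also have "\<dots> = real (card P) * 2 ^ card V" by (simp add: case_prod_beta)
  also have "\<dots> \<le> lipschitz_const V"
    unfolding lipschitz_const_def using PV T(1) by (intro mult_right_mono of_nat_mono card_mono) auto
  finally show ?thesis .
qed

lemma finite_subgraphs: "finite {H. H \<subseteq> G \<and> bounded_graph H}"
  by (rule finite_subset[of _ "Pow E"]) (auto simp: bounded_graph_def finite_E)

lemma bounded_graph_empty: "bounded_graph {}" by (simp add: bounded_graph_def)

lemma bounded_graph_subset:
  assumes "bounded_graph H" "H' \<subseteq> H"
  shows "bounded_graph H'"
proof -
  have "finite H" using assms(1) finite_E finite_subset by (auto simp: bounded_graph_def)
  then have "degree H' i \<le> degree H i" for i using assms(2) by (rule degree_mono)
  then show ?thesis using assms unfolding bounded_graph_def by (meson le_trans subset_trans)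
qed

lemma truncated_count_ge:
  "H \<subseteq> G \<Longrightarrow> bounded_graph H \<Longrightarrow> tree_count f V T H \<le> truncated_count f V T G"
  unfolding truncated_count_def by (intro Max_ge finite_imageI finite_subgraphs) auto

lemma truncated_count_le:
  assumes "\<And>H. H \<subseteq> G \<Longrightarrow> bounded_graph H \<Longrightarrow> tree_count f V T H \<le> z"
  shows "truncated_count f V T G \<le> z"
proof -
  have "tree_count f V T ` {H. H \<subseteq> G \<and> bounded_graph H} \<noteq> {}" using bounded_graph_empty by auto
  then show ?thesis
    unfolding truncated_count_def using assms by (subst Max_le_iff) (auto simp: finite_subgraphs)
qed

text \<open>The truncated count is monotone with increments at most
  \<open>lipschitz_const V\<close>, so \<open>subset_expectation_exp_le\<close> applies. Truncation
  only lowers the count, which keeps the mean below \<open>tree_sum n d f p V T\<close>.\<close>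

lemma truncated_count_exp:
  assumes T: "finite V" "is_tree V T" and f: "\<And>s. 0 \<le> f s \<and> f s \<le> 1"
    and l: "0 \<le> l" "l * lipschitz_const V \<le> 1"
  shows "subset_expectation p E (\<lambda>G. exp (l * truncated_count f V T G))
    \<le> exp (l * tree_sum n d f p V T + l\<^sup>2 * (lipschitz_const V)\<^sup>2 * M)"
proof -
  let ?X = "truncated_count f V T" and ?C = "lipschitz_const V"
  have TV: "T \<subseteq> [V]\<^bsup>2\<^esup>" using T(2) by (simp add: is_tree_def)
  have C0: "0 \<le> ?C" by (simp add: lipschitz_const_def)
  have "subset_expectation p E (\<lambda>G. exp (l * ?X G))
    \<le> exp (l * subset_expectation p E ?X + l\<^sup>2 * ?C\<^sup>2 * sum p E)"
  proof (rule subset_expectation_exp_le[OF finite_E _ _ l])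
    fix e G assume e: "e \<in> E" "G \<subseteq> E" "e \<notin> G"
    have "?X G \<le> ?X (insert e G)"
      by (rule truncated_count_le) (auto intro: truncated_count_ge)
    moreover have "?X (insert e G) \<le> ?X G + ?C"
    proof (rule truncated_count_le)
      fix H assume H: "H \<subseteq> insert e G" "bounded_graph H"
      show "tree_count f V T H \<le> ?X G + ?C"
      proof (cases "e \<in> H")
        case True
        \<comment> \<open>Without \<open>e\<close>, the graph \<open>H\<close> competes in the
          maximum for \<open>G\<close>.\<close>
        have "tree_count f V T (H - {e}) \<le> ?X G"
          using H by (intro truncated_count_ge bounded_graph_subset[OF H(2)]) auto
        moreover have "tree_count f V T H - tree_count f V T (H - {e}) \<le> ?C"
          by (rule tree_count_remove_edge[OF T H(2) True f])
        ultimately show ?thesis by linarith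
      next
        case False
        then have "tree_count f V T H \<le> ?X G" using H by (intro truncated_count_ge) auto
        then show ?thesis using C0 by linarith
      qed
    qed
    ultimately show "?X G \<le> ?X (insert e G) \<and> ?X (insert e G) - ?X G \<le> ?C" by simp
  qed (use p_bounds in auto)
  also have "\<dots> \<le> exp (l * tree_sum n d f p V T + l\<^sup>2 * ?C\<^sup>2 * M)"
  proof -
    have "subset_expectation p E ?X \<le> subset_expectation p E (tree_count f V T)"
      using p_bounds f by (intro subset_expectation_mono truncated_count_le tree_count_mono) auto
    also have "\<dots> = tree_sum n d f p V T"
      unfolding tree_count_def[abs_def] by (rule subset_expectation_tree_sum[OF T(1) TV])
    finally show ?thesis using l sum_p_le by (intro exp_le_cancel_iff[THEN iffD2] add_mono mult_left_mono) auto
  qed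
  finally show ?thesis .
qed

text \<open>Change of measure. By \<open>exp z \<ge> 1 + z\<close>, the exponential of
  \<open>l\<close> times the average is at most the average of the exponentials; on \<open>A\<close>
  the truncated count dominates the count, and the density bound moves the sum to the independent
  model at the price \<open>exp K\<close>.\<close>

lemma average_tree_count_le:
  assumes T: "finite V" "is_tree V T" and f: "\<And>s. 0 \<le> f s \<and> f s \<le> 1"
    and l: "0 < l" "l * lipschitz_const V \<le> 1"
    and A: "A \<noteq> {}" "finite A" "\<And>G. G \<in> A \<Longrightarrow> bounded_graph G"
    and K: "\<And>G. G \<in> A \<Longrightarrow> 1 / real (card A) \<le> exp K * subset_weight p E G"
  shows "(\<Sum>G\<in>A. tree_count f V T G) / real (card A)
    \<le> tree_sum n d f p V T + K / l + l * (lipschitz_const V)\<^sup>2 * M"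
proof -
  let ?X = "tree_count f V T" and ?C = "lipschitz_const V"
  define m where "m = (\<Sum>G\<in>A. ?X G) / real (card A)"
  have cA: "0 < real (card A)" using A by (simp add: card_gt_0_iff)
  have "real (card A) = (\<Sum>G\<in>A. 1 + l * (?X G - m))"
    using cA by (simp add: sum.distrib sum_distrib_left[symmetric] sum_subtractf m_def)
  also have "\<dots> \<le> (\<Sum>G\<in>A. exp (l * (?X G - m)))" by (intro sum_mono exp_ge_add_one_self)
  also have "\<dots> = (\<Sum>G\<in>A. exp (l * ?X G)) / exp (l * m)"
    by (simp add: right_diff_distrib exp_diff sum_divide_distrib)
  finally have "exp (l * m) \<le> (\<Sum>G\<in>A. exp (l * ?X G)) / real (card A)"
    using cA by (simp add: field_simps)
  also have "\<dots> = (\<Sum>G\<in>A. 1 / real (card A) * exp (l * ?X G))"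
    by (simp add: sum_divide_distrib)
  also have "\<dots> \<le> (\<Sum>G\<in>A. exp K * subset_weight p E G * exp (l * truncated_count f V T G))"
    using K A(3) l p_bounds
    by (intro sum_mono mult_mono exp_le_cancel_iff[THEN iffD2] mult_left_mono truncated_count_ge
        mult_nonneg_nonneg subset_weight_nonneg) auto
  also have "\<dots> \<le> (\<Sum>G\<in>Pow E. exp K * subset_weight p E G * exp (l * truncated_count f V T G))"
    using A(3) p_bounds finite_E
    by (intro sum_mono2) (auto simp: bounded_graph_def intro!: mult_nonneg_nonneg subset_weight_nonneg)
  also have "\<dots> = exp K * subset_expectation p E (\<lambda>G. exp (l * truncated_count f V T G))"
    by (simp add: subset_expectation_def sum_distrib_left mult_ac)
  also have "\<dots> \<le> exp K * exp (l * tree_sum n d f p V T + l\<^sup>2 * ?C\<^sup>2 * M)"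
    using truncated_count_exp[OF T f _ l(2)] l(1) by (intro mult_left_mono) auto
  also have "\<dots> = exp (l * (tree_sum n d f p V T + K / l + l * ?C\<^sup>2 * M))"
    using l(1) by (simp add: exp_add[symmetric] algebra_simps power2_eq_square)
  finally have "l * m \<le> l * (tree_sum n d f p V T + K / l + l * ?C\<^sup>2 * M)" by simp
  then show ?thesis unfolding mult_le_cancel_left_pos[OF l(1)] m_def .
qed

text \<open>Two defects make up the loss \<open>g y\<close> at a vertex: its degree deviation, and
  the at most \<open>card V\<close> neighbours already occupied by the embedding.\<close>

lemma tree_count_lower:
  assumes T: "finite V" "is_tree V T" "V \<noteq> {}" and G: "bounded_graph G"
  shows "M - real (card V) * 2 ^ card V * (degree_deviation G + real (card V) * real n) \<le> tree_count (\<lambda>_. 1) V T G"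
proof -
  let ?\<xi> = "\<lambda>e. of_bool (e \<in> G) :: real"
  define g where "g y = \<bar>real (degree G y) - real (d y)\<bar> + real (card V)" for y
  obtain r where r: "r \<in> V" using T(3) by auto
  have GE: "G \<subseteq> E" using G by (simp add: bounded_graph_def)
  have acyc: "\<nexists>c. graph_cycle T c" using T(2) by (simp add: is_tree_def)
  have "grows {r} {} V T" using T r by (intro tree_grows) auto
  then have "(\<Sum>y\<in>{1..n}. real (d y)) - real (card V) * 2 ^ card V * (\<Sum>y\<in>{1..n}. g y) \<le> tree_sum n d (\<lambda>_. 1) ?\<xi> V T"
  proof (rule tree_sum_lower[OF _ subset_refl acyc order_refl])
    fix y :: nat and U :: "nat set" assume y: "y \<in> {1..n}" and U: "finite U" "card U \<le> card V"
    have "real (degree G y) = (\<Sum>x\<in>{1..n} - {y}. ?\<xi> {y, x})" by (rule degree_eq_row_sum[OF GE y])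
    also have "\<dots> \<le> (\<Sum>x\<in>({1..n} - U) \<union> U. ?\<xi> {y, x})" using U by (intro sum_mono2) auto
    also have "\<dots> = (\<Sum>x\<in>{1..n} - U. ?\<xi> {y, x}) + (\<Sum>x\<in>U. ?\<xi> {y, x})"
      using U by (intro sum.union_disjoint) auto
    also have "(\<Sum>x\<in>U. ?\<xi> {y, x}) \<le> (\<Sum>x\<in>U. 1)" by (intro sum_mono) auto
    also have "\<dots> \<le> real (card V)" using U by simp
    finally show "real (d y) - (\<Sum>x\<in>{1..n} - U. ?\<xi> {y, x}) \<le> g y" by (simp add: g_def)
  qed (use d_pos bounded_graph_row[OF G] in \<open>auto simp: g_def\<close>)
  moreover have "(\<Sum>y\<in>{1..n}. g y) = degree_deviation G + real (card V) * real n"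
    by (simp add: g_def degree_deviation_def sum.distrib)
  ultimately show ?thesis by (simp add: M_eq tree_count_def)
qed

lemma uniform_tree_distance:
  assumes T: "finite V" "is_tree V T" "V \<noteq> {}"
    and l: "0 < l" "l * lipschitz_const V \<le> 1"
    and A: "A \<noteq> {}" "finite A" "\<And>G. G \<in> A \<Longrightarrow> bounded_graph G"
    and K: "\<And>G. G \<in> A \<Longrightarrow> 1 / real (card A) \<le> exp K * subset_weight p E G"
    and dev: "\<And>G. G \<in> A \<Longrightarrow> degree_deviation G \<le> r"
  shows "(\<Sum>s\<in>injections V n. inverse_tree_weight d V T s
        * \<bar>tree_prob (pmf_of_set A) s T - tree_prob (G_maxent n d) s T\<bar>)
    \<le> 2 * (K / l + l * (lipschitz_const V)\<^sup>2 * M) + real (card V) * 2 ^ card V * (r + real (card V) * real n)"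
proof -
  have TV: "T \<subseteq> [V]\<^bsup>2\<^esup>" using T(2) by (simp add: is_tree_def)
  have cA: "0 < real (card A)" using A by (simp add: card_gt_0_iff)
  define a where "a s = tree_prob (pmf_of_set A) s T" for s
  define b where "b s = (\<Prod>e\<in>T. p (s ` e))" for s
  define f :: "(nat \<Rightarrow> nat) \<Rightarrow> real" where "f s = of_bool (b s < a s)" for s
  let ?w = "inverse_tree_weight d V T" and ?I = "injections V n"
  have a: "a s = (\<Sum>G\<in>A. \<Prod>e\<in>T. of_bool (s ` e \<in> G)) / real (card A)" for s
    unfolding a_def tree_prob_def integral_pmf_of_set[OF A(1,2)] tree_indicator_eq[OF T(1) TV] ..
  have avg: "(\<Sum>s\<in>?I. h s * (?w s * a s)) = (\<Sum>G\<in>A. tree_count h V T G) / real (card A)" for h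
  proof -
    have "(\<Sum>s\<in>?I. h s * (?w s * a s)) = (\<Sum>s\<in>?I. \<Sum>G\<in>A. h s * (?w s * (\<Prod>e\<in>T. of_bool (s ` e \<in> G))) / real (card A))"
      by (simp add: a sum_divide_distrib sum_distrib_left)
    also have "\<dots> = (\<Sum>G\<in>A. \<Sum>s\<in>?I. h s * (?w s * (\<Prod>e\<in>T. of_bool (s ` e \<in> G))) / real (card A))"
      by (rule sum.swap)
    finally show ?thesis by (simp add: tree_count_def tree_sum_def sum_divide_distrib)
  qed
  have "(\<Sum>s\<in>?I. ?w s * \<bar>a s - tree_prob (G_maxent n d) s T\<bar>) = (\<Sum>s\<in>?I. ?w s * \<bar>a s - b s\<bar>)"
    using tree_prob_maxent[OF _ T(1) TV] by (intro sum.cong refl) (simp add: b_def)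
  \<comment> \<open>This is \<open>\<bar>x\<bar> = 2 * max 0 x - x\<close>, with \<open>f\<close>
    marking the positive terms. Concentration bounds the first part, comparison of totals the
    second.\<close>
  also have "\<dots> = (\<Sum>s\<in>?I. 2 * (f s * (?w s * a s) - f s * (?w s * b s)) - (1 * (?w s * a s) - 1 * (?w s * b s)))"
    by (intro sum.cong refl) (auto simp: f_def algebra_simps)
  also have "\<dots> = 2 * ((\<Sum>s\<in>?I. f s * (?w s * a s)) - tree_sum n d f p V T)
     - ((\<Sum>s\<in>?I. 1 * (?w s * a s)) - tree_sum n d (\<lambda>_. 1) p V T)"
    by (simp only: sum_subtractf sum_distrib_left[symmetric] tree_sum_def b_def)
  also have "\<dots> \<le> 2 * (K / l + l * (lipschitz_const V)\<^sup>2 * M)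
    + real (card V) * 2 ^ card V * (r + real (card V) * real n)"
  proof -
    have "(\<Sum>s\<in>?I. f s * (?w s * a s)) \<le> tree_sum n d f p V T + K / l + l * (lipschitz_const V)\<^sup>2 * M"
      unfolding avg by (rule average_tree_count_le[OF T(1,2) _ l A K]) (auto simp: f_def)
    moreover have "M - real (card V) * 2 ^ card V * (r + real (card V) * real n) \<le> (\<Sum>s\<in>?I. 1 * (?w s * a s))"
    proof -
      have "M - real (card V) * 2 ^ card V * (r + real (card V) * real n) \<le> tree_count (\<lambda>_. 1) V T G" if "G \<in> A" for G
      proof -
        have "real (card V) * 2 ^ card V * (degree_deviation G + real (card V) * real n)
          \<le> real (card V) * 2 ^ card V * (r + real (card V) * real n)"
          using dev[OF that] by (intro mult_left_mono) auto
        then show ?thesis using tree_count_lower[OF T A(3)[OF that]] by linarith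
      qed
      then have "real (card A) * (M - real (card V) * 2 ^ card V * (r + real (card V) * real n))
         \<le> (\<Sum>G\<in>A. tree_count (\<lambda>_. 1) V T G)"
        by (rule sum_bounded_below)
      then show ?thesis unfolding avg using cA by (simp add: pos_le_divide_eq mult.commute)
    qed
    moreover have "tree_sum n d (\<lambda>_. 1) p V T \<le> M"
    proof -
      obtain u where "u \<in> V" using T(3) by auto
      then have "tree_sum n d (\<lambda>s. (\<lambda>_. 1) (s u)) p V T \<le> 1 ^ (card V - 1) * (\<Sum>y\<in>{1..n}. 1 * real (d y))"
        using p_row_sum d_pos p_nonneg by (intro tree_sum_rooted_upper[OF T(1,2)]) auto
      then show ?thesis by (simp add: M_eq)
    qed
    moreover have "2 * (X - Y) - (Z - W) \<le> 2 * (K1 + K2) + L"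
      if "X \<le> Y + K1 + K2" "M - L \<le> Z" "W \<le> M" for X Y Z W K1 K2 L :: real
    proof -
      have "2 * (X - Y) + (W - Z) \<le> 2 * (K1 + K2) + L"
        using that by (intro add_mono mult_left_mono) auto
      then show ?thesis by simp
    qed
    ultimately show ?thesis by blast
  qed
  finally show ?thesis by (simp only: a_def)
qed

end

section \<open>Tree distances\<close>

text \<open>After division by \<open>b\<close> all factors have absolute value at most 1, where
  \<open>norm_prod_diff\<close> bounds the difference by a sum.\<close>

lemma prod_diff_le:
  fixes u v b :: "'a \<Rightarrow> real"
  assumes "finite T" and b: "\<And>e. e \<in> T \<Longrightarrow> 0 < b e"
    and uv: "\<And>e. e \<in> T \<Longrightarrow> \<bar>u e\<bar> \<le> b e" "\<And>e. e \<in> T \<Longrightarrow> \<bar>v e\<bar> \<le> b e"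
    and diff: "\<And>e. e \<in> T \<Longrightarrow> \<bar>u e - v e\<bar> \<le> z * b e"
  shows "\<bar>(\<Prod>e\<in>T. u e) - (\<Prod>e\<in>T. v e)\<bar> \<le> real (card T) * z * (\<Prod>e\<in>T. b e)"
proof -
  have B: "0 < prod b T" using b by (rule prod_pos)
  have "\<bar>(\<Prod>e\<in>T. u e / b e) - (\<Prod>e\<in>T. v e / b e)\<bar> \<le> (\<Sum>e\<in>T. \<bar>u e / b e - v e / b e\<bar>)"
    using norm_prod_diff[of T "\<lambda>e. u e / b e" "\<lambda>e. v e / b e"] b uv by (force simp: divide_le_eq)
  also have "\<dots> \<le> (\<Sum>e\<in>T. z)"
  proof (rule sum_mono)
    fix e assume e: "e \<in> T"
    then have "\<bar>u e / b e - v e / b e\<bar> = \<bar>u e - v e\<bar> / b e"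
      using b[OF e] by (simp add: diff_divide_distrib[symmetric])
    then show "\<bar>u e / b e - v e / b e\<bar> \<le> z" using diff[OF e] b[OF e] by (simp add: divide_le_eq)
  qed
  finally have "\<bar>(\<Prod>e\<in>T. u e / b e) - (\<Prod>e\<in>T. v e / b e)\<bar> \<le> real (card T) * z" by simp
  moreover have "(\<Prod>e\<in>T. u e / b e) - (\<Prod>e\<in>T. v e / b e) = ((\<Prod>e\<in>T. u e) - (\<Prod>e\<in>T. v e)) / prod b T"
    by (simp add: prod_dividef diff_divide_distrib)
  ultimately show ?thesis using B by (simp add: divide_le_eq)
qed

context sparse_degree_sequence
begin

section \<open>The error parameter and uniform families\<close>

definition eta :: "real \<Rightarrow> real" where
  "eta \<alpha> = (real n / M) powr (1 / 4) * real n powr \<alpha>"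

lemma eta_pos: "0 < eta \<alpha>"
  using n_pos M_pos by (simp add: eta_def)

lemma eta_squared: "(eta \<alpha>)\<^sup>2 = (real n / M) powr (1 / 2) * real n powr (2 * \<alpha>)"
proof -
  have "(eta \<alpha>)\<^sup>2 = ((real n / M) powr (1 / 4) * (real n / M) powr (1 / 4)) * (real n powr \<alpha> * real n powr \<alpha>)"
    by (simp add: eta_def power2_eq_square mult_ac)
  then show ?thesis by (simp add: powr_add[symmetric])
qed

text \<open>A deviation bound \<open>sqrt (n * M) * n powr \<alpha>\<close> is smaller than this by
  a factor \<open>n powr \<alpha>\<close>, which is the room for the logarithms.\<close>

lemma M_eta_squared: "M * (eta \<alpha>)\<^sup>2 = sqrt (real n * M) * real n powr (2 * \<alpha>)"
proof -
  have "M * (real n / M) powr (1 / 2) = sqrt (real n * M)"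
    using M_pos by (simp add: powr_half_sqrt real_sqrt_divide real_sqrt_mult field_simps)
  then show ?thesis by (simp add: eta_squared)
qed

text \<open>With \<open>L = ln n\<close>, the factor \<open>2 * M * card E\<close> has logarithm at
  most \<open>5 * L\<close> and occurs with exponent \<open>6 * s\<close>, the factor
  \<open>2 * M\<close> at most \<open>3 * L\<close> with exponent \<open>3 * r\<close>, and
  \<open>ln 6 \<le> r * L\<close>. As \<open>s \<le> r\<close>, the total is at most
  \<open>40 * r * L\<close>, within the allowed 42.\<close>

lemma uniform_density_exp:
  assumes A: "graphs_with_degrees n d \<subseteq> A" "A \<subseteq> Pow E"
    and dev: "\<And>G. G \<in> A \<Longrightarrow> degree_deviation G \<le> sqrt (real n * M) * real n powr \<alpha>"
    and \<alpha>: "0 < \<alpha>" "42 * ln (real n) \<le> real n powr \<alpha>"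
    and G: "G \<in> A"
  shows "1 / real (card A) \<le> exp (M * (eta \<alpha>)\<^sup>2) * subset_weight p E G"
proof -
  define s where "s = sqrt (real n * M)"
  define r where "r = s * real n powr \<alpha>"
  define L where "L = ln (real n)"
  have n24: "24 \<le> real n" using d_n_le_n d_n_ge_1 by linarith
  have pn: "1 \<le> real n powr \<alpha>" using n24 \<alpha> by (intro ge_one_powr_ge_zero) auto
  have "1 * 1 \<le> real n * M" using n24 M_ge_24 by (intro mult_mono) auto
  then have s1: "1 \<le> s" by (simp add: s_def)
  have sr: "s \<le> r" using mult_left_mono[OF pn, of s] s1 by (simp add: r_def)
  have L0: "0 \<le> L" using n24 by (simp add: L_def)
  have cE: "1 \<le> real (card E)" using E_nonempty finite_E by (metis One_nat_def Suc_leI card_gt_0_iff of_nat_1 of_nat_mono)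
  have lM: "ln (2 * M) \<le> 3 * L"
  proof -
    have "2 * M \<le> real n * (real n)\<^sup>2" using n24 M_le_n2 M_pos by (intro mult_mono) auto
    then have "ln (2 * M) \<le> ln (real n ^ 3)" using M_pos by (simp add: power2_eq_square power3_eq_cube)
    then show ?thesis using n24 by (simp add: L_def ln_realpow)
  qed
  have "ln (real (card E)) \<le> ln ((real n)\<^sup>2)" using card_E_le cE by (intro ln_mono) linarith+
  then have lE: "ln (real (card E)) \<le> 2 * L" using n24 by (simp add: L_def ln_realpow)
  have "ln (2 * M * real (card E)) = ln (2 * M) + ln (real (card E))"
    by (rule ln_mult_pos) (use M_pos cE in linarith)+
  then have lME: "ln (2 * M * real (card E)) \<le> 5 * L" using lM lE by linarith
  have "ln 6 \<le> ln (real n)" using n24 by simp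
  then have l6: "ln 6 \<le> r * L" using mult_right_mono[of 1 r L] sr s1 L0 by (simp add: L_def)
  have "6 * (2 * M * real (card E)) powr (6 * s) * (2 * M) powr (3 * r)
     = exp (ln 6 + 6 * s * ln (2 * M * real (card E)) + 3 * r * ln (2 * M))"
  proof -
    have powr_exp: "u powr v = exp (v * ln u)" if "0 < u" for u v :: real
      using that by (simp add: powr_def)
    have "0 < 2 * M * real (card E)" "0 < 2 * M"
      using M_pos cE by (intro mult_pos_pos; linarith)+
    from this[THEN powr_exp] show ?thesis by (simp only: exp_add) simp
  qed
  also have "\<dots> \<le> exp (M * (eta \<alpha>)\<^sup>2)"
  proof (rule exp_le_cancel_iff[THEN iffD2])
    have "6 * s * ln (2 * M * real (card E)) \<le> 6 * s * (5 * L)"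
      using lME s1 by (intro mult_left_mono) auto
    also have "\<dots> = 30 * (s * L)" by simp
    also have "\<dots> \<le> 30 * (r * L)" using sr L0 by (intro mult_left_mono mult_right_mono) auto
    finally have 1: "6 * s * ln (2 * M * real (card E)) \<le> 30 * (r * L)" .
    have "3 * r * ln (2 * M) \<le> 3 * r * (3 * L)"
      using lM s1 sr by (intro mult_left_mono) auto
    then have 2: "3 * r * ln (2 * M) \<le> 9 * (r * L)" by simp
    have "0 \<le> r * L" using sr s1 L0 by simp
    then have "ln 6 + 6 * s * ln (2 * M * real (card E)) + 3 * r * ln (2 * M) \<le> 42 * (r * L)"
      using 1 2 l6 by linarith
    also have "\<dots> = r * (42 * L)" by simp
    also have "\<dots> \<le> r * real n powr \<alpha>"
      using \<alpha>(2) sr s1 by (intro mult_left_mono) (auto simp: L_def)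
    also have "\<dots> = M * (eta \<alpha>)\<^sup>2"
      unfolding M_eta_squared r_def s_def by (simp add: powr_add[symmetric])
    finally show "ln 6 + 6 * s * ln (2 * M * real (card E)) + 3 * r * ln (2 * M) \<le> M * (eta \<alpha>)\<^sup>2" .
  qed
  finally have "6 * (2 * M * real (card E)) powr (6 * s) * (2 * M) powr (3 * r) * subset_weight p E G
    \<le> exp (M * (eta \<alpha>)\<^sup>2) * subset_weight p E G"
    using p_bounds by (intro mult_right_mono subset_weight_nonneg) auto
  moreover have "1 / real (card A)
      \<le> 6 * (2 * M * real (card E)) powr (6 * s) * (2 * M) powr (3 * r) * subset_weight p E G"
    unfolding s_def using uniform_density_bound[OF A _ G, of r] dev by (simp add: r_def s_def)
  ultimately show ?thesis by linarith
qed

lemma uniform_L_bound: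
  assumes A: "graphs_with_degrees n d \<subseteq> A" "\<And>G. G \<in> A \<Longrightarrow> bounded_graph G"
    and dev: "\<And>G. G \<in> A \<Longrightarrow> degree_deviation G \<le> sqrt (real n * M) * real n powr \<alpha>"
    and \<alpha>: "0 < \<alpha>" "42 * ln (real n) \<le> real n powr \<alpha>" "eta \<alpha> \<le> 1"
    and k: "1 \<le> k"
  shows "tree_distance (pmf_of_set A) k n d
    \<le> real (card (trees k)) * (4 * lipschitz_const {1..k} + real k * 2 ^ k * (1 + real k)) * eta \<alpha>"
proof -
  define C where "C = lipschitz_const {1..k}"
  define K where "K = M * (eta \<alpha>)\<^sup>2"
  define R where "R = (4 * C + real k * 2 ^ k * (1 + real k)) * (M * eta \<alpha>)"
  have AE: "A \<subseteq> Pow E" using A(2) by (auto simp: bounded_graph_def)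
  have A': "A \<noteq> {}" using A(1) graphs_with_degrees_nonempty by auto
  have finA: "finite A" by (rule finite_subset[OF AE]) (simp add: finite_E)
  have C1: "1 \<le> C"
  proof -
    have "1 * 1 \<le> real k * real k" using k by (intro mult_mono) auto
    then have "1 * 1 \<le> real (card ({1..k} \<times> {1..k})) * 2 ^ card {1..k}"
      by (intro mult_mono) auto
    then show ?thesis by (simp add: C_def lipschitz_const_def)
  qed
  have e0: "0 < eta \<alpha>" by (rule eta_pos)
  \<comment> \<open>This makes \<open>K / l\<close> and \<open>l * C\<^sup>2 * M\<close> both equal
    to \<open>C * M * eta \<alpha>\<close>, and \<open>eta \<alpha> \<le> 1\<close> gives
    \<open>l * C \<le> 1\<close>.\<close>
  define l where "l = eta \<alpha> / C"
  have l: "0 < l" "l * C \<le> 1" using e0 C1 \<alpha>(3) by (auto simp: l_def)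
  \<comment> \<open>Thus the errors \<open>r\<close> and \<open>n\<close>, which are at most
    \<open>K\<close>, are absorbed into \<open>M * eta \<alpha>\<close>.\<close>
  have KM: "K \<le> M * eta \<alpha>"
  proof -
    have "eta \<alpha> * eta \<alpha> \<le> eta \<alpha> * 1" using \<alpha>(3) e0 by (intro mult_left_mono) auto
    then show ?thesis using M_pos by (simp add: K_def power2_eq_square)
  qed
  define s where "s = sqrt (real n * M)"
  define r where "r = s * real n powr \<alpha>"
  have pn: "1 \<le> real n powr \<alpha>" using n_pos \<alpha> by (intro ge_one_powr_ge_zero) auto
  have s0: "0 \<le> s" using M_pos by (simp add: s_def)
  have rK: "r \<le> K"
  proof -
    have "r * 1 \<le> r * real n powr \<alpha>" using pn s0 by (intro mult_left_mono) (auto simp: r_def)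
    also have "\<dots> = K" unfolding K_def M_eta_squared r_def s_def by (simp add: powr_add[symmetric])
    finally show ?thesis by simp
  qed
  have nK: "real n \<le> K"
  proof -
    have "(real n)\<^sup>2 \<le> real n * M" using n_le_M by (simp add: power2_eq_square mult_left_mono)
    then have "real n \<le> s" unfolding s_def by (rule real_le_rsqrt)
    also have "s * 1 \<le> r" unfolding r_def using pn s0 by (intro mult_left_mono)
    finally show ?thesis using rK by simp
  qed
  have "(\<Sum>s\<in>injections {1..k} n. inverse_tree_weight d {1..k} T s
        * \<bar>tree_prob (pmf_of_set A) s T - tree_prob (G_maxent n d) s T\<bar>) \<le> R"
    if T: "T \<in> trees k" for T
  proof -
    have "(\<Sum>s\<in>injections {1..k} n. inverse_tree_weight d {1..k} T s
        * \<bar>tree_prob (pmf_of_set A) s T - tree_prob (G_maxent n d) s T\<bar>)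
      \<le> 2 * (K / l + l * (lipschitz_const {1..k})\<^sup>2 * M)
        + real (card {1..k}) * 2 ^ card {1..k} * (r + real (card {1..k}) * real n)"
    proof (rule uniform_tree_distance[OF _ trees_D(2)[OF T] _ l(1) _ A' finA A(2)])
      show "1 / real (card A) \<le> exp K * subset_weight p E G" if "G \<in> A" for G
        unfolding K_def by (rule uniform_density_exp[OF A(1) AE dev \<alpha>(1,2) that])
      show "degree_deviation G \<le> r" if "G \<in> A" for G using dev[OF that] by (simp add: r_def s_def)
    qed (use l k in \<open>auto simp: C_def\<close>)
    also have "\<dots> \<le> R"
    proof -
      have Kl: "K / l = C * (M * eta \<alpha>)" "l * C\<^sup>2 * M = C * (M * eta \<alpha>)"
        using C1 e0 by (simp_all add: l_def K_def power2_eq_square field_simps)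
      have R: "R = 2 * (C * (M * eta \<alpha>) + C * (M * eta \<alpha>)) + real k * 2 ^ k * ((1 + real k) * (M * eta \<alpha>))"
        by (simp add: R_def algebra_simps)
      have card: "card {1..k} = k" by simp
      show ?thesis
        unfolding R C_def[symmetric] card Kl
      proof (rule add_left_mono)
        show "real k * 2 ^ k * (r + real k * real n) \<le> real k * 2 ^ k * ((1 + real k) * (M * eta \<alpha>))"
        proof (rule mult_left_mono)
          have "real k * real n \<le> real k * (M * eta \<alpha>)" using nK KM by (intro mult_left_mono) auto
          then show "r + real k * real n \<le> (1 + real k) * (M * eta \<alpha>)"
            using rK KM by (simp add: distrib_right)
        qed simp
      qed
    qed
    finally show ?thesis .
  qed
  then have "tree_distance (pmf_of_set A) k n d \<le> 1 / M * (real (card (trees k)) * R)"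
    unfolding tree_distance_eq using M_pos by (intro mult_left_mono sum_bounded_above) auto
  also have "\<dots> = real (card (trees k)) * (4 * C + real k * 2 ^ k * (1 + real k)) * eta \<alpha>"
    using M_pos by (simp add: R_def)
  finally show ?thesis by (simp add: C_def)
qed

lemma graphs_with_degrees_bounded:
  assumes "G \<in> graphs_with_degrees n d"
  shows "bounded_graph G" "degree_deviation G = 0"
  using assms by (auto simp: graphs_with_degrees_def bounded_graph_def degree_deviation_def)

text \<open>Split \<open>d^a\<close> as \<open>sqrt d * d^(a - 1/2)\<close>, where the second factor
  is at most \<open>n^(a - 1/2)\<close>; the square roots are summed by Cauchy-Schwarz. The bound
  \<open>a < 1\<close> keeps degrees at most twice their targets, as the truncation demands.\<close>

lemma graphs_almost_degrees_bounded:
  assumes a: "1 / 2 < a" "a < 1" and G: "G \<in> graphs_almost_degrees a n d"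
  shows "bounded_graph G" "degree_deviation G \<le> sqrt (real n * M) * real n powr (a - 1 / 2)"
proof -
  have GE: "G \<subseteq> E" and close: "\<bar>real (degree G i) - real (d i)\<bar> \<le> real (d i) powr a" if "i \<in> {1..n}" for i
    using G that by (auto simp: graphs_almost_degrees_def graphs_with_degrees_def abs_minus_commute less_imp_le)
  have GE: "G \<subseteq> E" using GE[of 1] n_pos by auto
  have "degree G i \<le> 2 * d i" if i: "i \<in> {1..n}" for i
  proof -
    have "real (d i) powr a \<le> real (d i) powr 1" using d_pos[OF i] a by (intro powr_mono) auto
    then have "real (degree G i) \<le> real (2 * d i)" using close[OF i] by simp
    then show ?thesis by (rule of_nat_le_iff[THEN iffD1])
  qed
  then show "bounded_graph G" using GE by (simp add: bounded_graph_def)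
  have "degree_deviation G \<le> (\<Sum>i\<in>{1..n}. sqrt (real (d i)) * real n powr (a - 1 / 2))"
    unfolding degree_deviation_def
  proof (rule sum_mono)
    fix i assume i: "i \<in> {1..n}"
    have "real (d i) \<le> real n" using d_le[OF i] d_n_le_n by linarith
    then have "real (d i) powr (a - 1 / 2) \<le> real n powr (a - 1 / 2)" using a by (intro powr_mono2) auto
    then have "sqrt (real (d i)) * real (d i) powr (a - 1 / 2) \<le> sqrt (real (d i)) * real n powr (a - 1 / 2)"
      by (intro mult_left_mono) auto
    moreover have "real (d i) powr a = sqrt (real (d i)) * real (d i) powr (a - 1 / 2)"
      by (simp add: powr_half_sqrt[symmetric] powr_add[symmetric])
    ultimately show "\<bar>real (degree G i) - real (d i)\<bar> \<le> sqrt (real (d i)) * real n powr (a - 1 / 2)"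
      using close[OF i] by linarith
  qed
  also have "\<dots> = (\<Sum>i\<in>{1..n}. sqrt (real (d i))) * real n powr (a - 1 / 2)" by (simp add: sum_distrib_right)
  also have "\<dots> \<le> sqrt (real n * M) * real n powr (a - 1 / 2)"
    using sum_sqrt_d_le by (intro mult_right_mono) auto
  finally show "degree_deviation G \<le> sqrt (real n * M) * real n powr (a - 1 / 2)" .
qed

lemma graphs_with_degrees_subset: "graphs_with_degrees n d \<subseteq> graphs_almost_degrees a n d"
proof -
  have "\<bar>real (d i) - real (d i)\<bar> < real (d i) powr a" if "i \<in> {1..n}" for i
    using d_pos[OF that] by simp
  then show ?thesis unfolding graphs_almost_degrees_def by blast
qed

text \<open>Both edge probabilities are dominated by \<open>b = 2 * P\<close> with
  \<open>P = d i * d j / M\<close>. The row sums of \<open>b\<close> are at most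
  \<open>2 * d\<close>, so the product differences add up to a controlled tree sum. Moreover
  \<open>q\<close> differs from \<open>P\<close> by at most \<open>\<delta> * P\<close> and
  \<open>p\<close> by at most \<open>12 * \<delta> * P\<close>, together less than
  \<open>14 * \<delta> * P = 7 * \<delta> * b\<close>.\<close>

lemma L_q_bound:
  assumes k: "1 \<le> k"
  shows "L_q k n d \<le> real (card (trees k)) * (real (card ([{1..k}]\<^bsup>2\<^esup>)) * 7 * 2 ^ k) * \<delta>"
proof -
  define q where "q i j = real (d i) * real (d j) / (M + real (d i) * real (d j))" for i j
  define b where "b e = 2 * (real (d (Min e)) * real (d (Max e)) / M)" for e
  have b_pair: "b {i, j} = 2 * (real (d i) * real (d j) / M)" for i j
    by (cases "i \<le> j") (auto simp: b_def min_def max_def mult_ac)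
  have b0: "0 \<le> b e" for e using M_pos by (simp add: b_def)
  have q_pair: "q (Min {i, j}) (Max {i, j}) = q i j" for i j
    by (cases "i \<le> j") (auto simp: q_def min_def max_def mult_ac)
  have q01: "0 \<le> q i j \<and> q i j \<le> 1" for i j
    using M_pos by (auto simp: q_def divide_le_eq add_pos_nonneg)
  have edge: "0 < b e \<and> \<bar>q (Min e) (Max e)\<bar> \<le> b e \<and> \<bar>p e\<bar> \<le> b e \<and> \<bar>q (Min e) (Max e) - p e\<bar> \<le> 7 * \<delta> * b e"
    if e: "e \<in> E" for e
  proof -
    obtain i j where ij: "e = {i, j}" "i \<in> {1..n}" "j \<in> {1..n}" "i \<noteq> j" "px i j = p e"
      using e by (rule edge_cases)
    define N where "N = real (d i) * real (d j)"
    define P where "P = N / M"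
    have "1 * 1 \<le> N" unfolding N_def using d_pos ij by (intro mult_mono) auto
    then have N1: "1 \<le> N" by simp
    then have P0: "0 < P" using M_pos by (simp add: P_def)
    have "N \<le> real (d n) * real (d n)" unfolding N_def using d_le ij by (intro mult_mono) auto
    then have P\<delta>: "P \<le> \<delta>" using M_pos by (simp add: P_def \<delta>_def power2_eq_square divide_right_mono)
    define Q where "Q = N / (M + N)"
    have qQ: "q i j = Q" by (simp add: q_def N_def Q_def)
    have Q0: "0 \<le> Q" using q01[of i j] by (simp add: qQ)
    have QP: "Q \<le> P" unfolding P_def Q_def using N1 M_pos by (intro divide_left_mono mult_pos_pos) auto
    have "P - Q = P * Q" using N1 M_pos by (simp add: P_def Q_def field_simps)
    also have "\<dots> \<le> P * \<delta>" using QP P\<delta> P0 by (intro mult_left_mono) auto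
    finally have "P - Q \<le> P * \<delta>" .
    moreover have "\<bar>p e - P\<bar> \<le> 12 * (P * \<delta>)"
      using p_approx[OF ij(2-4)] by (simp add: ij(1) P_def N_def mult_ac)
    moreover have "p e \<le> 2 * P"
      using px_upper2[OF ij(2,3)] ij(5) by (simp add: P_def N_def)
    moreover have "0 \<le> P * \<delta>" using P0 delta_bounds by simp
    ultimately have "\<bar>Q - p e\<bar> \<le> 14 * (P * \<delta>)" "\<bar>p e\<bar> \<le> 2 * P" "\<bar>Q\<bar> \<le> 2 * P"
      using p_nonneg[of e] Q0 QP P0 by linarith+
    moreover have "b e = 2 * P" by (simp add: ij(1) b_pair P_def N_def)
    ultimately show ?thesis using P0 q_pair[of i j] qQ by (simp add: ij(1) mult_ac)
  qed
  have "(\<Sum>s\<in>injections {1..k} n. inverse_tree_weight d {1..k} T s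
        * \<bar>tree_prob (G_q n d) s T - tree_prob (G_maxent n d) s T\<bar>)
      \<le> real (card ([{1..k}]\<^bsup>2\<^esup>)) * 7 * 2 ^ k * \<delta> * M"
    if T: "T \<in> trees k" for T
  proof -
    let ?m = "real (card ([{1..k}]\<^bsup>2\<^esup>))" and ?w = "inverse_tree_weight d {1..k} T"
    note TV = trees_D(1)[OF T]
    have finT: "finite T" using TV by (rule finite_graph[rotated]) simp
    have cT: "real (card T) \<le> ?m"
      using TV by (intro of_nat_mono card_mono finite_imp_finite_nsets) auto
    have "(\<Sum>s\<in>injections {1..k} n. ?w s * \<bar>tree_prob (G_q n d) s T - tree_prob (G_maxent n d) s T\<bar>)
      \<le> (\<Sum>s\<in>injections {1..k} n. ?w s * (?m * (7 * \<delta>) * (\<Prod>e\<in>T. b (s ` e))))"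
    proof (intro sum_mono mult_left_mono inverse_tree_weight_nonneg)
      fix s assume s: "s \<in> injections {1..k} n"
      have sE: "s ` e \<in> E" if "e \<in> T" for e using image_edges(2)[OF s TV] that by blast
      have "tree_prob (G_q n d) s T = (\<Prod>e\<in>T. q (Min (s ` e)) (Max (s ` e)))"
        unfolding G_q_def q_def[symmetric] using q01
        by (intro tree_prob_independent_edges[OF s _ TV]) (auto simp: q_def)
      moreover have "tree_prob (G_maxent n d) s T = (\<Prod>e\<in>T. p (s ` e))"
        by (rule tree_prob_maxent[OF s _ TV]) simp
      ultimately have "\<bar>tree_prob (G_q n d) s T - tree_prob (G_maxent n d) s T\<bar>
          \<le> real (card T) * (7 * \<delta>) * (\<Prod>e\<in>T. b (s ` e))"
        using edge[OF sE] by (simp only:) (intro prod_diff_le finT, auto)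
      also have "\<dots> \<le> ?m * (7 * \<delta>) * (\<Prod>e\<in>T. b (s ` e))"
        using cT delta_bounds b0 by (intro mult_right_mono prod_nonneg) auto
      finally show "\<bar>tree_prob (G_q n d) s T - tree_prob (G_maxent n d) s T\<bar>
          \<le> ?m * (7 * \<delta>) * (\<Prod>e\<in>T. b (s ` e))" .
    qed
    also have "\<dots> = ?m * (7 * \<delta>) * tree_sum n d (\<lambda>_. 1) b {1..k} T"
      by (simp add: tree_sum_def sum_distrib_left mult_ac)
    also have "\<dots> \<le> ?m * (7 * \<delta>) * (2 ^ k * M)"
    proof (intro mult_left_mono)
      have "tree_sum n d (\<lambda>s. (\<lambda>_. 1) (s 1)) b {1..k} T \<le> 2 ^ (card {1..k} - 1) * (\<Sum>y\<in>{1..n}. 1 * real (d y))"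
      proof (rule tree_sum_rooted_upper[OF _ trees_D(2)[OF T]])
        fix y assume y: "y \<in> {1..n}"
        have "(\<Sum>x\<in>{1..n} - {y}. b {y, x}) \<le> (\<Sum>x\<in>{1..n}. b {y, x})"
          using b0 by (intro sum_mono2) auto
        also have "\<dots> = 2 * (real (d y) * M / M)"
          by (simp add: b_pair sum_distrib_left[symmetric] sum_divide_distrib[symmetric] M_eq)
        finally show "(\<Sum>x\<in>{1..n} - {y}. b {y, x}) \<le> 2 * real (d y)" using M_pos by simp
      qed (use k d_pos b0 in auto)
      also have "\<dots> \<le> 2 ^ k * M" unfolding M_eq by (intro mult_mono power_increasing) (auto simp: sum_nonneg)
      finally show "tree_sum n d (\<lambda>_. 1) b {1..k} T \<le> 2 ^ k * M" .
    qed (use delta_bounds in auto)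
    finally show ?thesis by (simp add: mult_ac)
  qed
  then have "L_q k n d \<le> 1 / M * (real (card (trees k)) * (real (card ([{1..k}]\<^bsup>2\<^esup>)) * 7 * 2 ^ k * \<delta> * M))"
    unfolding L_q_def tree_distance_eq using M_pos by (intro mult_left_mono sum_bounded_above) auto
  then show ?thesis using M_pos by simp
qed

end

theorem theorem2p25:
  fixes k :: nat
  assumes "k \<ge> 1"
  shows "\<exists>c::real. c > 0 \<and>
    (\<forall>(\<epsilon>::real) (a::real) (D :: nat \<Rightarrow> nat \<Rightarrow> nat).
       \<epsilon> > 0 \<longrightarrow> 1/2 < a \<longrightarrow> a < 1 \<longrightarrow>
       (\<forall>\<^sub>F n in sequentially. strict_graphic \<epsilon> n (D n)) \<longrightarrow>
       (\<lambda>n. (real (D n n))\<^sup>2) \<in> o(\<lambda>n. real (deg_sum n (D n))) \<longrightarrow>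
       (\<lambda>n. (real n / real (deg_sum n (D n))) powr (1/2) * real n powr (3 * (a - 1/2)))
          \<longlonglongrightarrow> 0 \<longrightarrow>
       (\<forall>\<^sub>F n in sequentially.
          L_a a k n (D n)
            \<le> c * ((real n / real (deg_sum n (D n))) powr (1/4) * real n powr (a - 1/2)) \<and>
          L_g k n (D n)
            \<le> c * ((real n / real (deg_sum n (D n))) powr (1/4) * real n powr (a - 1/2)
                    + (real (D n n))\<^sup>2 / real (deg_sum n (D n))) \<and>
          L_q k n (D n)
            \<le> c * ((real n / real (deg_sum n (D n))) powr (1/4) * real n powr (a - 1/2)
                    + (real (D n n))\<^sup>2 / real (deg_sum n (D n)))))"
proof -
  \<comment> \<open>The constants of \<open>uniform_L_bound\<close>, with
    \<open>lipschitz_const\<close> written out, and of \<open>L_q_bound\<close>; both depend on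
    \<open>k\<close> alone.\<close>
  define c1 where "c1 = real (card (trees k)) * (4 * (real (card ({1..k} \<times> {1..k})) * 2 ^ card {1..k})
     + real k * 2 ^ k * (1 + real k))"
  define c2 where "c2 = real (card (trees k)) * (real (card ([{1..k}]\<^bsup>2\<^esup>)) * 7 * 2 ^ k)"
  have c0: "0 \<le> c1" "0 \<le> c2" by (auto simp: c1_def c2_def)
  show ?thesis
  proof (intro exI[of _ "c1 + c2 + 1"] conjI allI impI)
    show "0 < c1 + c2 + 1" using c0 by linarith
    fix \<epsilon> a :: real and D :: "nat \<Rightarrow> nat \<Rightarrow> nat"
    assume a: "1 / 2 < a" "a < 1"
      and graphic: "\<forall>\<^sub>F n in sequentially. strict_graphic \<epsilon> n (D n)"
      and small: "(\<lambda>n. (real (D n n))\<^sup>2) \<in> o(\<lambda>n. real (deg_sum n (D n)))"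
      and lim: "(\<lambda>n. (real n / real (deg_sum n (D n))) powr (1/2) * real n powr (3 * (a - 1/2))) \<longlonglongrightarrow> 0"
    have "\<forall>\<^sub>F n in sequentially. norm ((real (D n n))\<^sup>2) \<le> 1 / 24 * norm (real (deg_sum n (D n)))"
      by (rule landau_o.smallD[OF small]) simp
    moreover have "\<forall>\<^sub>F n in sequentially. (real n / real (deg_sum n (D n))) powr (1/2) * real n powr (3 * (a - 1/2)) < 1"
      by (rule order_tendstoD(2)[OF lim]) simp
    moreover have "\<forall>\<^sub>F n in sequentially. 42 * ln (real n) \<le> real n powr (a - 1 / 2)"
      using a by real_asymp
    ultimately show "\<forall>\<^sub>F n in sequentially.
          L_a a k n (D n)
            \<le> (c1 + c2 + 1) * ((real n / real (deg_sum n (D n))) powr (1/4) * real n powr (a - 1/2)) \<and>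
          L_g k n (D n)
            \<le> (c1 + c2 + 1) * ((real n / real (deg_sum n (D n))) powr (1/4) * real n powr (a - 1/2)
                    + (real (D n n))\<^sup>2 / real (deg_sum n (D n))) \<and>
          L_q k n (D n)
            \<le> (c1 + c2 + 1) * ((real n / real (deg_sum n (D n))) powr (1/4) * real n powr (a - 1/2)
                    + (real (D n n))\<^sup>2 / real (deg_sum n (D n)))"
      using graphic eventually_ge_at_top[of 1]
    proof eventually_elim
      case (elim n)
      have "real (24 * (D n n)\<^sup>2) \<le> real (deg_sum n (D n))" using elim(1) by simp
      then have "24 * (D n n)\<^sup>2 \<le> deg_sum n (D n)" by (rule of_nat_le_iff[THEN iffD1])
      then interpret sparse_degree_sequence n "D n"
        using elim(4,5) by unfold_locales (auto simp: strict_graphic_def)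
      define \<alpha> where "\<alpha> = a - 1 / 2"
      have \<alpha>: "0 < \<alpha>" "42 * ln (real n) \<le> real n powr \<alpha>" using a elim(3) by (auto simp: \<alpha>_def)
      \<comment> \<open>As \<open>n powr (2 * \<alpha>) \<le> n powr (3 * \<alpha>)\<close>, the
        limit hypothesis bounds \<open>eta \<alpha>\<close> by 1 for large \<open>n\<close>.\<close>
      have "(eta \<alpha>)\<^sup>2 \<le> (real n / M) powr (1 / 2) * real n powr (3 * \<alpha>)"
        unfolding eta_squared using elim(5) \<alpha>(1) by (intro mult_left_mono powr_mono) auto
      also have "\<dots> < 1" using elim(2) by (simp add: \<alpha>_def)
      finally have e1: "eta \<alpha> \<le> 1" using eta_pos[of \<alpha>] power2_le_imp_le[of "eta \<alpha>" 1] by simp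
      have "L_a a k n (D n) \<le> c1 * eta \<alpha>"
        unfolding L_a_def G_a_def c1_def lipschitz_const_def[symmetric]
        using graphs_almost_degrees_bounded[OF a]
        by (intro uniform_L_bound graphs_with_degrees_subset \<alpha> e1 assms) (auto simp: \<alpha>_def)
      moreover have "L_g k n (D n) \<le> c1 * eta \<alpha>"
        unfolding L_g_def G_g_def c1_def lipschitz_const_def[symmetric]
        using graphs_with_degrees_bounded
        by (intro uniform_L_bound \<alpha> e1 assms) (auto simp: M_pos less_imp_le)
      moreover have "L_q k n (D n) \<le> c2 * \<delta>" unfolding c2_def by (rule L_q_bound[OF assms])
      moreover have "0 \<le> c1 * \<delta>" "0 \<le> c2 * \<delta>" "0 \<le> c1 * eta \<alpha>" "0 \<le> c2 * eta \<alpha>" "0 < eta \<alpha>" "0 < \<delta>"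
        using c0 delta_bounds eta_pos[of \<alpha>] by auto
      ultimately have "L_a a k n (D n) \<le> (c1 + c2 + 1) * eta \<alpha>"
        "L_g k n (D n) \<le> (c1 + c2 + 1) * (eta \<alpha> + \<delta>)" "L_q k n (D n) \<le> (c1 + c2 + 1) * (eta \<alpha> + \<delta>)"
        by (simp_all add: distrib_left distrib_right)
      then show ?case by (simp add: eta_def \<delta>_def \<alpha>_def)
    qed
  qed
qed

end
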